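(* Let $P$ be a precubical set with boundary operators $d_i^k$, let $b \in \{0,1\}$, and let $x \in P_1$ be a regular element such that (i) there is no element $y \in P_1 \setminus \{x\}$ such that $d_1^{1-b}y = d_1^{1-b}x$, (ii) no element in $P_1$ having $d_1^{1-b}x$ in its boundary belongs to the boundary of an element in $P_2$. Consider the set $Y = \{y \in P_1 \mid d_1^b y = d_1^{1-b}x\}$. Define $Q_0 = P_0 \setminus \{d_1^{1-b}x\}$, $Q_1 = P_1 \setminus \{x\}$, $Q_r = P_r$ for $r > 1$, and operators $D_i^k$ on $Q=(Q_r)_{r\ge 0}$ by $$D_i^k z = \begin{cases} d_1^b x, & z \in Y,\ i = 1,\ k = b,\\ d_i^k z, & \text{else.}\end{cases}$$ Then $Q$ with the boundary operators $D_i^k$ is a precubical set such that $Y \subseteq Q_1$, $Q \setminus Y$ is a common precubical subset of $P$ and $Q$, and $|P|$ and $|Q|$ are dihomotopy equivalent relative to $|Q \setminus Y|$. Moreover, if $Y \neq \emptyset$, then $\mathrm{Extrl}(P) = \mathrm{Extrl}(Q) \subseteq Q \setminus Y$, the fundamental bipartite graphs of $|P|$ and $|Q|$ are isomorphic, and for each pair of extremal elements $v,w \in \mathrm{Extrl}(P)$ the d-path spaces $\vec{\mathcal P}(|P|)([v,()],[w,()])$ and $\vec{\mathcal P}(|Q|)([v,()],[w,()])$ are homotopy equivalent.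
   Context: Precubical sets. $I=[0,1]$. A precubical set is a graded set $P=(P_n)_{n\ge 0}$ with boundary operators $d_i^k: P_n \to P_{n-1}$ ($n>0$, $k=0,1$, $i=1,\dots,n$) satisfying $d_i^k\circ d_j^l = d_{j-1}^l\circ d_i^k$ ($k,l=0,1$, $i<j$). Elements of $P_0$ are called vertices. An element is in the boundary of $z$ if it is obtained from $z$ by applying one or more boundary operators. A morphism of precubical sets is a morphism of graded sets compatible with the boundary operators. A precubical subset of $P$ is a precubical set $Q$ with $Q_n\subseteq P_n$ for all $n$ whose boundary operators coincide with those of $P$ on $Q$. $Q\setminus Y$ denotes the graded set obtained from $Q$ by removing the elements of $Y$. Regular elements. Let $\Box$ be the category whose objects are the standard cubes $I^n$ ($n\geq 0$, $I^0=\{()\}$) and whose non-identity morphisms are composites of the maps $\delta_i^k: I^n\to I^{n+1}$ ($i\in\{1,\dots,n+1\}$, $k\in\{0,1\}$), $\delta_i^k(u_1,\dots,u_n)=(u_1,\dots,u_{i-1},k,u_i,\dots,u_n)$. Precubical sets are the presheaves on $\Box$. Let $\mathbb I^n=\Box(-,I^n)$. For $x\in P_n$ let $x_\sharp:\mathbb I^n\to P$ be the unique morphism with $x_\sharp(\mathrm{id}_{I^n})=x$; $x$ is regular if $x_\sharp$ is injective. d-spaces. A d-space is a topological space $X$ with a set $dX\subseteq X^I$ of paths (called d-paths) containing all constant paths and closed under composition with (not necessarily strictly) increasing continuous maps $I\to I$ and under concatenation. A d-map is a continuous map $f$ between d-spaces such that $f\circ\omega$ is a d-path for each d-path $\omega$.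 A d-subspace $A$ of $X$ is a subspace with $dA=\{\omega\in A^I \mid \omega \text{ is a d-path when regarded as a path in } X\}$. Geometric realization. $|P|=(\coprod_{n\ge 0}P_n\times I^n)/\sim$ with $P_n$ discrete and $\sim$ generated by $(d_i^kx,u)\sim(x,\delta_i^k(u))$; classes are written $[x,u]$. Its d-paths are the increasing reparametrizations of finite concatenations of paths of the form $t\mapsto[x,\alpha(t)]$, where $x\in P_n$ and $\alpha:I\to I^n$ is continuous and order-preserving (componentwise order on $I^n$). If $Q$ is a precubical subset of $P$, then $|Q|$ is regarded as a d-subspace of $|P|$. Dihomotopy. For d-maps $f,g:X\to Y$ coinciding on a d-subspace $A$ of $X$, a dihomotopy relative to $A$ from $f$ to $g$ is a homotopy $H:X\times I\to Y$ from $f$ to $g$ such that each $H(-,t)$ is a d-map which coincides with $f$ and $g$ on $A$; $f,g$ are then called dihomotopic relative to $A$. If $X$ and $Y$ are d-spaces with a common d-subspace $A$, a d-map $f:X\to Y$ with $f(a)=a$ for all $a\in A$ is a dihomotopy equivalence relative to $A$ if there is a d-map $g:Y\to X$ with $g(a)=a$ for all $a\in A$ such that $g\circ f$ and $f\circ g$ are dihomotopic relative to $A$ to the identities. $X$ and $Y$ are dihomotopy equivalent relative to $A$ if such an $f$ exists. Extremal elements and fundamental bipartite graph. A vertex $v\in P_0$ is minimal (maximal) if there is no $x\in P_1$ with $d_1^1x=v$ ($d_1^0x=v$); it is extremal if it is minimal or maximal. $\mathrm{Extrl}(P)$ is the $0$-dimensional precubical subset of extremal elements. The fundamental category $\vec\pi_1(X)$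 of a d-space $X$ has the points of $X$ as objects and, as morphisms from $x$ to $y$, the dihomotopy classes relative to $\{0,1\}$ (endpoints fixed) of d-paths from $x$ to $y$ (composition by concatenation). A point $a\in X$ is minimal (maximal) if any morphism in $\vec\pi_1(X)$ with target (source) $a$ has source (target) $a$, and extremal if it is minimal or maximal; $\mathrm{Extrl}(X)$ is the d-subspace of extremal points. The fundamental bipartite graph of $X$ is the full subcategory $\vec\pi_1(X,\mathrm{Extrl}(X))$ of $\vec\pi_1(X)$ on $\mathrm{Extrl}(X)$. For $a,b\in X$, the d-path space $\vec{\mathcal P}(X)(a,b)$ is the subspace of $X^I$ (compact-open topology) of d-paths from $a$ to $b$. *)

theory Defs
  imports "HOL-Analysis.Analysis"
begin

section \<open>Precubical sets\<close>

text \<open>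
  The boundary operator \<open>d\<^sub>i\<^sup>k : P\<^sub>n \<rightarrow> P\<^sub>n\<^sub>-\<^sub>1\<close> is \<open>bdry P n k i\<close>. The dimension \<open>n\<close> is an
  explicit argument, so the sets \<open>cells P n\<close> need not be disjoint for different \<open>n\<close>.
\<close>

record 'a precubical =
  cells :: "nat \<Rightarrow> 'a set"
  bdry :: "nat \<Rightarrow> nat \<Rightarrow> nat \<Rightarrow> 'a \<Rightarrow> 'a"

definition precubical_set :: "'a precubical \<Rightarrow> bool" where
  "precubical_set P \<longleftrightarrow>
     (\<forall>n>0. \<forall>k\<in>{0,1}. \<forall>i\<in>{1..n}. \<forall>z\<in>cells P n. bdry P n k i z \<in> cells P (n - 1)) \<and>
     (\<forall>n. \<forall>k\<in>{0,1}. \<forall>l\<in>{0,1}. \<forall>i j. 1 \<le> i \<and> i < j \<and> j \<le> n \<longrightarrow>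
        (\<forall>z\<in>cells P n. bdry P (n - 1) k i (bdry P n l j z) =
                        bdry P (n - 1) l (j - 1) (bdry P n k i z)))"

text \<open>\<open>in_boundary P m y n z\<close>: the element \<open>y\<close> of degree \<open>m\<close> is in the boundary of the
  element \<open>z\<close> of degree \<open>n\<close>.\<close>

inductive in_boundary :: "'a precubical \<Rightarrow> nat \<Rightarrow> 'a \<Rightarrow> nat \<Rightarrow> 'a \<Rightarrow> bool" for P where
  face: "\<lbrakk>n > 0; k \<in> {0,1}; i \<in> {1..n}; z \<in> cells P n\<rbrakk>
           \<Longrightarrow> in_boundary P (n - 1) (bdry P n k i z) n z"
| face_trans: "\<lbrakk>in_boundary P m y n z; m > 0; k \<in> {0,1}; i \<in> {1..m}\<rbrakk>
           \<Longrightarrow> in_boundary P (m - 1) (bdry P m k i y) n z"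

definition precubical_morphism ::
    "'a precubical \<Rightarrow> 'b precubical \<Rightarrow> (nat \<Rightarrow> 'a \<Rightarrow> 'b) \<Rightarrow> bool" where
  "precubical_morphism P Q f \<longleftrightarrow>
     (\<forall>n. f n ` cells P n \<subseteq> cells Q n) \<and>
     (\<forall>n>0. \<forall>k\<in>{0,1}. \<forall>i\<in>{1..n}. \<forall>z\<in>cells P n.
        f (n - 1) (bdry P n k i z) = bdry Q n k i (f n z))"

definition precubical_subset :: "'a precubical \<Rightarrow> 'a precubical \<Rightarrow> bool" where
  "precubical_subset Q P \<longleftrightarrow>
     precubical_set Q \<and> precubical_set P \<and> (\<forall>n. cells Q n \<subseteq> cells P n) \<and>
     (\<forall>n>0. \<forall>k\<in>{0,1}. \<forall>i\<in>{1..n}. \<forall>z\<in>cells Q n. bdry Q n k i z = bdry P n k i z)"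

text \<open>The operators of a restriction are \<open>undefined\<close> outside their domains, so that two
  restrictions are equal as records as soon as their cells and their boundary operators on
  these cells agree.\<close>

definition restrict_cells :: "'a precubical \<Rightarrow> (nat \<Rightarrow> 'a set) \<Rightarrow> 'a precubical" where
  "restrict_cells P S =
     \<lparr>cells = S,
      bdry = (\<lambda>n k i z. if z \<in> S n \<and> k \<in> {0,1} \<and> i \<in> {1..n} then bdry P n k i z else undefined)\<rparr>"

definition remove_cells :: "'a precubical \<Rightarrow> (nat \<Rightarrow> 'a set) \<Rightarrow> 'a precubical" where
  "remove_cells P Z = restrict_cells P (\<lambda>n. cells P n - Z n)"

definition minimal_vertex :: "'a precubical \<Rightarrow> 'a \<Rightarrow> bool" where
  "minimal_vertex P v \<longleftrightarrow> v \<in> cells P 0 \<and> \<not> (\<exists>x\<in>cells P 1. bdry P 1 1 1 x = v)"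

definition maximal_vertex :: "'a precubical \<Rightarrow> 'a \<Rightarrow> bool" where
  "maximal_vertex P v \<longleftrightarrow> v \<in> cells P 0 \<and> \<not> (\<exists>x\<in>cells P 1. bdry P 1 0 1 x = v)"

definition Extrl :: "'a precubical \<Rightarrow> 'a precubical" where
  "Extrl P = restrict_cells P
     (\<lambda>n. if n = 0 then {v. minimal_vertex P v \<or> maximal_vertex P v} else {})"


section \<open>Standard cubes and regular elements\<close>

text \<open>\<open>I\<^sup>n\<close> consists of the functions \<open>{1..n} \<rightarrow> [0,1]\<close> with value \<open>undefined\<close> outside
  \<open>{1..n}\<close>, the unique point of \<open>I\<^sup>0\<close> being \<open>\<lambda>_. undefined\<close>.\<close>

definition cube_top :: "nat \<Rightarrow> (nat \<Rightarrow> real) topology" where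
  "cube_top n = product_topology (\<lambda>_. top_of_set {0..1}) {1..n}"

abbreviation cube :: "nat \<Rightarrow> (nat \<Rightarrow> real) set" where
  "cube n \<equiv> topspace (cube_top n)"

lemma cube_eq: "cube n = ({1..n} \<rightarrow>\<^sub>E {0..1})"
  by (simp add: cube_top_def)

text \<open>\<open>coface n k i\<close> is \<open>\<delta>\<^sub>i\<^sup>k : I\<^sup>n \<rightarrow> I\<^sup>n\<^sup>+\<^sup>1\<close>.\<close>

definition coface :: "nat \<Rightarrow> nat \<Rightarrow> nat \<Rightarrow> (nat \<Rightarrow> real) \<Rightarrow> (nat \<Rightarrow> real)" where
  "coface n k i u =
     (\<lambda>j\<in>{1..Suc n}. if j < i then u j else if j = i then real k else u (j - 1))"

text \<open>\<open>box_hom m n f\<close>: \<open>f\<close> is a morphism \<open>I\<^sup>m \<rightarrow> I\<^sup>n\<close> of the category \<open>\<box>\<close>.\<close>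

inductive box_hom :: "nat \<Rightarrow> nat \<Rightarrow> ((nat \<Rightarrow> real) \<Rightarrow> (nat \<Rightarrow> real)) \<Rightarrow> bool" where
  ident: "box_hom n n (\<lambda>u\<in>cube n. u)"
| comp: "\<lbrakk>box_hom m n f; k \<in> {0,1}; i \<in> {1..Suc n}\<rbrakk>
           \<Longrightarrow> box_hom m (Suc n) (compose (cube m) (coface n k i) f)"

definition representable_cube :: "nat \<Rightarrow> ((nat \<Rightarrow> real) \<Rightarrow> (nat \<Rightarrow> real)) precubical" where
  "representable_cube n =
     \<lparr>cells = (\<lambda>m. {f. box_hom m n f}),
      bdry = (\<lambda>m k i f. compose (cube (m - 1)) f (coface (m - 1) k i))\<rparr>"

text \<open>By the Yoneda lemma, the morphism \<open>f = x\<^sub>\<sharp>\<close> below exists and is unique (on cells).\<close>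

definition regular :: "'a precubical \<Rightarrow> nat \<Rightarrow> 'a \<Rightarrow> bool" where
  "regular P n x \<longleftrightarrow>
     x \<in> cells P n \<and>
     (\<exists>f. precubical_morphism (representable_cube n) P f \<and> f n (\<lambda>u\<in>cube n. u) = x \<and>
          (\<forall>m. inj_on (f m) (cells (representable_cube n) m)))"


section \<open>d-spaces\<close>

text \<open>\<open>path_set X\<close> is \<open>X\<^sup>I\<close>. Paths have value \<open>undefined\<close> outside \<open>[0,1]\<close>.\<close>

definition path_set :: "'p topology \<Rightarrow> (real \<Rightarrow> 'p) set" where
  "path_set X = {\<omega> \<in> extensional {0..1}. pathin X \<omega>}"

definition increasing_map :: "(real \<Rightarrow> real) \<Rightarrow> bool" where
  "increasing_map \<phi> \<longleftrightarrow>
     \<phi> ` {0..1} \<subseteq> {0..1} \<and> continuous_on {0..1} \<phi> \<and> mono_on {0..1} \<phi>"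

definition concat_path :: "(real \<Rightarrow> 'p) \<Rightarrow> (real \<Rightarrow> 'p) \<Rightarrow> (real \<Rightarrow> 'p)" where
  "concat_path \<omega> \<eta> = (\<lambda>t\<in>{0..1}. if t \<le> 1/2 then \<omega> (2 * t) else \<eta> (2 * t - 1))"

record 'p dspace =
  dtop :: "'p topology"
  dpaths :: "(real \<Rightarrow> 'p) set"

definition dspace :: "'p dspace \<Rightarrow> bool" where
  "dspace X \<longleftrightarrow>
     dpaths X \<subseteq> path_set (dtop X) \<and>
     (\<forall>a\<in>topspace (dtop X). (\<lambda>t\<in>{0..1}. a) \<in> dpaths X) \<and>
     (\<forall>\<omega>\<in>dpaths X. \<forall>\<phi>. increasing_map \<phi> \<longrightarrow> compose {0..1} \<omega> \<phi> \<in> dpaths X) \<and>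
     (\<forall>\<omega>\<in>dpaths X. \<forall>\<eta>\<in>dpaths X. \<omega> 1 = \<eta> 0 \<longrightarrow> concat_path \<omega> \<eta> \<in> dpaths X)"

definition d_map :: "'p dspace \<Rightarrow> 'q dspace \<Rightarrow> ('p \<Rightarrow> 'q) \<Rightarrow> bool" where
  "d_map X Y f \<longleftrightarrow>
     dspace X \<and> dspace Y \<and> continuous_map (dtop X) (dtop Y) f \<and>
     (\<forall>\<omega>\<in>dpaths X. compose {0..1} f \<omega> \<in> dpaths Y)"

text \<open>\<open>i\<close> identifies \<open>A\<close> with the d-subspace of \<open>X\<close> on the image of \<open>i\<close>.\<close>

definition d_embedding :: "'p dspace \<Rightarrow> 'q dspace \<Rightarrow> ('p \<Rightarrow> 'q) \<Rightarrow> bool" where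
  "d_embedding A X i \<longleftrightarrow>
     dspace A \<and> dspace X \<and> embedding_map (dtop A) (dtop X) i \<and>
     (\<forall>\<omega>\<in>path_set (dtop A). \<omega> \<in> dpaths A \<longleftrightarrow> compose {0..1} i \<omega> \<in> dpaths X)"

text \<open>The homotopies in \<^const>\<open>homotopic_with\<close> have the parameter in the first argument.\<close>

definition dihomotopic_rel ::
    "'p set \<Rightarrow> 'p dspace \<Rightarrow> 'q dspace \<Rightarrow> ('p \<Rightarrow> 'q) \<Rightarrow> ('p \<Rightarrow> 'q) \<Rightarrow> bool" where
  "dihomotopic_rel A X Y f g \<longleftrightarrow>
     homotopic_with (\<lambda>h. d_map X Y h \<and> (\<forall>a\<in>A. h a = f a \<and> h a = g a)) (dtop X) (dtop Y) f g"

text \<open>A common d-subspace \<open>A\<close> of \<open>X\<close> and \<open>Y\<close> is given together with its inclusions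
  \<open>i : A \<rightarrow> X\<close> and \<open>j : A \<rightarrow> Y\<close>; the condition \<open>f a = a\<close> becomes \<open>f (i a) = j a\<close>.\<close>

definition dihomotopy_equivalence_rel ::
    "'r dspace \<Rightarrow> ('r \<Rightarrow> 'p) \<Rightarrow> ('r \<Rightarrow> 'q) \<Rightarrow> 'p dspace \<Rightarrow> 'q dspace \<Rightarrow> ('p \<Rightarrow> 'q) \<Rightarrow> bool" where
  "dihomotopy_equivalence_rel A i j X Y f \<longleftrightarrow>
     d_embedding A X i \<and> d_embedding A Y j \<and>
     d_map X Y f \<and> (\<forall>a\<in>topspace (dtop A). f (i a) = j a) \<and>
     (\<exists>g. d_map Y X g \<and> (\<forall>a\<in>topspace (dtop A). g (j a) = i a) \<and>
          dihomotopic_rel (i ` topspace (dtop A)) X X (g \<circ> f) id \<and>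
          dihomotopic_rel (j ` topspace (dtop A)) Y Y (f \<circ> g) id)"

definition dihomotopy_equivalent_rel ::
    "'r dspace \<Rightarrow> ('r \<Rightarrow> 'p) \<Rightarrow> ('r \<Rightarrow> 'q) \<Rightarrow> 'p dspace \<Rightarrow> 'q dspace \<Rightarrow> bool" where
  "dihomotopy_equivalent_rel A i j X Y \<longleftrightarrow> (\<exists>f. dihomotopy_equivalence_rel A i j X Y f)"


section \<open>Geometric realization\<close>

definition coproduct_top :: "'a precubical \<Rightarrow> (nat \<times> 'a \<times> (nat \<Rightarrow> real)) topology" where
  "coproduct_top P =
     sum_topology (\<lambda>n. prod_topology (discrete_topology (cells P n)) (cube_top n)) UNIV"

inductive glue :: "'a precubical \<Rightarrow> nat \<times> 'a \<times> (nat \<Rightarrow> real) \<Rightarrow> nat \<times> 'a \<times> (nat \<Rightarrow> real) \<Rightarrow> bool"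
  for P where
  "\<lbrakk>z \<in> cells P (Suc n); u \<in> cube n; k \<in> {0,1}; i \<in> {1..Suc n}\<rbrakk>
     \<Longrightarrow> glue P (n, bdry P (Suc n) k i z, u) (Suc n, z, coface n k i u)"

definition real_equiv :: "'a precubical \<Rightarrow> (nat \<times> 'a \<times> (nat \<Rightarrow> real)) rel" where
  "real_equiv P = {(p, q). p \<in> topspace (coproduct_top P) \<and> q \<in> topspace (coproduct_top P) \<and>
                           equivclp (glue P) p q}"

type_synonym 'a real_point = "(nat \<times> 'a \<times> (nat \<Rightarrow> real)) set"

text \<open>\<open>real_class P n z u\<close> is the point \<open>[z,u]\<close> of \<open>|P|\<close>, where \<open>z\<close> has degree \<open>n\<close>.\<close>

definition real_class :: "'a precubical \<Rightarrow> nat \<Rightarrow> 'a \<Rightarrow> (nat \<Rightarrow> real) \<Rightarrow> 'a real_point" where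
  "real_class P n z u = real_equiv P `` {(n, z, u)}"

abbreviation vertex_point :: "'a precubical \<Rightarrow> 'a \<Rightarrow> 'a real_point" where
  "vertex_point P v \<equiv> real_class P 0 v (\<lambda>_. undefined)"

definition quotient_top :: "'p topology \<Rightarrow> ('p \<Rightarrow> 'q) \<Rightarrow> 'q topology" where
  "quotient_top X q =
     topology (\<lambda>U. U \<subseteq> q ` topspace X \<and> openin X {p \<in> topspace X. q p \<in> U})"

lemma openin_quotient_top:
  "openin (quotient_top X q) U \<longleftrightarrow>
     U \<subseteq> q ` topspace X \<and> openin X {p \<in> topspace X. q p \<in> U}"
proof -
  have 1: "{p \<in> topspace X. q p \<in> S \<inter> T} =
        {p \<in> topspace X. q p \<in> S} \<inter> {p \<in> topspace X. q p \<in> T}" for S T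
    by auto
  have 2: "{p \<in> topspace X. q p \<in> \<Union>\<K>} = (\<Union>K\<in>\<K>. {p \<in> topspace X. q p \<in> K})" for \<K>
    by auto
  have "istopology (\<lambda>U. U \<subseteq> q ` topspace X \<and> openin X {p \<in> topspace X. q p \<in> U})"
    unfolding istopology_def 1 2 by blast
  then show ?thesis
    by (simp add: quotient_top_def)
qed

lemma quotient_map_quotient_top: "quotient_map X (quotient_top X q) q"
proof -
  have "{p \<in> topspace X. q p \<in> q ` topspace X} = topspace X"
    by auto
  then have "openin (quotient_top X q) (q ` topspace X)"
    by (simp add: openin_quotient_top)
  then have "topspace (quotient_top X q) = q ` topspace X"
    by (meson openin_quotient_top openin_subset openin_topspace subset_antisym)
  then show ?thesis
    by (auto simp: quotient_map_def openin_quotient_top)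
qed

definition realization_top :: "'a precubical \<Rightarrow> 'a real_point topology" where
  "realization_top P = quotient_top (coproduct_top P) (\<lambda>p. real_equiv P `` {p})"

definition elementary_dpath :: "'a precubical \<Rightarrow> (real \<Rightarrow> 'a real_point) \<Rightarrow> bool" where
  "elementary_dpath P \<omega> \<longleftrightarrow>
     (\<exists>n z \<alpha>. z \<in> cells P n \<and> continuous_map (top_of_set {0..1}) (cube_top n) \<alpha> \<and>
        (\<forall>s t. 0 \<le> s \<and> s \<le> t \<and> t \<le> 1 \<longrightarrow> (\<forall>i\<in>{1..n}. \<alpha> s i \<le> \<alpha> t i)) \<and>
        \<omega> = (\<lambda>t\<in>{0..1}. real_class P n z (\<alpha> t)))"

inductive concat_dpath :: "'a precubical \<Rightarrow> (real \<Rightarrow> 'a real_point) \<Rightarrow> bool" for P where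
  elementary: "elementary_dpath P \<omega> \<Longrightarrow> concat_dpath P \<omega>"
| concat: "\<lbrakk>concat_dpath P \<omega>; concat_dpath P \<eta>; \<omega> 1 = \<eta> 0\<rbrakk> \<Longrightarrow> concat_dpath P (concat_path \<omega> \<eta>)"

definition realization :: "'a precubical \<Rightarrow> 'a real_point dspace" where
  "realization P =
     \<lparr>dtop = realization_top P,
      dpaths = {compose {0..1} \<omega> \<phi> | \<omega> \<phi>. concat_dpath P \<omega> \<and> increasing_map \<phi>}\<rparr>"

text \<open>For a precubical subset \<open>R\<close> of \<open>P\<close>, \<open>realization_incl P\<close> is the inclusion of \<open>|R|\<close> in
  \<open>|P|\<close>: it maps the point \<open>[z,u]\<close> of \<open>|R|\<close> to the point \<open>[z,u]\<close> of \<open>|P|\<close>.\<close>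

definition realization_incl :: "'a precubical \<Rightarrow> 'a real_point \<Rightarrow> 'a real_point" where
  "realization_incl P c = real_equiv P `` c"


section \<open>Categories\<close>

text \<open>\<open>Comp C x y z f g\<close> is the composite of \<open>f : x \<rightarrow> y\<close> followed by \<open>g : y \<rightarrow> z\<close>.\<close>

record ('o, 'm) category =
  Obj :: "'o set"
  Hom :: "'o \<Rightarrow> 'o \<Rightarrow> 'm set"
  Comp :: "'o \<Rightarrow> 'o \<Rightarrow> 'o \<Rightarrow> 'm \<Rightarrow> 'm \<Rightarrow> 'm"
  Ident :: "'o \<Rightarrow> 'm"

definition is_functor ::
    "('o, 'm) category \<Rightarrow> ('p, 'n) category \<Rightarrow> ('o \<Rightarrow> 'p) \<Rightarrow> ('o \<Rightarrow> 'o \<Rightarrow> 'm \<Rightarrow> 'n) \<Rightarrow> bool" where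
  "is_functor C D F G \<longleftrightarrow>
     F ` Obj C \<subseteq> Obj D \<and>
     (\<forall>x\<in>Obj C. \<forall>y\<in>Obj C. G x y ` Hom C x y \<subseteq> Hom D (F x) (F y)) \<and>
     (\<forall>x\<in>Obj C. G x x (Ident C x) = Ident D (F x)) \<and>
     (\<forall>x\<in>Obj C. \<forall>y\<in>Obj C. \<forall>z\<in>Obj C. \<forall>f\<in>Hom C x y. \<forall>g\<in>Hom C y z.
        G x z (Comp C x y z f g) = Comp D (F x) (F y) (F z) (G x y f) (G y z g))"

definition isomorphic_categories :: "('o, 'm) category \<Rightarrow> ('p, 'n) category \<Rightarrow> bool" where
  "isomorphic_categories C D \<longleftrightarrow>
     (\<exists>F G. is_functor C D F G \<and> bij_betw F (Obj C) (Obj D) \<and>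
        (\<forall>x\<in>Obj C. \<forall>y\<in>Obj C. bij_betw (G x y) (Hom C x y) (Hom D (F x) (F y))))"

definition full_subcategory :: "('o, 'm) category \<Rightarrow> 'o set \<Rightarrow> ('o, 'm) category" where
  "full_subcategory C S = C\<lparr>Obj := S\<rparr>"


section \<open>The fundamental category and the fundamental bipartite graph\<close>

text \<open>The directed interval: d-paths of \<open>X\<close> are the same as d-maps from it to \<open>X\<close>.\<close>

definition dinterval :: "real dspace" where
  "dinterval = \<lparr>dtop = top_of_set {0..1}, dpaths = {\<phi> \<in> extensional {0..1}. increasing_map \<phi>}\<rparr>"

definition dpaths_between :: "'p dspace \<Rightarrow> 'p \<Rightarrow> 'p \<Rightarrow> (real \<Rightarrow> 'p) set" where
  "dpaths_between X a b = {\<omega> \<in> dpaths X. \<omega> 0 = a \<and> \<omega> 1 = b}"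

definition dpath_class :: "'p dspace \<Rightarrow> (real \<Rightarrow> 'p) \<Rightarrow> (real \<Rightarrow> 'p) set" where
  "dpath_class X \<omega> = {\<eta> \<in> dpaths X. dihomotopic_rel {0,1} dinterval X \<omega> \<eta>}"

definition fundamental_category :: "'p dspace \<Rightarrow> ('p, (real \<Rightarrow> 'p) set) category" where
  "fundamental_category X =
     \<lparr>Obj = topspace (dtop X),
      Hom = (\<lambda>a b. dpath_class X ` dpaths_between X a b),
      Comp = (\<lambda>a b c f g. \<Union>\<omega>\<in>f. \<Union>\<eta>\<in>g. dpath_class X (concat_path \<omega> \<eta>)),
      Ident = (\<lambda>a. dpath_class X (\<lambda>t\<in>{0..1}. a))\<rparr>"

definition minimal_point :: "'p dspace \<Rightarrow> 'p \<Rightarrow> bool" where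
  "minimal_point X a \<longleftrightarrow>
     a \<in> topspace (dtop X) \<and>
     (\<forall>b\<in>topspace (dtop X). Hom (fundamental_category X) b a \<noteq> {} \<longrightarrow> b = a)"

definition maximal_point :: "'p dspace \<Rightarrow> 'p \<Rightarrow> bool" where
  "maximal_point X a \<longleftrightarrow>
     a \<in> topspace (dtop X) \<and>
     (\<forall>b\<in>topspace (dtop X). Hom (fundamental_category X) a b \<noteq> {} \<longrightarrow> b = a)"

definition extremal_points :: "'p dspace \<Rightarrow> 'p set" where
  "extremal_points X = {a. minimal_point X a \<or> maximal_point X a}"

definition fundamental_bipartite_graph :: "'p dspace \<Rightarrow> ('p, (real \<Rightarrow> 'p) set) category" where
  "fundamental_bipartite_graph X =
     full_subcategory (fundamental_category X) (extremal_points X)"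


section \<open>d-path spaces\<close>

definition compact_open_top :: "'p topology \<Rightarrow> (real \<Rightarrow> 'p) topology" where
  "compact_open_top X = topology_generated_by
     {{\<omega> \<in> path_set X. \<omega> ` K \<subseteq> U} | K U. compactin (top_of_set {0..1}) K \<and> openin X U}"

definition dpath_space :: "'p dspace \<Rightarrow> 'p \<Rightarrow> 'p \<Rightarrow> (real \<Rightarrow> 'p) topology" where
  "dpath_space X a b = subtopology (compact_open_top (dtop X)) (dpaths_between X a b)"

end

theory Submission
  imports Defs
begin

text \<open>
  The map \<open>f : |P| \<rightarrow> |Q|\<close> contracts \<open>x\<close> to its surviving end \<open>v\<^sub>1 = d\<^sub>1\<^sup>b x\<close>, and \<open>g : |Q| \<rightarrow> |P|\<close> sends
  every edge \<open>y \<in> Y\<close>, which starts (or ends) at \<open>v\<^sub>1\<close> in \<open>Q\<close>, to the concatenation of \<open>x\<close> and \<open>y\<close>.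
  Both composites are dihomotopic to the identity by sliding along \<open>x\<close> and by reparametrizing the
  edges in \<open>Y\<close>. These formulas are compatible with the gluing because by (i) and (ii) the removed
  vertex lies only on \<open>x\<close> and on the edges in \<open>Y\<close>, none of which is a face of a square.
  Directedness is checked on paths that are elementary on each piece of some subdivision, a
  description of the d-paths of a realization that is stable under reparametrization.

  The consequences for d-path spaces and fundamental categories follow by composing d-paths with
  \<open>f\<close>, \<open>g\<close> and the homotopies, as extremal vertices lie in the part that is kept fixed. The
  extremal points of \<open>|P|\<close> are its extremal vertices: a coordinate strictly between \<open>0\<close> and \<open>1\<close> can be
  moved both ways, and this changes the number of such coordinates, an invariant of the point;
  and a minimal vertex occurs in a cube only as its lowest corner.
\<close>

section \<open>Points and maps of geometric realizations\<close>

text \<open>Regularity of \<open>x\<close> enters as \<open>v0\<close> \<noteq> \<open>v1\<close>; a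
  loop could not be collapsed onto a surviving end. What shapes the proof is that every map,
  homotopy and invariant has to be given on representatives (n, z, u). Away from \<open>v0\<close>,
  \<open>x\<close> and \<open>Y\<close> the formula is always \<open>real_class\<close>, so all the
  content sits on edges, where a cube is an interval. There the distance from the end
  \<open>d^b\<close> is used as coordinate, which merges the cases b = 0 and b = 1. Two points are
  topologically delicate. A homotopy given cube by cube has to descend to the product of the
  realization with I, for which local compactness of I is used. And |R| must carry the topology and
  the d-paths inherited from |P| and from |Q|: the gluing in the larger set could identify more
  points, and a d-path of the larger set could pass through cells that are not in \<open>R\<close>.
  Both are excluded by a left inverse of the inclusion, using that the missing cells are vertices
  and edges.\<close>

lemma precubical_bdry:
  assumes "precubical_set P" "z \<in> cells P (Suc n)" "k \<in> {0,1}" "i \<in> {1..Suc n}"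
  shows "bdry P (Suc n) k i z \<in> cells P n"
  using assms unfolding precubical_set_def by (metis diff_Suc_1 zero_less_Suc)

section \<open>The disjoint union of the cubes\<close>

lemma topspace_coproduct [simp]:
  "topspace (coproduct_top P) = (SIGMA n:UNIV. cells P n \<times> cube n)"
  by (auto simp: coproduct_top_def)

text \<open>The cells carry the discrete topology, so different cubes do not interact: openness, and
  with it continuity on a realization, can be tested one cube at a time.\<close>

lemma openin_coproduct_top:
  "openin (coproduct_top P) W \<longleftrightarrow>
     W \<subseteq> topspace (coproduct_top P) \<and> (\<forall>n. \<forall>z\<in>cells P n. openin (cube_top n) {u. (n, z, u) \<in> W})"
proof
  assume W: "openin (coproduct_top P) W"
  then have "W \<subseteq> topspace (coproduct_top P)"
    using openin_subset by blast
  moreover have "openin (cube_top n) {u. (n, z, u) \<in> W}" if z: "z \<in> cells P n" for n z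
  proof -
    have "openin (prod_topology (discrete_topology (cells P n)) (cube_top n)) {x. (n, x) \<in> W}"
      using W by (auto simp: coproduct_top_def openin_sum_topology)
    then have op: "\<And>z u. (n, z, u) \<in> W \<Longrightarrow>
        \<exists>U V. openin (discrete_topology (cells P n)) U \<and> openin (cube_top n) V \<and>
              z \<in> U \<and> u \<in> V \<and> U \<times> V \<subseteq> {x. (n, x) \<in> W}"
      by (simp add: openin_prod_topology_alt)
    show ?thesis
    proof (subst openin_subopen, intro ballI)
      fix u assume "u \<in> {u. (n, z, u) \<in> W}"
      then obtain U V where "openin (cube_top n) V" "z \<in> U" "u \<in> V" "U \<times> V \<subseteq> {x. (n, x) \<in> W}"
        using op[of z u] by blast
      then show "\<exists>T. openin (cube_top n) T \<and> u \<in> T \<and> T \<subseteq> {u. (n, z, u) \<in> W}"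
        by (intro exI[of _ V]) auto
    qed
  qed
  ultimately show "W \<subseteq> topspace (coproduct_top P) \<and>
      (\<forall>n. \<forall>z\<in>cells P n. openin (cube_top n) {u. (n, z, u) \<in> W})"
    by blast
next
  assume W: "W \<subseteq> topspace (coproduct_top P) \<and>
      (\<forall>n. \<forall>z\<in>cells P n. openin (cube_top n) {u. (n, z, u) \<in> W})"
  show "openin (coproduct_top P) W"
    unfolding coproduct_top_def openin_sum_topology
  proof (intro conjI ballI)
    show "W \<subseteq> Sigma UNIV (topspace \<circ>
        (\<lambda>n. prod_topology (discrete_topology (cells P n)) (cube_top n)))"
      using W by auto
    fix n
    show "openin (prod_topology (discrete_topology (cells P n)) (cube_top n)) {x. (n, x) \<in> W}"
      unfolding openin_prod_topology_alt
    proof (intro allI impI)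
      fix z u assume zu: "(z, u) \<in> {x. (n, x) \<in> W}"
      then have "z \<in> cells P n"
        using W by auto
      then show "\<exists>U V. openin (discrete_topology (cells P n)) U \<and> openin (cube_top n) V \<and>
              z \<in> U \<and> u \<in> V \<and> U \<times> V \<subseteq> {x. (n, x) \<in> W}"
        using W zu by (intro exI[of _ "{z}"] exI[of _ "{u. (n, z, u) \<in> W}"]) auto
    qed
  qed
qed

text \<open>Joint continuity in a parameter is local on the cubes as well, since {n} x {z} x B is
  open in the coproduct for every open B in the cube.\<close>

lemma continuous_map_prod_coproduct:
  assumes "\<And>n z. z \<in> cells P n \<Longrightarrow> continuous_map (prod_topology T (cube_top n)) Z (\<lambda>(t, u). F t (n, z, u))"
  shows "continuous_map (prod_topology T (coproduct_top P)) Z (\<lambda>(t, p). F t p)"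
  unfolding continuous_map_def
proof (intro conjI allI impI)
  have "F t (n, z, u) \<in> topspace Z" if "t \<in> topspace T" "z \<in> cells P n" "u \<in> cube n" for t n z u
    using funcset_mem[OF continuous_map_funspace[OF assms[OF that(2)]], of "(t, u)"] that by simp
  then show "(\<lambda>(t, p). F t p) \<in> topspace (prod_topology T (coproduct_top P)) \<rightarrow> topspace Z"
    by auto
next
  fix U assume U: "openin Z U"
  let ?W = "{q \<in> topspace (prod_topology T (coproduct_top P)). (case q of (t, p) \<Rightarrow> F t p) \<in> U}"
  show "openin (prod_topology T (coproduct_top P)) ?W"
    unfolding openin_prod_topology_alt
  proof (intro allI impI)
    fix t p assume tp: "(t, p) \<in> ?W"
    obtain n z u where p: "p = (n, z, u)"
      by (cases p) auto
    have z: "z \<in> cells P n"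
      using tp p by auto
    have "openin (prod_topology T (cube_top n))
        {q \<in> topspace (prod_topology T (cube_top n)). (case q of (t, u) \<Rightarrow> F t (n, z, u)) \<in> U}"
      using assms[OF z] U unfolding continuous_map_def by blast
    moreover have "(t, u) \<in>
        {q \<in> topspace (prod_topology T (cube_top n)). (case q of (t, u) \<Rightarrow> F t (n, z, u)) \<in> U}"
      using tp p by auto
    ultimately obtain A B where AB: "openin T A" "openin (cube_top n) B" "t \<in> A" "u \<in> B"
        "A \<times> B \<subseteq> {q \<in> topspace (prod_topology T (cube_top n)).
           (case q of (t, u) \<Rightarrow> F t (n, z, u)) \<in> U}"
      unfolding openin_prod_topology_alt by meson
    have "openin (coproduct_top P) ({n} \<times> {z} \<times> B)"
      unfolding openin_coproduct_top
    proof (intro conjI allI ballI)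
      show "{n} \<times> {z} \<times> B \<subseteq> topspace (coproduct_top P)"
        using z openin_subset[OF AB(2)] by auto
      fix m y
      show "openin (cube_top m) {u. (m, y, u) \<in> {n} \<times> {z} \<times> B}"
        using AB(2) by (cases "m = n \<and> y = z") auto
    qed
    moreover have "A \<times> ({n} \<times> {z} \<times> B) \<subseteq> ?W"
      using AB(5) z by auto
    ultimately show "\<exists>U V. openin T U \<and> openin (coproduct_top P) V \<and> t \<in> U \<and> p \<in> V \<and> U \<times> V \<subseteq> ?W"
      using AB p by (intro exI[of _ A] exI[of _ "{n} \<times> {z} \<times> B"]) auto
  qed
qed

section \<open>Classes of points under the gluing relation\<close>

lemma coface_in_cube:
  assumes "u \<in> cube n" "k \<in> {0,1}" "i \<in> {1..Suc n}"
  shows "coface n k i u \<in> cube (Suc n)"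
proof -
  have u: "\<And>j. j \<in> {1..n} \<Longrightarrow> u j \<in> {0..1}"
    using assms by (auto simp: cube_eq PiE_iff)
  have "coface n k i u j \<in> {0..1}" if j: "j \<in> {1..Suc n}" for j
  proof -
    have "j \<in> {1..n}" if "j < i"
      using that j assms(3) by auto
    moreover have "j - 1 \<in> {1..n}" if "j > i"
      using that j assms(3) by auto
    ultimately show ?thesis
      using u[of j] u[of "j - 1"] j assms(2) by (auto simp: coface_def)
  qed
  then show ?thesis
    by (auto simp: cube_eq PiE_iff coface_def extensional_def)
qed

text \<open>The tool for telling points of a realization apart (with
  \<open>interior_coordinates\<close>, \<open>cube_vertex\<close> and \<open>point_in_subset\<close>
  as F), and for showing that maps given on representatives are well defined.\<close>

lemma equivclp_invariant:
  assumes "equivclp r p q" "\<And>p q. r p q \<Longrightarrow> F p = F q"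
  shows "F p = F q"
  using assms(1) by (induction rule: equivclp_induct) (use assms(2) in metis)+

lemma equiv_real_equiv: "equiv (topspace (coproduct_top P)) (real_equiv P)"
  by (rule equivI)
     (auto simp: real_equiv_def refl_on_def sym_def trans_def
           intro: equivclp_sym equivclp_trans simp del: topspace_coproduct)

lemma real_class_eq_iff:
  assumes "z \<in> cells P n" "u \<in> cube n" "z' \<in> cells P n'" "u' \<in> cube n'"
  shows "real_class P n z u = real_class P n' z' u' \<longleftrightarrow> equivclp (glue P) (n, z, u) (n', z', u')"
proof -
  have "real_class P n z u = real_class P n' z' u' \<longleftrightarrow> ((n, z, u), (n', z', u')) \<in> real_equiv P"
    unfolding real_class_def using equiv_real_equiv eq_equiv_class_iff
    by (metis (no_types, lifting) SigmaI UNIV_I assms topspace_coproduct)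
  then show ?thesis
    using assms by (simp add: real_equiv_def)
qed

lemma real_class_glue:
  assumes "precubical_set P" "z \<in> cells P (Suc n)" "u \<in> cube n" "k \<in> {0,1}" "i \<in> {1..Suc n}"
  shows "real_class P (Suc n) z (coface n k i u) = real_class P n (bdry P (Suc n) k i z) u"
proof -
  have "glue P (n, bdry P (Suc n) k i z, u) (Suc n, z, coface n k i u)"
    using assms by (intro glue.intros)
  then show ?thesis
    by (subst real_class_eq_iff[OF assms(2) coface_in_cube[OF assms(3-5)]
          precubical_bdry[OF assms(1,2,4,5)] assms(3)])
       (rule equivclp_sym, rule r_into_equivclp)
qed

lemma quotient_map_realization:
  "quotient_map (coproduct_top P) (realization_top P) (\<lambda>(n, z, u). real_class P n z u)"
proof -
  have "(\<lambda>p. real_equiv P `` {p}) = (\<lambda>(n, z, u). real_class P n z u)"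
    by (auto simp: real_class_def)
  then show ?thesis
    using quotient_map_quotient_top[of "coproduct_top P" "\<lambda>p. real_equiv P `` {p}"]
    by (simp add: realization_top_def)
qed

lemma topspace_realization:
  "topspace (realization_top P) = {real_class P n z u | n z u. z \<in> cells P n \<and> u \<in> cube n}"
  unfolding quotient_imp_surjective_map[OF quotient_map_realization[of P], symmetric]
    topspace_coproduct
  by (auto simp: image_iff Bex_def)

lemma real_class_in_topspace [intro]:
  "z \<in> cells P n \<Longrightarrow> u \<in> cube n \<Longrightarrow> real_class P n z u \<in> topspace (realization_top P)"
  by (auto simp: topspace_realization)

lemma realization_point_cases:
  assumes "c \<in> topspace (realization_top P)"
  obtains n z u where "z \<in> cells P n" "u \<in> cube n" "c = real_class P n z u"
  using assms by (auto simp: topspace_realization)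

lemma continuous_map_real_class:
  assumes "z \<in> cells P n"
  shows "continuous_map (cube_top n) (realization_top P) (real_class P n z)"
proof -
  have "continuous_map (cube_top n) (coproduct_top P) (\<lambda>u. (n, z, u))"
    unfolding continuous_map_def
  proof (intro conjI allI impI)
    show "(\<lambda>u. (n, z, u)) \<in> cube n \<rightarrow> topspace (coproduct_top P)"
      using assms by auto
    fix U assume "openin (coproduct_top P) U"
    then have "openin (cube_top n) {u. (n, z, u) \<in> U}" "U \<subseteq> topspace (coproduct_top P)"
      using assms by (auto simp only: openin_coproduct_top)
    moreover from this(2) have "{u. (n, z, u) \<in> U} = {u \<in> cube n. (n, z, u) \<in> U}"
      by auto
    ultimately show "openin (cube_top n) {u \<in> cube n. (n, z, u) \<in> U}"
      by simp
  qed
  from continuous_map_compose[OF this quotient_imp_continuous_map[OF quotient_map_realization]]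
  show ?thesis
    by (simp add: o_def)
qed

text \<open>The representative chosen by \<open>SOME\<close> is immaterial as soon as \<open>F\<close> is compatible with
  \<^const>\<open>glue\<close>.\<close>

definition induced_map :: "(nat \<times> 'a \<times> (nat \<Rightarrow> real) \<Rightarrow> 'q) \<Rightarrow> 'a real_point \<Rightarrow> 'q" where
  "induced_map F c = F (SOME p. p \<in> c)"

lemma induced_map_real_class:
  assumes "\<And>p q. glue P p q \<Longrightarrow> F p = F q" "z \<in> cells P n" "u \<in> cube n"
  shows "induced_map F (real_class P n z u) = F (n, z, u)"
proof -
  have "(n, z, u) \<in> real_class P n z u"
    using assms by (auto simp: real_class_def real_equiv_def)
  then have "(SOME p. p \<in> real_class P n z u) \<in> real_class P n z u"
    by (rule someI)
  then have "equivclp (glue P) (n, z, u) (SOME p. p \<in> real_class P n z u)"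
    by (auto simp: real_class_def real_equiv_def)
  from equivclp_invariant[of _ _ _ F, OF this assms(1)] show ?thesis
    by (simp add: induced_map_def)
qed

text \<open>The product of a quotient map with a locally compact Hausdorff space is again a quotient
  map. This lets a homotopy that is continuous on every product of I with a cube descend jointly in
  both variables.\<close>

lemma continuous_map_induced_homotopy:
  assumes cont: "\<And>n z. z \<in> cells P n \<Longrightarrow>
      continuous_map (prod_topology (top_of_set {0..1::real}) (cube_top n)) Z (\<lambda>(t, u). F t (n, z, u))"
    and inv: "\<And>t p q. t \<in> {0..1} \<Longrightarrow> glue P p q \<Longrightarrow> F t p = F t q"
  shows "continuous_map (prod_topology (top_of_set {0..1}) (realization_top P)) Z
           (\<lambda>(t, c). induced_map (F t) c)"
proof -
  have *: "locally_compact_space (top_of_set {0..1::real})"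
    by (intro compact_imp_locally_compact_space) (simp add: compact_space_subtopology)
  have H: "Hausdorff_space (top_of_set {0..1::real})"
    by (simp add: Hausdorff_space_subtopology)
  have q: "quotient_map (prod_topology (top_of_set {0..1::real}) (coproduct_top P))
      (prod_topology (top_of_set {0..1}) (realization_top P)) (\<lambda>(t, p). (t, (\<lambda>(n, z, u). real_class P n z u) p))"
    using quotient_map_prod_right[OF * disjI1[OF H] quotient_map_realization] .
  have "continuous_map (prod_topology (top_of_set {0..1::real}) (coproduct_top P)) Z (\<lambda>(t, p). F t p)"
    by (intro continuous_map_prod_coproduct cont)
  then have "continuous_map (prod_topology (top_of_set {0..1::real}) (coproduct_top P)) Z
     ((\<lambda>(t, c). induced_map (F t) c) \<circ> (\<lambda>(t, p). (t, (\<lambda>(n, z, u). real_class P n z u) p)))"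
    by (rule continuous_map_eq) (auto simp: induced_map_real_class inv)
  with q show ?thesis
    by (rule continuous_compose_quotient_map)
qed

lemma continuous_map_realizationI:
  assumes cont: "\<And>n z. z \<in> cells P n \<Longrightarrow> continuous_map (cube_top n) Z (\<lambda>u. h (real_class P n z u))"
  shows "continuous_map (realization_top P) Z h"
proof (rule continuous_compose_quotient_map[OF quotient_map_realization])
  show "continuous_map (coproduct_top P) Z (h \<circ> (\<lambda>(n, z, u). real_class P n z u))"
    unfolding continuous_map_def
  proof (intro conjI allI impI)
    have "h (real_class P n z u) \<in> topspace Z" if "z \<in> cells P n" "u \<in> cube n" for n z u
      using continuous_map_funspace[OF cont[OF that(1)]] that(2) by auto
    then show "h \<circ> (\<lambda>(n, z, u). real_class P n z u) \<in> topspace (coproduct_top P) \<rightarrow> topspace Z"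
      by auto
    fix U assume U: "openin Z U"
    let ?W = "{p \<in> topspace (coproduct_top P). (h \<circ> (\<lambda>(n, z, u). real_class P n z u)) p \<in> U}"
    have "openin (cube_top n) {u. (n, z, u) \<in> ?W}" if "z \<in> cells P n" for n z
    proof -
      have "{u. (n, z, u) \<in> ?W} = {u \<in> cube n. h (real_class P n z u) \<in> U}"
        using that by auto
      then show ?thesis
        using cont[OF that] U unfolding continuous_map_def by auto
    qed
    then show "openin (coproduct_top P) ?W"
      unfolding openin_coproduct_top[of P ?W] by blast
  qed
qed

lemma continuous_map_induced_map:
  assumes cont: "\<And>n z. z \<in> cells P n \<Longrightarrow> continuous_map (cube_top n) Z (\<lambda>u. F (n, z, u))"
    and inv: "\<And>p q. glue P p q \<Longrightarrow> F p = F q"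
  shows "continuous_map (realization_top P) Z (induced_map F)"
  by (intro continuous_map_realizationI continuous_map_eq[OF cont])
     (auto simp: induced_map_real_class[of P, OF inv])

section \<open>Points on edges\<close>

definition edge_point :: "'a precubical \<Rightarrow> 'a \<Rightarrow> real \<Rightarrow> 'a real_point" where
  "edge_point P e s = real_class P 1 e (\<lambda>j\<in>{1..1}. s)"

lemma cube_0: "cube 0 = {\<lambda>_. undefined}"
  by (simp add: cube_eq)

lemma cube_1_restrict: "s \<in> {0..1} \<Longrightarrow> (\<lambda>j\<in>{1..1}. s) \<in> cube 1"
  by (auto simp: cube_eq)

lemma cube_1_eq: "u \<in> cube 1 \<Longrightarrow> u = (\<lambda>j\<in>{1..1}. u 1)"
  by (auto simp: cube_eq PiE_iff extensional_def fun_eq_iff)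

lemma cube_coordinate: "u \<in> cube n \<Longrightarrow> i \<in> {1..n} \<Longrightarrow> u i \<in> {0..1}"
  by (auto simp: cube_eq)

lemma real_class_edge: "u \<in> cube 1 \<Longrightarrow> real_class P 1 e u = edge_point P e (u 1)"
  unfolding edge_point_def using cube_1_eq by metis

lemma coface_0: "coface 0 k 1 u = (\<lambda>j\<in>{1..1}. real k)"
  by (auto simp: coface_def fun_eq_iff)

lemma edge_point_endpoint:
  assumes "precubical_set P" "e \<in> cells P 1" "k \<in> {0,1}"
  shows "edge_point P e (real k) = vertex_point P (bdry P 1 k 1 e)"
  using real_class_glue[of P e 0 "\<lambda>_. undefined" k 1] assms
  by (simp add: edge_point_def coface_0 cube_0 flip: One_nat_def)

lemma continuous_map_edge_point:
  assumes "e \<in> cells P 1" "continuous_map T (top_of_set {0..1}) \<rho>"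
  shows "continuous_map T (realization_top P) (\<lambda>t. edge_point P e (\<rho> t))"
proof -
  have "continuous_map T (cube_top 1) (\<lambda>t. \<lambda>j\<in>{1..1}. \<rho> t)"
    unfolding cube_top_def continuous_map_componentwise using assms(2) by auto
  from continuous_map_compose[OF this continuous_map_real_class[OF assms(1)]]
  show ?thesis
    by (simp add: o_def edge_point_def)
qed

section \<open>Piecewise elementary paths\<close>

definition monotone_cube_path :: "nat \<Rightarrow> real \<Rightarrow> real \<Rightarrow> (real \<Rightarrow> nat \<Rightarrow> real) \<Rightarrow> bool" where
  "monotone_cube_path n a b \<alpha> \<longleftrightarrow>
     continuous_map (top_of_set {a..b}) (cube_top n) \<alpha> \<and>
     (\<forall>s t. a \<le> s \<and> s \<le> t \<and> t \<le> b \<longrightarrow> (\<forall>i\<in>{1..n}. \<alpha> s i \<le> \<alpha> t i))"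

text \<open>Unlike \<^const>\<open>concat_dpath\<close>, this notion does not fix the subdivision points, which makes
  it stable under reparametrization.\<close>

inductive piecewise_dpath :: "'a precubical \<Rightarrow> (real \<Rightarrow> 'a real_point) \<Rightarrow> real \<Rightarrow> real \<Rightarrow> bool"
  for P \<omega> where
  piece: "\<lbrakk>a < b; z \<in> cells P n; monotone_cube_path n a b \<alpha>;
           \<forall>t\<in>{a..b}. \<omega> t = real_class P n z (\<alpha> t)\<rbrakk> \<Longrightarrow> piecewise_dpath P \<omega> a b"
| join: "\<lbrakk>piecewise_dpath P \<omega> a c; piecewise_dpath P \<omega> c b\<rbrakk> \<Longrightarrow> piecewise_dpath P \<omega> a b"

lemma monotone_cube_path_in_cube:
  "monotone_cube_path n a b \<alpha> \<Longrightarrow> t \<in> {a..b} \<Longrightarrow> \<alpha> t \<in> cube n"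
  unfolding monotone_cube_path_def continuous_map_def by auto

lemma monotone_cube_path_reparam:
  assumes "monotone_cube_path n a b \<alpha>" "continuous_on {c..d} \<phi>" "mono_on {c..d} \<phi>"
    "\<phi> ` {c..d} \<subseteq> {a..b}"
  shows "monotone_cube_path n c d (\<lambda>t. \<alpha> (\<phi> t))"
  unfolding monotone_cube_path_def
proof (intro conjI allI impI)
  have "continuous_map (top_of_set {c..d}) (top_of_set {a..b}) \<phi>"
    using assms by (auto simp: continuous_map_in_subtopology)
  from continuous_map_compose[OF this, of "cube_top n" \<alpha>]
  show "continuous_map (top_of_set {c..d}) (cube_top n) (\<lambda>t. \<alpha> (\<phi> t))"
    using assms(1) by (simp add: monotone_cube_path_def o_def)
  fix s t assume st: "c \<le> s \<and> s \<le> t \<and> t \<le> d"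
  then have "\<phi> s \<le> \<phi> t"
    using assms(3) by (intro mono_onD[OF assms(3)]) auto
  moreover have "a \<le> \<phi> s" "\<phi> t \<le> b"
    using assms(4) st by (auto simp: image_subset_iff)
  ultimately show "\<forall>i\<in>{1..n}. \<alpha> (\<phi> s) i \<le> \<alpha> (\<phi> t) i"
    using assms(1) by (auto simp: monotone_cube_path_def)
qed

lemma piecewise_dpath_less: "piecewise_dpath P \<omega> a b \<Longrightarrow> a < b"
  by (induction rule: piecewise_dpath.induct) auto

lemma piecewise_dpath_cong:
  assumes "piecewise_dpath P \<omega> a b" "\<And>t. t \<in> {a..b} \<Longrightarrow> \<eta> t = \<omega> t"
  shows "piecewise_dpath P \<eta> a b"
  using assms
proof (induction rule: piecewise_dpath.induct)
  case (piece a b z n \<alpha>)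
  then show ?case
    by (auto intro: piecewise_dpath.piece)
next
  case (join a c b)
  have "a < c" "c < b"
    using join piecewise_dpath_less by blast+
  with join show ?case
    by (intro piecewise_dpath.join[of _ _ a c b]) auto
qed

lemma piecewise_dpath_reparam:
  assumes "piecewise_dpath P \<omega> a b" "c < d" "continuous_on {c..d} \<phi>" "mono_on {c..d} \<phi>"
    "\<phi> ` {c..d} \<subseteq> {a..b}"
  shows "piecewise_dpath P (\<lambda>t. \<omega> (\<phi> t)) c d"
  using assms
proof (induction arbitrary: c d rule: piecewise_dpath.induct)
  case (piece a b z n \<alpha>)
  show ?case
    by (rule piecewise_dpath.piece[OF _ _ monotone_cube_path_reparam[OF piece(3)]])
       (use piece in \<open>auto simp: image_subset_iff\<close>)
next
  case (join a m b)
  have mono: "\<phi> s \<le> \<phi> t" if "c \<le> s" "s \<le> t" "t \<le> d" for s t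
    using that by (intro mono_onD[OF join.prems(3)]) auto
  have range: "a \<le> \<phi> t" "\<phi> t \<le> b" if "c \<le> t" "t \<le> d" for t
    using that join.prems(4) by (auto simp: image_subset_iff)
  consider "\<phi> d \<le> m" | "\<phi> c \<ge> m" | "\<phi> c < m" "m < \<phi> d"
    by linarith
  then show ?case
  proof cases
    case 1
    then have "\<phi> t \<in> {a..m}" if "t \<in> {c..d}" for t
      using that range[of t] mono[of t d] by auto
    then have "\<phi> ` {c..d} \<subseteq> {a..m}"
      by auto
    then show ?thesis
      using join by blast
  next
    case 2
    then have "\<phi> t \<in> {m..b}" if "t \<in> {c..d}" for t
      using that range[of t] mono[of c t] by auto
    then have "\<phi> ` {c..d} \<subseteq> {m..b}"
      by auto
    then show ?thesis
      using join by blast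
  next
    \<comment> \<open>A continuous monotone \<phi> hits m, possibly on a whole interval. Any
      preimage serves as the new cut point; the strict inequalities keep both pieces
      non-degenerate.\<close>
    case 3
    then obtain \<tau> where \<tau>: "c \<le> \<tau>" "\<tau> \<le> d" "\<phi> \<tau> = m"
      using IVT'[of \<phi> c m d] join.prems by auto
    then have "c < \<tau>" "\<tau> < d"
      using 3 by (auto simp: less_le)
    moreover have "\<phi> t \<in> {a..m}" if "t \<in> {c..\<tau>}" for t
      using that range[of t] mono[of t \<tau>] \<tau> by auto
    then have "\<phi> ` {c..\<tau>} \<subseteq> {a..m}"
      by auto
    moreover have "\<phi> t \<in> {m..b}" if "t \<in> {\<tau>..d}" for t
      using that range[of t] mono[of \<tau> t] \<tau> by auto
    then have "\<phi> ` {\<tau>..d} \<subseteq> {m..b}"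
      by auto
    moreover have "continuous_on {c..\<tau>} \<phi>" "mono_on {c..\<tau>} \<phi>"
        "continuous_on {\<tau>..d} \<phi>" "mono_on {\<tau>..d} \<phi>"
      using join.prems(2,3) \<tau>
      by (auto elim!: continuous_on_subset mono_on_subset)
    ultimately show ?thesis
      using join.IH by (intro piecewise_dpath.join[of _ _ c \<tau> d]) auto
  qed
qed

lemma continuous_map_piecewise_dpath:
  assumes "piecewise_dpath P \<omega> a b"
  shows "continuous_map (top_of_set {a..b}) (realization_top P) \<omega>"
  using assms
proof (induction rule: piecewise_dpath.induct)
  case (piece a b z n \<alpha>)
  then have "continuous_map (top_of_set {a..b}) (realization_top P) (real_class P n z \<circ> \<alpha>)"
    by (intro continuous_map_compose[OF _ continuous_map_real_class])
       (auto simp: monotone_cube_path_def)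
  then show ?case
    by (rule continuous_map_eq) (use piece in auto)
next
  case (join a c b)
  have "a < c" "c < b"
    using join piecewise_dpath_less by blast+
  then have "{a..b} \<inter> {x \<in> {a..b}. x \<le> c} = {a..c}" "{a..b} \<inter> {x \<in> {a..b}. c \<le> x} = {c..b}"
    by auto
  then have "continuous_map (top_of_set {a..b}) (realization_top P) (\<lambda>x. if x \<le> c then \<omega> x else \<omega> x)"
    using join by (intro continuous_map_cases_le) (auto simp: subtopology_subtopology)
  then show ?case
    by simp
qed

lemma piecewise_dpath_concat_path:
  assumes "piecewise_dpath P \<omega> 0 1" "piecewise_dpath P \<eta> 0 1" "\<omega> 1 = \<eta> 0"
  shows "piecewise_dpath P (concat_path \<omega> \<eta>) 0 1"
proof (rule piecewise_dpath.join)
  have "piecewise_dpath P (\<lambda>t. \<omega> (2 * t)) 0 (1/2)"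
    by (rule piecewise_dpath_reparam[OF assms(1)])
       (auto intro!: continuous_intros mono_onI)
  then show "piecewise_dpath P (concat_path \<omega> \<eta>) 0 (1/2)"
    by (rule piecewise_dpath_cong) (auto simp: concat_path_def)
  have "piecewise_dpath P (\<lambda>t. \<eta> (2 * t - 1)) (1/2) 1"
    by (rule piecewise_dpath_reparam[OF assms(2)])
       (auto intro!: continuous_intros mono_onI)
  then show "piecewise_dpath P (concat_path \<omega> \<eta>) (1/2) 1"
  proof (rule piecewise_dpath_cong)
    fix t :: real assume "t \<in> {1/2..1}"
    \<comment> \<open>At 1/2 \<open>concat_path\<close> still takes its first branch, so the second
      half agrees there only because \<open>\<omega> 1 = \<eta> 0\<close>.\<close>
    then consider "t = 1/2" | "1/2 < t" "t \<le> 1"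
      by fastforce
    then show "concat_path \<omega> \<eta> t = \<eta> (2 * t - 1)"
    proof cases
      case 1
      show ?thesis
        unfolding 1 using assms(3) by (simp add: concat_path_def)
    qed (auto simp: concat_path_def)
  qed
qed

lemma concat_dpath_imp_piecewise: "concat_dpath P \<omega> \<Longrightarrow> piecewise_dpath P \<omega> 0 1"
proof (induction rule: concat_dpath.induct)
  case (elementary \<omega>)
  then obtain n z \<alpha> where "z \<in> cells P n" "monotone_cube_path n 0 1 \<alpha>"
      "\<omega> = (\<lambda>t\<in>{0..1}. real_class P n z (\<alpha> t))"
    by (auto simp: elementary_dpath_def monotone_cube_path_def)
  then show ?case
    by (intro piecewise_dpath.piece[of 0 1 z _ n \<alpha>]) auto
next
  case (concat \<omega> \<eta>)
  then show ?case
    by (intro piecewise_dpath_concat_path)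
qed

text \<open>\<open>concat_path\<close> always switches at 1/2, so an arbitrary subdivision is
  recovered only up to a reparametrization \<phi>, which is built along with the concatenation
  \<eta>.\<close>

lemma piecewise_imp_concat_dpath:
  assumes "piecewise_dpath P \<omega> a b"
  shows "\<exists>\<eta> \<phi>. concat_dpath P \<eta> \<and> continuous_on {a..b} \<phi> \<and> mono_on {a..b} \<phi> \<and>
           \<phi> a = 0 \<and> \<phi> b = 1 \<and> (\<forall>t\<in>{a..b}. \<omega> t = \<eta> (\<phi> t))"
  using assms
proof (induction rule: piecewise_dpath.induct)
  case (piece a b z n \<alpha>)
  let ?\<phi> = "\<lambda>t. (t - a) / (b - a)" and ?\<psi> = "\<lambda>t. a + t * (b - a)"
  let ?\<eta> = "\<lambda>t\<in>{0..1}. real_class P n z (\<alpha> (?\<psi> t))"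
  have "?\<psi> t \<in> {a..b}" if "t \<in> {0..1}" for t
    using that piece(1) mult_left_le_one_le[of "b - a" t] mult_right_mono[of a b t]
    by (auto simp: algebra_simps)
  then have "monotone_cube_path n 0 1 (\<lambda>t. \<alpha> (?\<psi> t))"
    using piece(1) by (intro monotone_cube_path_reparam[OF piece(3), where \<phi> = ?\<psi>])
      (auto intro!: continuous_intros mono_onI mult_right_mono)
  then have "elementary_dpath P ?\<eta>"
    using piece(2) unfolding elementary_dpath_def monotone_cube_path_def by blast
  moreover have "mono_on {a..b} ?\<phi>" "continuous_on {a..b} ?\<phi>"
    using piece(1) by (auto intro!: mono_onI divide_right_mono continuous_intros)
  moreover have "\<omega> t = ?\<eta> (?\<phi> t)" if "t \<in> {a..b}" for t
  proof -
    have "?\<phi> t \<in> {0..1}" "?\<psi> (?\<phi> t) = t"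
      using that piece(1) by auto
    then show ?thesis
      using that piece(4) by simp
  qed
  moreover have "?\<phi> a = 0" "?\<phi> b = 1"
    using piece(1) by auto
  ultimately show ?case
    using concat_dpath.elementary by blast
next
  case (join a c b)
  have less: "a < c" "c < b"
    using join piecewise_dpath_less by blast+
  obtain \<eta>1 \<phi>1 where 1: "concat_dpath P \<eta>1" "continuous_on {a..c} \<phi>1" "mono_on {a..c} \<phi>1"
      "\<phi>1 a = 0" "\<phi>1 c = 1" "\<And>t. t\<in>{a..c} \<Longrightarrow> \<omega> t = \<eta>1 (\<phi>1 t)"
    using join.IH(1) by blast
  obtain \<eta>2 \<phi>2 where 2: "concat_dpath P \<eta>2" "continuous_on {c..b} \<phi>2" "mono_on {c..b} \<phi>2"
      "\<phi>2 c = 0" "\<phi>2 b = 1" "\<And>t. t\<in>{c..b} \<Longrightarrow> \<omega> t = \<eta>2 (\<phi>2 t)"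
    using join.IH(2) by blast
  \<comment> \<open>Each half is compressed so that the cut point c goes to 1/2.\<close>
  let ?\<phi> = "\<lambda>t. if t \<le> c then \<phi>1 t / 2 else (1 + \<phi>2 t) / 2"
  have r1: "0 \<le> \<phi>1 t" "\<phi>1 t \<le> 1" if "a \<le> t" "t \<le> c" for t
    using mono_onD[OF 1(3), of a t] mono_onD[OF 1(3), of t c] that 1(4,5) by auto
  have r2: "0 \<le> \<phi>2 t" "\<phi>2 t \<le> 1" if "c \<le> t" "t \<le> b" for t
    using mono_onD[OF 2(3), of c t] mono_onD[OF 2(3), of t b] that 2(4,5) by auto
  have "concat_dpath P (concat_path \<eta>1 \<eta>2)"
    using 1(1) 2(1) 1(6)[of c] 2(6)[of c] 1(5) 2(4) less by (intro concat_dpath.concat) auto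
  moreover have "continuous_on {a..b} ?\<phi>"
  proof (rule continuous_on_cases_le[where h = "\<lambda>t. t"])
    show "continuous_on {t \<in> {a..b}. t \<le> c} (\<lambda>t. \<phi>1 t / 2)"
      by (intro continuous_intros continuous_on_subset[OF 1(2)]) auto
    show "continuous_on {t \<in> {a..b}. c \<le> t} (\<lambda>t. (1 + \<phi>2 t) / 2)"
      by (intro continuous_intros continuous_on_subset[OF 2(2)]) auto
  qed (use 1 2 in auto)
  moreover have "mono_on {a..b} ?\<phi>"
  proof (rule mono_onI)
    fix r s assume rs: "r \<in> {a..b}" "s \<in> {a..b}" "r \<le> s"
    have "\<phi>1 r \<le> \<phi>1 s" if "s \<le> c"
      using that rs by (intro mono_onD[OF 1(3)]) auto
    moreover have "\<phi>2 r \<le> \<phi>2 s" if "c < r"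
      using that rs by (intro mono_onD[OF 2(3)]) auto
    ultimately show "?\<phi> r \<le> ?\<phi> s"
      using rs r1[of r] r2[of s] by auto
  qed
  moreover have "\<omega> t = concat_path \<eta>1 \<eta>2 (?\<phi> t)" if t: "t \<in> {a..b}" for t
  proof (cases "t \<le> c")
    case True
    then show ?thesis
      using t 1(6) r1[of t] by (auto simp: concat_path_def)
  next
    case False
    \<comment> \<open>To the right of c the function \<phi>2 may still be 0; the value 1/2 then
      falls into the first branch of \<open>concat_path\<close>, and the matching end points are
      needed.\<close>
    moreover have "\<eta>2 (\<phi>2 t) = \<eta>1 1" if "\<phi>2 t = 0"
      using that 1(6)[of c] 2(6)[of c] 1(5) 2(4) less by auto
    ultimately show ?thesis
      using t 2(6)[of t] r2[of t] by (cases "\<phi>2 t = 0") (auto simp: concat_path_def add_divide_distrib)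
  qed
  ultimately show ?case
    using 1(4) 2(5) less by (intro exI[of _ "concat_path \<eta>1 \<eta>2"] exI[of _ ?\<phi>]) auto
qed

text \<open>The increasing reparametrization in the definition of the d-paths absorbs the \<phi> of
  the preceding lemma. From here on the d-paths of a realization are accessed through
  \<open>piecewise_dpath\<close>.\<close>

lemma dpaths_realization:
  "dpaths (realization P) = {\<omega> \<in> extensional {0..1}. piecewise_dpath P \<omega> 0 1}"
proof (intro subset_antisym subsetI)
  fix \<omega> assume "\<omega> \<in> dpaths (realization P)"
  then obtain \<eta> \<phi> where \<eta>: "concat_dpath P \<eta>" "increasing_map \<phi>" "\<omega> = compose {0..1} \<eta> \<phi>"
    by (auto simp: realization_def)
  have "piecewise_dpath P (\<lambda>t. \<eta> (\<phi> t)) 0 1"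
    by (rule piecewise_dpath_reparam[OF concat_dpath_imp_piecewise[OF \<eta>(1)]])
       (use \<eta>(2) in \<open>auto simp: increasing_map_def\<close>)
  then have "piecewise_dpath P \<omega> 0 1"
    by (rule piecewise_dpath_cong) (auto simp: \<eta> compose_def)
  then show "\<omega> \<in> {\<omega> \<in> extensional {0..1}. piecewise_dpath P \<omega> 0 1}"
    by (auto simp: \<eta>)
next
  fix \<omega> assume \<omega>: "\<omega> \<in> {\<omega> \<in> extensional {0..1}. piecewise_dpath P \<omega> 0 1}"
  then obtain \<eta> \<phi> where \<eta>: "concat_dpath P \<eta>" "continuous_on {0..1} \<phi>" "mono_on {0..1} \<phi>"
      "\<phi> 0 = 0" "\<phi> 1 = 1" "\<And>t. t\<in>{0..1} \<Longrightarrow> \<omega> t = \<eta> (\<phi> t)"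
    using piecewise_imp_concat_dpath by (metis (no_types, lifting) mem_Collect_eq)
  have "increasing_map \<phi>"
    using mono_onD[OF \<eta>(3), of 0] mono_onD[OF \<eta>(3), of _ 1] \<eta> by (auto simp: increasing_map_def)
  moreover have "\<omega> = compose {0..1} \<eta> \<phi>"
    using \<omega> \<eta>(6) by (auto simp: compose_def extensional_def fun_eq_iff simp del: set_eq_iff)
  ultimately show "\<omega> \<in> dpaths (realization P)"
    using \<eta>(1) by (auto simp: realization_def)
qed

lemma dtop_realization [simp]: "dtop (realization P) = realization_top P"
  by (simp add: realization_def)

lemma dspace_realization: "dspace (realization P)"
  unfolding dspace_def dtop_realization
proof (intro conjI ballI allI impI)
  show "dpaths (realization P) \<subseteq> path_set (realization_top P)"
    using continuous_map_piecewise_dpath by (auto simp: dpaths_realization path_set_def pathin_def)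
next
  fix c assume "c \<in> topspace (realization_top P)"
  then obtain n z u where "z \<in> cells P n" "u \<in> cube n" "c = real_class P n z u"
    by (rule realization_point_cases)
  then have "piecewise_dpath P (\<lambda>t\<in>{0..1}. c) 0 1"
    by (intro piecewise_dpath.piece[of 0 1 z _ n "\<lambda>_. u"]) (auto simp: monotone_cube_path_def)
  then show "(\<lambda>t\<in>{0..1}. c) \<in> dpaths (realization P)"
    by (auto simp: dpaths_realization)
next
  fix \<omega> \<phi> assume "\<omega> \<in> dpaths (realization P)" "increasing_map \<phi>"
  then have "piecewise_dpath P (\<lambda>t. \<omega> (\<phi> t)) 0 1"
    using piecewise_dpath_reparam[of P \<omega> 0 1 0 1 \<phi>]
    by (auto simp: dpaths_realization increasing_map_def)
  then have "piecewise_dpath P (compose {0..1} \<omega> \<phi>) 0 1"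
    by (rule piecewise_dpath_cong) (auto simp: compose_def)
  then show "compose {0..1} \<omega> \<phi> \<in> dpaths (realization P)"
    by (auto simp: dpaths_realization)
next
  fix \<omega> \<eta> assume "\<omega> \<in> dpaths (realization P)" "\<eta> \<in> dpaths (realization P)" "\<omega> 1 = \<eta> 0"
  then show "concat_path \<omega> \<eta> \<in> dpaths (realization P)"
    using piecewise_dpath_concat_path[of P \<omega> \<eta>]
    by (auto simp: dpaths_realization) (simp add: concat_path_def)
qed

text \<open>Joins are preserved by every map, so directedness is a matter of one monotone path in
  one cube. Its image may need several pieces; this happens when an edge is mapped onto a
  detour.\<close>

lemma d_map_realizationI:
  assumes cont: "continuous_map (realization_top P) (realization_top Q) h"
    and piece: "\<And>n z a b \<alpha>. \<lbrakk>z \<in> cells P n; a < b; monotone_cube_path n a b \<alpha>\<rbrakk>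
      \<Longrightarrow> piecewise_dpath Q (\<lambda>t. h (real_class P n z (\<alpha> t))) a b"
  shows "d_map (realization P) (realization Q) h"
proof -
  have "piecewise_dpath Q (\<lambda>t. h (\<omega> t)) a b" if "piecewise_dpath P \<omega> a b" for \<omega> a b
    using that
  proof (induction rule: piecewise_dpath.induct)
    case (piece a b z n \<alpha>)
    show ?case
      by (rule piecewise_dpath_cong[OF assms(2)[OF piece(2,1,3)]]) (use piece in auto)
  qed (rule piecewise_dpath.join)
  then have "piecewise_dpath Q (compose {0..1} h \<omega>) 0 1" if "\<omega> \<in> dpaths (realization P)" for \<omega>
    by (rule piecewise_dpath_cong[where \<omega> = "\<lambda>t. h (\<omega> t)"])
       (use that in \<open>auto simp: dpaths_realization compose_def\<close>)
  then show ?thesis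
    using cont dspace_realization[of P] dspace_realization[of Q]
    by (auto simp: d_map_def dpaths_realization[of Q])
qed

lemma monotone_cube_path_1:
  assumes "monotone_cube_path 1 a b \<alpha>"
  shows "continuous_on {a..b} (\<lambda>t. \<alpha> t 1)" "mono_on {a..b} (\<lambda>t. \<alpha> t 1)"
    "\<And>t. t \<in> {a..b} \<Longrightarrow> \<alpha> t 1 \<in> {0..1}"
proof -
  have "continuous_map (top_of_set {a..b}) (top_of_set {0..1}) (\<lambda>t. \<alpha> t 1)"
    using assms unfolding monotone_cube_path_def cube_top_def continuous_map_componentwise by auto
  then show "continuous_on {a..b} (\<lambda>t. \<alpha> t 1)" "\<And>t. t \<in> {a..b} \<Longrightarrow> \<alpha> t 1 \<in> {0..1}"
    by (auto simp: continuous_map_in_subtopology)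
  show "mono_on {a..b} (\<lambda>t. \<alpha> t 1)"
    using assms by (auto simp: monotone_cube_path_def intro!: mono_onI)
qed

lemma piecewise_dpath_edge:
  assumes "e \<in> cells P 1" "a < b" "continuous_on {a..b} \<rho>" "mono_on {a..b} \<rho>" "\<rho> ` {a..b} \<subseteq> {0..1}"
  shows "piecewise_dpath P (\<lambda>t. edge_point P e (\<rho> t)) a b"
proof (rule piecewise_dpath.piece)
  have "continuous_map (top_of_set {a..b}) (cube_top 1) (\<lambda>t. \<lambda>j\<in>{1..1}. \<rho> t)"
    unfolding cube_top_def continuous_map_componentwise
    using assms by (auto simp: continuous_map_in_subtopology)
  then show "monotone_cube_path 1 a b (\<lambda>t. \<lambda>j\<in>{1..1}. \<rho> t)"
    using assms(4) by (auto simp: monotone_cube_path_def intro: mono_onD)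
qed (use assms in \<open>auto simp: edge_point_def\<close>)

section \<open>Removing cells of dimension at most one\<close>

lemma glue_mono:
  assumes "precubical_subset R P" "glue R p q"
  shows "glue P p q"
  using assms(2)
proof cases
  case (1 z n u k i)
  have "bdry R (Suc n) k i z = bdry P (Suc n) k i z" "z \<in> cells P (Suc n)"
    using assms(1) 1 unfolding precubical_subset_def by blast+
  then show ?thesis
    using 1 glue.intros by metis
qed

lemma equivclp_glue_mono:
  assumes "precubical_subset R P" "equivclp (glue R) p q"
  shows "equivclp (glue P) p q"
  using assms(2)
  by (induction rule: equivclp_induct)
     (auto dest: glue_mono[OF assms(1)] intro: equivclp_into_equivclp)

lemma precubical_subsetD:
  assumes "precubical_subset R P"
  shows "precubical_set R" "precubical_set P" "z \<in> cells R n \<Longrightarrow> z \<in> cells P n"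
    "\<lbrakk>z \<in> cells R (Suc n); k \<in> {0,1}; i \<in> {1..Suc n}\<rbrakk> \<Longrightarrow> bdry R (Suc n) k i z = bdry P (Suc n) k i z"
  using assms unfolding precubical_subset_def by blast+

text \<open>Gluing in \<open>R\<close> is also gluing in \<open>P\<close>, so a class of
  \<open>R\<close> is contained in a class of \<open>P\<close>; saturating it with
  \<open>real_equiv P\<close> gives exactly that class.\<close>

lemma realization_incl_real_class:
  assumes "precubical_subset R P" "z \<in> cells R n" "u \<in> cube n"
  shows "realization_incl P (real_class R n z u) = real_class P n z u"
proof -
  have "real_equiv P `` {p} = real_class P n z u" if "p \<in> real_class R n z u" for p
  proof -
    have "equivclp (glue P) (n, z, u) p" "p \<in> topspace (coproduct_top P)"
      using that equivclp_glue_mono[OF assms(1)] precubical_subsetD(3)[OF assms(1)]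
      by (auto simp: real_class_def real_equiv_def)
    then have "((n, z, u), p) \<in> real_equiv P"
      using assms precubical_subsetD(3) by (fastforce simp: real_equiv_def)
    then show ?thesis
      unfolding real_class_def using equiv_class_eq[OF equiv_real_equiv] by metis
  qed
  moreover have "(n, z, u) \<in> real_class R n z u"
    using assms by (auto simp: real_class_def real_equiv_def)
  ultimately show ?thesis
    unfolding realization_incl_def Image_eq_UN[of _ "real_class R n z u"] by blast
qed

text \<open>Stated for closed sets because the inclusion of |R| will be shown to be a closed
  map.\<close>

lemma closedin_realization_top:
  "closedin (realization_top P) C \<longleftrightarrow> C \<subseteq> topspace (realization_top P) \<and>
     (\<forall>n. \<forall>z\<in>cells P n. closedin (cube_top n) {u \<in> cube n. real_class P n z u \<in> C})"
proof -
  have "closedin (realization_top P) C \<longleftrightarrow> C \<subseteq> topspace (realization_top P) \<and>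
      closedin (coproduct_top P) {p \<in> topspace (coproduct_top P). (\<lambda>(n, z, u). real_class P n z u) p \<in> C}"
    (is "_ \<longleftrightarrow> _ \<and> closedin _ ?D")
    using quotient_map_realization[of P] closedin_subset[of "realization_top P" C]
    by (auto simp only: quotient_map_closedin)
  moreover have "closedin (coproduct_top P) ?D \<longleftrightarrow>
      (\<forall>n. \<forall>z\<in>cells P n. closedin (cube_top n) {u \<in> cube n. real_class P n z u \<in> C})"
  proof -
    have *: "{u. (n, z, u) \<in> topspace (coproduct_top P) - ?D} = cube n - {u \<in> cube n. real_class P n z u \<in> C}"
      if "z \<in> cells P n" for n z
      using that by auto
    have "closedin (coproduct_top P) ?D \<longleftrightarrow> openin (coproduct_top P) (topspace (coproduct_top P) - ?D)"
      by (simp add: closedin_def)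
    also have "\<dots> \<longleftrightarrow> (\<forall>n. \<forall>z\<in>cells P n.
        openin (cube_top n) {u. (n, z, u) \<in> topspace (coproduct_top P) - ?D})"
      unfolding openin_coproduct_top[of P "topspace (coproduct_top P) - ?D"] by blast
    also have "\<dots> \<longleftrightarrow> (\<forall>n. \<forall>z\<in>cells P n. closedin (cube_top n) {u \<in> cube n. real_class P n z u \<in> C})"
      by (intro all_cong1 ball_cong refl, subst *) (auto simp: closedin_def)
    finally show ?thesis .
  qed
  ultimately show ?thesis
    by simp
qed

lemma Hausdorff_cube: "Hausdorff_space (cube_top n)"
  by (simp add: cube_top_def Hausdorff_space_product_topology Hausdorff_space_subtopology)

text \<open>A set-theoretic left inverse of the inclusion \<open>|R| \<rightarrow> |P|\<close>, defined on representatives and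
  equal to \<open>None\<close> outside \<open>|R|\<close>. It exists in this simple form because the cells
  outside \<open>R\<close> are vertices and edges.\<close>

definition point_in_subset ::
    "'a precubical \<Rightarrow> 'a precubical \<Rightarrow> nat \<times> 'a \<times> (nat \<Rightarrow> real) \<Rightarrow> 'a real_point option" where
  "point_in_subset R P = (\<lambda>(n, z, u).
     if z \<in> cells R n then Some (real_class R n z u)
     else if n = 1 \<and> u 1 = 0 \<and> bdry P 1 0 1 z \<in> cells R 0 then Some (vertex_point R (bdry P 1 0 1 z))
     else if n = 1 \<and> u 1 = 1 \<and> bdry P 1 1 1 z \<in> cells R 0 then Some (vertex_point R (bdry P 1 1 1 z))
     else None)"

text \<open>The situation occurs twice, with \<open>R\<close> inside \<open>P\<close> and inside
  \<open>Q\<close>. A missing cell can meet |R| only at the ends of an edge.\<close>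

locale low_dimensional_complement =
  fixes R P :: "'a precubical"
  assumes sub: "precubical_subset R P"
    and high: "n \<ge> 2 \<Longrightarrow> z \<in> cells P n \<Longrightarrow> z \<in> cells R n"
begin

lemma point_in_subset_glue:
  assumes "glue P p q"
  shows "point_in_subset R P p = point_in_subset R P q"
  using assms
proof cases
  case (1 z n u k i)
  show ?thesis
  proof (cases "z \<in> cells R (Suc n)")
    case True
    have "bdry P (Suc n) k i z \<in> cells R n"
      using precubical_bdry[of R z n k i] precubical_subsetD[OF sub] True 1 by metis
    moreover have "real_class R (Suc n) z (coface n k i u) = real_class R n (bdry P (Suc n) k i z) u"
      using real_class_glue[of R z n u k i] precubical_subsetD[OF sub] True 1 by metis
    ultimately show ?thesis
      using True 1 by (simp add: point_in_subset_def)
  next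
    case False
    then have n: "n = 0" "i = 1"
      using high[of "Suc n" z] 1 by (auto intro: ccontr)
    moreover have u: "u = (\<lambda>_. undefined)"
      using 1 n by (auto simp: cube_0)
    moreover have "coface n k i u 1 = real k"
      unfolding n coface_0 by simp
    moreover have "k = 0 \<or> k = 1"
      using 1 by auto
    ultimately show ?thesis
      using False 1 by (elim disjE) (simp_all add: point_in_subset_def)
  qed
qed

text \<open>By invariance under gluing, the left inverse may be evaluated at a representative that
  lies in \<open>R\<close>, even if (n, z, u) is an end of an edge outside \<open>R\<close>.\<close>

lemma point_in_subset_incl:
  assumes c: "c \<in> topspace (realization_top R)" and z: "z \<in> cells P n" "u \<in> cube n"
    and eq: "real_class P n z u = realization_incl P c"
  shows "point_in_subset R P (n, z, u) = Some c"
proof -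
  obtain n' z' u' where c': "z' \<in> cells R n'" "u' \<in> cube n'" "c = real_class R n' z' u'"
    using c by (rule realization_point_cases)
  then have "equivclp (glue P) (n, z, u) (n', z', u')"
    using z eq realization_incl_real_class[OF sub] precubical_subsetD(3)[OF sub]
    by (metis real_class_eq_iff)
  then have "point_in_subset R P (n, z, u) = point_in_subset R P (n', z', u')"
    by (rule equivclp_invariant) (rule point_in_subset_glue)
  then show ?thesis
    using c' by (simp add: point_in_subset_def)
qed

lemma inj_realization_incl:
  assumes "c \<in> topspace (realization_top R)" "c' \<in> topspace (realization_top R)"
    "realization_incl P c = realization_incl P c'"
  shows "c = c'"
proof -
  obtain n z u where c: "z \<in> cells R n" "u \<in> cube n" "c = real_class R n z u"
    using assms(1) by (rule realization_point_cases)
  have "real_class P n z u = realization_incl P c"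
    using c realization_incl_real_class[OF sub] by simp
  then have "point_in_subset R P (n, z, u) = Some c" "point_in_subset R P (n, z, u) = Some c'"
    using point_in_subset_incl[OF _ precubical_subsetD(3)[OF sub c(1)] c(2)] assms by metis+
  then show ?thesis
    by simp
qed

lemma d_map_realization_incl: "d_map (realization R) (realization P) (realization_incl P)"
proof (rule d_map_realizationI)
  show "continuous_map (realization_top R) (realization_top P) (realization_incl P)"
  proof (rule continuous_map_realizationI)
    fix n z assume z: "z \<in> cells R n"
    show "continuous_map (cube_top n) (realization_top P) (\<lambda>u. realization_incl P (real_class R n z u))"
      by (rule continuous_map_eq[OF continuous_map_real_class[OF precubical_subsetD(3)[OF sub z]]])
         (simp add: realization_incl_real_class[OF sub z])
  qed
next
  fix n z a b \<alpha> assume *: "z \<in> cells R n" "a < b" "monotone_cube_path n a b \<alpha>"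
  then show "piecewise_dpath P (\<lambda>t. realization_incl P (real_class R n z (\<alpha> t))) a b"
    by (intro piecewise_dpath.piece[of a b z _ n \<alpha>])
       (auto simp: realization_incl_real_class[OF sub _ monotone_cube_path_in_cube]
          precubical_subsetD(3)[OF sub])
qed

lemma embedding_realization_incl:
  "embedding_map (realization_top R) (realization_top P) (realization_incl P)"
proof (rule injective_closed_imp_embedding_map)
  show "continuous_map (realization_top R) (realization_top P) (realization_incl P)"
    using d_map_realization_incl by (simp add: d_map_def)
  then have top: "realization_incl P ` topspace (realization_top R) \<subseteq> topspace (realization_top P)"
    by (auto simp: continuous_map_def)
  show "inj_on (realization_incl P) (topspace (realization_top R))"
    using inj_realization_incl by (auto simp: inj_on_def)
  show "closed_map (realization_top R) (realization_top P) (realization_incl P)"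
    unfolding closed_map_def
  proof (intro allI impI)
    fix C assume C: "closedin (realization_top R) C"
    then have C_top: "C \<subseteq> topspace (realization_top R)"
      by (rule closedin_subset)
    have "closedin (cube_top n) {u \<in> cube n. real_class P n z u \<in> realization_incl P ` C}"
      if z: "z \<in> cells P n" for n z
    proof (cases "z \<in> cells R n")
      case True
      have "real_class P n z u \<in> realization_incl P ` C \<longleftrightarrow> real_class R n z u \<in> C" if "u \<in> cube n" for u
      proof
        assume "real_class P n z u \<in> realization_incl P ` C"
        then obtain c where c: "c \<in> C" "real_class P n z u = realization_incl P c"
          by auto
        then have "c = real_class R n z u"
          using point_in_subset_incl[of c z n u] True that z C_top by (auto simp: point_in_subset_def)
        then show "real_class R n z u \<in> C"
          using c by simp
      next
        assume "real_class R n z u \<in> C"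
        then show "real_class P n z u \<in> realization_incl P ` C"
          using realization_incl_real_class[OF sub True that] by (metis imageI)
      qed
      then have "{u \<in> cube n. real_class P n z u \<in> realization_incl P ` C}
          = {u \<in> cube n. real_class R n z u \<in> C}"
        by auto
      then show ?thesis
        using C True by (simp add: closedin_realization_top)
    next
      case False
      \<comment> \<open>On a cell outside \<open>R\<close> the left inverse is \<open>None\<close>
        except at the two ends of an edge. The set is therefore finite, and finite sets are closed
        in the cube.\<close>
      let ?ends = "{\<lambda>j\<in>{1..1::nat}. 0::real, \<lambda>j\<in>{1..1}. 1}"
      have "{u \<in> cube n. real_class P n z u \<in> realization_incl P ` C} \<subseteq> ?ends"
      proof (intro subsetI, elim CollectE conjE)
        fix u assume u: "u \<in> cube n" "real_class P n z u \<in> realization_incl P ` C"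
        obtain c where "c \<in> C" "real_class P n z u = realization_incl P c"
          using u by auto
        then have "point_in_subset R P (n, z, u) = Some c"
          using point_in_subset_incl[of c z n u] u z C_top by auto
        then have "n = 1" "u 1 = 0 \<or> u 1 = 1"
          using False by (auto simp: point_in_subset_def split: if_splits)
        moreover from this(1) have "u = (\<lambda>j\<in>{1..1}. u 1)"
          using cube_1_eq u(1) by simp
        ultimately have "u = (\<lambda>j\<in>{1..1}. 0) \<or> u = (\<lambda>j\<in>{1..1}. 1)"
          by auto
        then show "u \<in> ?ends"
          by (simp only: insert_iff) blast
      qed
      then have "finite {u \<in> cube n. real_class P n z u \<in> realization_incl P ` C}"
        by (rule finite_subset) simp
      then show ?thesis
        using Hausdorff_imp_t1_space[OF Hausdorff_cube] unfolding t1_space_closedin_finite by blast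
    qed
    then show "closedin (realization_top P) (realization_incl P ` C)"
      unfolding closedin_realization_top using top C_top by blast
  qed
qed

text \<open>This shows that |R| inherits its d-paths: a d-path of |P| with values in |R| can use an
  edge outside \<open>R\<close> only by standing still at one of its ends.\<close>

lemma piecewise_dpath_realization_incl:
  assumes "piecewise_dpath P \<eta> a b" "\<And>t. t \<in> {a..b} \<Longrightarrow> \<omega> t \<in> topspace (realization_top R)"
    "\<And>t. t \<in> {a..b} \<Longrightarrow> \<eta> t = realization_incl P (\<omega> t)"
  shows "piecewise_dpath R \<omega> a b"
  using assms
proof (induction rule: piecewise_dpath.induct)
  case (piece a b z n \<alpha>)
  have cube: "\<alpha> t \<in> cube n" if "t \<in> {a..b}" for t
    using piece(3) that by (rule monotone_cube_path_in_cube)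
  have point: "point_in_subset R P (n, z, \<alpha> t) = Some (\<omega> t)" if "t \<in> {a..b}" for t
    using piece cube that by (intro point_in_subset_incl) auto
  show ?case
  proof (cases "z \<in> cells R n")
    case True
    then show ?thesis
      using piece(1,3) point by (intro piecewise_dpath.piece[of a b z R n \<alpha>])
        (auto simp: point_in_subset_def)
  next
    case False
    have n: "n = 1" and ends: "\<alpha> t 1 = 0 \<or> \<alpha> t 1 = 1" if "t \<in> {a..b}" for t
      using point[OF that] False by (auto simp: point_in_subset_def split: if_splits)
    have "n = 1"
      using n[of a] piece(1) by auto
    note \<alpha> = monotone_cube_path_1[OF piece(3)[unfolded \<open>n = 1\<close>]]
    \<comment> \<open>The coordinate is continuous and takes only the values 0 and 1, so it cannot
      change.\<close>
    have "\<alpha> a 1 = \<alpha> b 1"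
    proof (rule ccontr)
      assume "\<alpha> a 1 \<noteq> \<alpha> b 1"
      moreover have "\<alpha> a 1 \<le> \<alpha> b 1"
        using piece(1) by (intro mono_onD[OF \<alpha>(2)]) auto
      ultimately have "\<alpha> a 1 = 0" "\<alpha> b 1 = 1"
        using ends[of a] ends[of b] piece(1) by auto
      then obtain t where "a \<le> t" "t \<le> b" "\<alpha> t 1 = 1/2"
        using IVT'[of "\<lambda>t. \<alpha> t 1" a "1/2" b] \<alpha>(1) piece(1) by auto
      then show False
        using ends[of t] by auto
    qed
    then have const: "\<alpha> t 1 = \<alpha> a 1" if "t \<in> {a..b}" for t
      using mono_onD[OF \<alpha>(2), of a t] mono_onD[OF \<alpha>(2), of t b] that piece(1) by auto
    have "\<exists>w\<in>cells R 0. \<omega> a = vertex_point R w"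
      using point[of a] False piece(1) by (auto simp: point_in_subset_def split: if_splits)
    then obtain w where w: "w \<in> cells R 0" "\<omega> a = vertex_point R w"
      by blast
    have "\<omega> t = \<omega> a" if "t \<in> {a..b}" for t
      using point[OF that] point[of a] const[OF that] False piece(1) \<open>n = 1\<close>
      by (simp add: point_in_subset_def split: if_splits)
    \<comment> \<open>The edge z is not a cell of \<open>R\<close>, so the constant piece is
      presented by the 0-cube of the vertex w instead.\<close>
    then show ?thesis
      using piece(1) w by (intro piecewise_dpath.piece[of a b w R 0 "\<lambda>_ _. undefined"])
        (auto simp: monotone_cube_path_def cube_0)
  qed
next
  case (join a c b)
  have "a < c" "c < b"
    using join piecewise_dpath_less by blast+
  with join show ?case
    by (intro piecewise_dpath.join[of R _ a c b]) auto
qed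

lemma d_embedding_realization_incl:
  "d_embedding (realization R) (realization P) (realization_incl P)"
  unfolding d_embedding_def dtop_realization
proof (intro conjI ballI)
  fix \<omega> assume \<omega>: "\<omega> \<in> path_set (realization_top R)"
  have "\<omega> t \<in> topspace (realization_top R)" if "t \<in> {0..1}" for t
    using \<omega> that by (auto simp: path_set_def pathin_def continuous_map_def)
  moreover have "compose {0..1} (realization_incl P) \<omega> t = realization_incl P (\<omega> t)" if "t \<in> {0..1}" for t
    using that by (simp add: compose_def)
  ultimately have "\<omega> \<in> dpaths (realization R)" if "compose {0..1} (realization_incl P) \<omega> \<in> dpaths (realization P)"
    using that \<omega> piecewise_dpath_realization_incl[of _ 0 1 \<omega>]
    by (auto simp: dpaths_realization path_set_def)
  moreover have "compose {0..1} (realization_incl P) \<omega> \<in> dpaths (realization P)" if "\<omega> \<in> dpaths (realization R)"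
    using that d_map_realization_incl by (auto simp: d_map_def)
  ultimately show "\<omega> \<in> dpaths (realization R) \<longleftrightarrow>
      compose {0..1} (realization_incl P) \<omega> \<in> dpaths (realization P)"
    by blast
qed (use dspace_realization embedding_realization_incl in auto)

end

section \<open>Vertices and extremal points\<close>

text \<open>The dimension of the open cell that contains the point, read off from an arbitrary
  representative.\<close>

definition interior_coordinates :: "nat \<times> 'a \<times> (nat \<Rightarrow> real) \<Rightarrow> nat" where
  "interior_coordinates = (\<lambda>(n, z, u). card {j \<in> {1..n}. 0 < u j \<and> u j < 1})"

lemma interior_coordinates_glue:
  assumes "glue P p q"
  shows "interior_coordinates p = interior_coordinates q"
  using assms
proof cases
  case (1 z n u k i)
  \<comment> \<open>The new positions of the n old coordinates after one has been inserted at
    i.\<close>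
  let ?skip = "\<lambda>j. if j < i then j else Suc j"
  let ?c = "coface n k i u"
  have c: "?c (?skip j) = u j" if "j \<in> {1..n}" for j
    using that by (auto simp: coface_def)
  have "{j \<in> {1..Suc n}. 0 < ?c j \<and> ?c j < 1} = ?skip ` {j \<in> {1..n}. 0 < u j \<and> u j < 1}"
  proof (intro subset_antisym subsetI)
    fix j assume j: "j \<in> {j \<in> {1..Suc n}. 0 < ?c j \<and> ?c j < 1}"
    then have "j \<noteq> i"
      using 1 by (auto simp: coface_def)
    then have "j = ?skip (if j < i then j else j - 1)" "(if j < i then j else j - 1) \<in> {1..n}"
      using j 1 by auto
    then obtain j' where "j = ?skip j'" "j' \<in> {1..n}"
      by blast
    then show "j \<in> ?skip ` {j \<in> {1..n}. 0 < u j \<and> u j < 1}"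
      using j c[of j'] by (intro image_eqI[of _ _ j']) simp_all
  next
    fix j assume "j \<in> ?skip ` {j \<in> {1..n}. 0 < u j \<and> u j < 1}"
    then obtain j' where "j = ?skip j'" "j' \<in> {1..n}" "0 < u j'" "u j' < 1"
      by blast
    then show "j \<in> {j \<in> {1..Suc n}. 0 < ?c j \<and> ?c j < 1}"
      using c[of j'] by auto
  qed
  moreover have "inj_on ?skip A" for A
    by (auto simp: inj_on_def split: if_splits)
  ultimately have "card {j \<in> {1..Suc n}. 0 < ?c j \<and> ?c j < 1} = card {j \<in> {1..n}. 0 < u j \<and> u j < 1}"
    by (simp only: card_image)
  then show ?thesis
    using 1 by (simp add: interior_coordinates_def)
qed

text \<open>Rounds every nonzero coordinate up to 1 and selects the corresponding corner of z; any
  rounding that fixes 0 and 1 would be compatible with the gluing. Faces are taken from the last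
  coordinate downwards, so that no index has to be shifted.\<close>

primrec cube_vertex :: "'a precubical \<Rightarrow> nat \<Rightarrow> 'a \<Rightarrow> (nat \<Rightarrow> real) \<Rightarrow> 'a" where
  "cube_vertex P 0 z u = z"
| "cube_vertex P (Suc n) z u =
     cube_vertex P n (bdry P (Suc n) (if u (Suc n) = 0 then 0 else 1) (Suc n) z) u"

lemma cube_vertex_cong:
  "(\<And>j. j \<in> {1..n} \<Longrightarrow> u j = w j) \<Longrightarrow> cube_vertex P n z u = cube_vertex P n z w"
  by (induction n arbitrary: z) auto

text \<open>If i is the last coordinate, the coface decides the first face taken. Otherwise the i-th
  face is moved past the last one and the induction hypothesis applies.\<close>

lemma cube_vertex_coface:
  assumes P: "precubical_set P" and k: "k \<in> {0,1}"
  shows "z \<in> cells P (Suc n) \<Longrightarrow> i \<in> {1..Suc n} \<Longrightarrow>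
    cube_vertex P (Suc n) z (coface n k i u) = cube_vertex P n (bdry P (Suc n) k i z) u"
proof (induction n arbitrary: z i)
  case 0
  then show ?case
    using k by (auto simp: coface_def)
next
  case (Suc n)
  let ?c = "coface (Suc n) k i u"
  show ?case
  proof (cases "i = Suc (Suc n)")
    case True
    then have "(if ?c (Suc (Suc n)) = 0 then 0 else 1) = k"
      using k by (auto simp: coface_def)
    then have "cube_vertex P (Suc (Suc n)) z ?c = cube_vertex P (Suc n) (bdry P (Suc (Suc n)) k i z) ?c"
      unfolding cube_vertex.simps(2)[of P "Suc n"] using True by simp
    also have "\<dots> = cube_vertex P (Suc n) (bdry P (Suc (Suc n)) k i z) u"
      using True by (intro cube_vertex_cong) (auto simp: coface_def)
    finally show ?thesis .
  next
    case False
    then have i: "i \<in> {1..Suc n}"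
      using Suc.prems by auto
    define l :: nat where "l = (if u (Suc n) = 0 then 0 else 1)"
    define w where "w = bdry P (Suc (Suc n)) l (Suc (Suc n)) z"
    have l: "l \<in> {0,1}"
      by (simp add: l_def)
    have w: "w \<in> cells P (Suc n)"
      using precubical_bdry[OF P Suc.prems(1) l] by (simp add: w_def)
    have "?c (Suc (Suc n)) = u (Suc n)"
      using i by (auto simp: coface_def)
    then have "cube_vertex P (Suc (Suc n)) z ?c = cube_vertex P (Suc n) w ?c"
      unfolding cube_vertex.simps(2)[of P "Suc n"] by (simp add: w_def l_def)
    also have "\<dots> = cube_vertex P (Suc n) w (coface n k i u)"
      by (intro cube_vertex_cong) (auto simp: coface_def)
    also have "\<dots> = cube_vertex P n (bdry P (Suc n) k i w) u"
      using Suc.IH[OF w i] .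
    \<comment> \<open>The precubical identity, with the larger index being the last one.\<close>
    also have "bdry P (Suc n) k i w = bdry P (Suc n) l (Suc n) (bdry P (Suc (Suc n)) k i z)"
    proof -
      have "\<forall>z\<in>cells P (Suc (Suc n)). bdry P (Suc (Suc n) - 1) k i (bdry P (Suc (Suc n)) l (Suc (Suc n)) z) =
          bdry P (Suc (Suc n) - 1) l (Suc (Suc n) - 1) (bdry P (Suc (Suc n)) k i z)"
        using P k l i unfolding precubical_set_def by (meson atLeastAtMost_iff le_imp_less_Suc order_refl)
      then show ?thesis
        using Suc.prems(1) by (simp add: w_def)
    qed
    also have "cube_vertex P n \<dots> u = cube_vertex P (Suc n) (bdry P (Suc (Suc n)) k i z) u"
      by (simp add: l_def)
    finally show ?thesis .
  qed
qed

text \<open>Distinct vertices could a priori be identified through a chain of higher cubes;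
  \<open>cube_vertex\<close> is constant along such a chain and returns the vertex itself in
  dimension 0.\<close>

lemma vertex_point_eq_iff:
  assumes "precubical_set P" "v \<in> cells P 0" "w \<in> cells P 0"
  shows "vertex_point P v = vertex_point P w \<longleftrightarrow> v = w"
proof
  assume "vertex_point P v = vertex_point P w"
  then have "equivclp (glue P) (0, v, \<lambda>_. undefined) (0, w, \<lambda>_. undefined)"
    using assms by (subst (asm) real_class_eq_iff) (auto simp: cube_0)
  then have "(\<lambda>(n, z, u). cube_vertex P n z u) (0, v, \<lambda>_. undefined)
      = (\<lambda>(n, z, u). cube_vertex P n z u) (0, w, \<lambda>_. undefined)"
  proof (rule equivclp_invariant)
    fix p q assume "glue P p q"
    then show "(case p of (n, z, u) \<Rightarrow> cube_vertex P n z u) = (case q of (n, z, u) \<Rightarrow> cube_vertex P n z u)"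
    proof cases
      case (1 z n u k i)
      show ?thesis
        unfolding 1(1,2) prod.case by (rule cube_vertex_coface[OF assms(1) 1(5,3,6), symmetric])
    qed
  qed
  then show "v = w"
    by simp
qed simp

lemma real_class_eq_interior:
  assumes "z \<in> cells P n" "u \<in> cube n" "z' \<in> cells P n'" "u' \<in> cube n'"
    "real_class P n z u = real_class P n' z' u'"
  shows "interior_coordinates (n, z, u) = interior_coordinates (n', z', u')"
  using equivclp_invariant[OF _ interior_coordinates_glue]
    assms(5)[unfolded real_class_eq_iff[OF assms(1-4)]] .

lemma real_class_vertex_interior:
  assumes "z \<in> cells P n" "u \<in> cube n" "v \<in> cells P 0"
    "real_class P n z u = vertex_point P v" "j \<in> {1..n}"
  shows "u j = 0 \<or> u j = 1"
proof -
  have "card {j \<in> {1..n}. 0 < u j \<and> u j < 1} = 0"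
    using real_class_eq_interior[OF assms(1-3) _ assms(4)]
    by (simp add: cube_0 interior_coordinates_def)
  then have "\<not> (0 < u j \<and> u j < 1)"
    using assms(5) by auto
  then show ?thesis
    using cube_coordinate[OF assms(2,5)] by auto
qed

definition drop_coordinate :: "nat \<Rightarrow> nat \<Rightarrow> (nat \<Rightarrow> real) \<Rightarrow> nat \<Rightarrow> real" where
  "drop_coordinate n j u = (\<lambda>m\<in>{1..n}. if m < j then u m else u (Suc m))"

lemma drop_coordinate_in_cube: "u \<in> cube (Suc n) \<Longrightarrow> drop_coordinate n j u \<in> cube n"
  by (auto simp: drop_coordinate_def cube_eq PiE_iff)

lemma coface_drop_coordinate:
  assumes "u \<in> cube (Suc n)" "j \<in> {1..Suc n}" "u j = real k"
  shows "coface n k j (drop_coordinate n j u) = u"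
proof
  fix m
  show "coface n k j (drop_coordinate n j u) m = u m"
    using assms by (auto simp: coface_def drop_coordinate_def cube_eq PiE_iff extensional_def)
qed

text \<open>Faces are taken in the coordinates other than i, one at a time, until only the i-th one
  is left. The function c records the constant values as natural numbers, the form in which the
  boundary operators expect them.\<close>

lemma edge_of_cube:
  assumes P: "precubical_set P"
  shows "\<lbrakk>z \<in> cells P n; i \<in> {1..n}; \<And>s. s \<in> {0..1} \<Longrightarrow> w s \<in> cube n \<and> w s i = s;
      \<And>j s. \<lbrakk>j \<in> {1..n}; j \<noteq> i; s \<in> {0..1}\<rbrakk> \<Longrightarrow> w s j = real (c j) \<and> c j \<in> {0,1}\<rbrakk>
    \<Longrightarrow> \<exists>e\<in>cells P 1. \<forall>s\<in>{0..1}. real_class P n z (w s) = edge_point P e s"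
proof (induction n arbitrary: z i w c)
  case (Suc n)
  show ?case
  proof (cases "n = 0")
    case True
    then have "i = 1"
      using Suc.prems(2) by simp
    then show ?thesis
      using Suc.prems(1,3) True real_class_edge[of _ P z] by (intro bexI[of _ z]) auto
  next
    case False
    \<comment> \<open>Any coordinate other than i would do, and one exists because n > 0. The index
      i' is the position of i after j has been dropped.\<close>
    define j where "j = (if i = 1 then Suc n else 1)"
    define i' where "i' = (if i < j then i else i - 1)"
    have j: "j \<in> {1..Suc n}" "j \<noteq> i" and i': "i' \<in> {1..n}"
      using Suc.prems(2) False by (auto simp: j_def i'_def)
    have c: "c j \<in> {0,1}"
      using Suc.prems(4)[of j 0] j by auto
    have "\<exists>e\<in>cells P 1. \<forall>s\<in>{0..1}.
        real_class P n (bdry P (Suc n) (c j) j z) (drop_coordinate n j (w s)) = edge_point P e s"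
    proof (rule Suc.IH[where i = i' and c = "\<lambda>m. if m < j then c m else c (Suc m)"])
      show "bdry P (Suc n) (c j) j z \<in> cells P n"
        using precubical_bdry[OF P Suc.prems(1) c j(1)] .
      fix s :: real assume s: "s \<in> {0..1}"
      have "drop_coordinate n j (w s) i' = w s i"
        using i' j Suc.prems(2) by (auto simp: drop_coordinate_def i'_def j_def)
      then show "drop_coordinate n j (w s) \<in> cube n \<and> drop_coordinate n j (w s) i' = s"
        using drop_coordinate_in_cube Suc.prems(3)[OF s] by simp
    next
      fix m s assume m: "m \<in> {1..n}" "m \<noteq> i'" and s: "s \<in> {0..1::real}"
      let ?m = "if m < j then m else Suc m"
      have "?m \<in> {1..Suc n}" "?m \<noteq> i"
        using m j by (auto simp: i'_def split: if_splits)
      then have "w s ?m = real (c ?m) \<and> c ?m \<in> {0,1}"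
        using Suc.prems(4) s by blast
      then show "drop_coordinate n j (w s) m = real (if m < j then c m else c (Suc m)) \<and>
          (if m < j then c m else c (Suc m)) \<in> {0,1}"
        using m by (auto simp: drop_coordinate_def split: if_splits)
    qed (rule i')
    then obtain e where e: "e \<in> cells P 1" "\<And>s. s \<in> {0..1} \<Longrightarrow>
        real_class P n (bdry P (Suc n) (c j) j z) (drop_coordinate n j (w s)) = edge_point P e s"
      by blast
    have "real_class P (Suc n) z (w s) = edge_point P e s" if s: "s \<in> {0..1}" for s
    proof -
      have "w s \<in> cube (Suc n)" "w s j = real (c j)"
        using Suc.prems(3)[OF s] Suc.prems(4)[OF j s] by auto
      then show ?thesis
        using real_class_glue[OF P Suc.prems(1) drop_coordinate_in_cube c j(1)]
          coface_drop_coordinate[OF _ j(1)] e(2)[OF s] by metis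
    qed
    then show ?thesis
      using e(1) by blast
  qed
qed simp

lemma vertex_of_cube:
  assumes P: "precubical_set P"
  shows "\<lbrakk>z \<in> cells P n; u \<in> cube n; \<And>j. j \<in> {1..n} \<Longrightarrow> u j = 0 \<or> u j = 1\<rbrakk>
    \<Longrightarrow> \<exists>v\<in>cells P 0. real_class P n z u = vertex_point P v"
proof (induction n arbitrary: z u)
  case 0
  then show ?case
    by (auto simp: cube_0)
next
  case (Suc n)
  obtain k :: nat where k: "k \<in> {0,1}" "u (Suc n) = real k"
    using Suc.prems(3)[of "Suc n"] by (metis atLeastAtMost_iff insertCI le_add1 of_nat_0 of_nat_1
        order_refl plus_1_eq_Suc)
  have n: "Suc n \<in> {1..Suc n}"
    by simp
  have "\<exists>v\<in>cells P 0. real_class P n (bdry P (Suc n) k (Suc n) z) (drop_coordinate n (Suc n) u)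
      = vertex_point P v"
  proof (rule Suc.IH)
    show "bdry P (Suc n) k (Suc n) z \<in> cells P n"
      using precubical_bdry[OF P Suc.prems(1) k(1) n] .
    show "drop_coordinate n (Suc n) u \<in> cube n"
      using drop_coordinate_in_cube[OF Suc.prems(2)] .
    fix j assume "j \<in> {1..n}"
    then show "drop_coordinate n (Suc n) u j = 0 \<or> drop_coordinate n (Suc n) u j = 1"
      using Suc.prems(3)[of j] by (auto simp: drop_coordinate_def)
  qed
  then show ?case
    using real_class_glue[OF P Suc.prems(1) drop_coordinate_in_cube[OF Suc.prems(2)] k(1) n]
      coface_drop_coordinate[OF Suc.prems(2) n k(2)] by metis
qed

text \<open>If the i-th coordinate were k, letting it run through [0,1] would trace an edge whose
  k-end is v. Hence a minimal vertex (k = 1) is met only at the lowest corner of a cube, and a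
  maximal one (k = 0) only at the highest.\<close>

lemma vertex_coordinate:
  assumes P: "precubical_set P" and k: "k \<in> {0,1}" and v: "v \<in> cells P 0"
    and no_edge: "\<not> (\<exists>e\<in>cells P 1. bdry P 1 k 1 e = v)"
    and z: "z \<in> cells P n" "u \<in> cube n" "real_class P n z u = vertex_point P v" and i: "i \<in> {1..n}"
  shows "u i = 1 - real k"
proof (rule ccontr)
  assume "u i \<noteq> 1 - real k"
  then have ui: "u i = real k"
    using real_class_vertex_interior[OF z(1,2) v z(3) i] k by auto
  have "\<exists>e\<in>cells P 1. \<forall>s\<in>{0..1}. real_class P n z (u(i := s)) = edge_point P e s"
  proof (rule edge_of_cube[OF P z(1) i, where c = "\<lambda>j. if u j = 0 then 0 else 1"])
    fix s :: real assume "s \<in> {0..1}"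
    then show "u(i := s) \<in> cube n \<and> (u(i := s)) i = s"
      using z(2) i by (auto simp: cube_eq PiE_iff extensional_def)
  next
    fix j and s :: real assume j: "j \<in> {1..n}" "j \<noteq> i"
    then show "(u(i := s)) j = real (if u j = 0 then 0 else 1) \<and> (if u j = 0 then 0 else 1) \<in> {0, 1::nat}"
      using real_class_vertex_interior[OF z(1,2) v z(3) j(1)] by auto
  qed
  then obtain e where e: "e \<in> cells P 1" "\<And>s. s \<in> {0..1} \<Longrightarrow> real_class P n z (u(i := s)) = edge_point P e s"
    by blast
  have "real_class P n z u = vertex_point P (bdry P 1 k 1 e)"
    using e(2)[of "real k"] edge_point_endpoint[OF P e(1) k] ui k by (auto simp: fun_upd_idem)
  moreover have "bdry P 1 k 1 e \<in> cells P 0"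
    using precubical_bdry[OF P, of e 0 k 1] e(1) k by simp
  ultimately have "bdry P 1 k 1 e = v"
    using z(3) vertex_point_eq_iff[OF P _ v] by metis
  then show False
    using no_edge e(1) by blast
qed

text \<open>A monotone path that ends in the lowest corner of its cube also starts there; over
  several pieces the vertex is propagated backwards from the end.\<close>

lemma minimal_vertex_dpath:
  assumes P: "precubical_set P" and v: "minimal_vertex P v"
  shows "piecewise_dpath P \<omega> a b \<Longrightarrow> \<omega> b = vertex_point P v \<Longrightarrow> \<omega> a = vertex_point P v"
proof (induction rule: piecewise_dpath.induct)
  case (piece a b z n \<alpha>)
  have cube: "\<alpha> a \<in> cube n" "\<alpha> b \<in> cube n"
    using piece monotone_cube_path_in_cube[OF piece(3)] by auto
  have "\<alpha> a i = \<alpha> b i" if i: "i \<in> {1..n}" for i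
  proof -
    have "\<alpha> b i = 0"
      using vertex_coordinate[OF P, of 1 v z n "\<alpha> b" i] v piece cube i
      by (auto simp: minimal_vertex_def)
    moreover have "\<alpha> a i \<le> \<alpha> b i" "0 \<le> \<alpha> a i"
      using piece i cube_coordinate[OF cube(1) i] by (auto simp: monotone_cube_path_def)
    ultimately show ?thesis
      by simp
  qed
  then have "\<alpha> a = \<alpha> b"
    using PiE_ext[OF cube[unfolded cube_eq]] by blast
  moreover have "\<omega> a = real_class P n z (\<alpha> a)" "\<omega> b = real_class P n z (\<alpha> b)"
    using piece(1,4) by auto
  ultimately show ?case
    using piece.prems by simp
qed blast

lemma maximal_vertex_dpath:
  assumes P: "precubical_set P" and v: "maximal_vertex P v"
  shows "piecewise_dpath P \<omega> a b \<Longrightarrow> \<omega> a = vertex_point P v \<Longrightarrow> \<omega> b = vertex_point P v"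
proof (induction rule: piecewise_dpath.induct)
  case (piece a b z n \<alpha>)
  have cube: "\<alpha> a \<in> cube n" "\<alpha> b \<in> cube n"
    using piece monotone_cube_path_in_cube[OF piece(3)] by auto
  have "\<alpha> a i = \<alpha> b i" if i: "i \<in> {1..n}" for i
  proof -
    have "\<alpha> a i = 1"
      using vertex_coordinate[OF P, of 0 v z n "\<alpha> a" i] v piece cube i
      by (auto simp: maximal_vertex_def)
    moreover have "\<alpha> a i \<le> \<alpha> b i" "\<alpha> b i \<le> 1"
      using piece i cube_coordinate[OF cube(2) i] by (auto simp: monotone_cube_path_def)
    ultimately show ?thesis
      by simp
  qed
  then have "\<alpha> a = \<alpha> b"
    using PiE_ext[OF cube[unfolded cube_eq]] by blast
  moreover have "\<omega> a = real_class P n z (\<alpha> a)" "\<omega> b = real_class P n z (\<alpha> b)"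
    using piece(1,4) by auto
  ultimately show ?case
    using piece.prems by simp
qed blast

section \<open>Extremal points of a realization\<close>

lemma dspace_dpath_in_topspace:
  assumes "dspace X" "\<omega> \<in> dpaths X" "t \<in> {0..1}"
  shows "\<omega> t \<in> topspace (dtop X)"
proof -
  have "continuous_map (top_of_set {0..1}) (dtop X) \<omega>"
    using assms(1,2) unfolding dspace_def path_set_def pathin_def by blast
  then show ?thesis
    using continuous_map_funspace assms(3) by fastforce
qed

text \<open>A set of morphisms is nonempty exactly when there is a d-path, so dihomotopy drops out
  of the condition.\<close>

lemma minimal_point_iff:
  assumes "dspace X"
  shows "minimal_point X a \<longleftrightarrow> a \<in> topspace (dtop X) \<and> (\<forall>\<omega>\<in>dpaths X. \<omega> 1 = a \<longrightarrow> \<omega> 0 = a)"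
  using dspace_dpath_in_topspace[OF assms, of _ 0]
  by (auto simp: minimal_point_def fundamental_category_def dpaths_between_def)

lemma maximal_point_iff:
  assumes "dspace X"
  shows "maximal_point X a \<longleftrightarrow> a \<in> topspace (dtop X) \<and> (\<forall>\<omega>\<in>dpaths X. \<omega> 0 = a \<longrightarrow> \<omega> 1 = a)"
  using dspace_dpath_in_topspace[OF assms, of _ 1]
  by (auto simp: maximal_point_def fundamental_category_def dpaths_between_def)

lemma interior_coordinate_moves:
  assumes z: "z \<in> cells P n" "u \<in> cube n" and i: "i \<in> {1..n}" "0 < u i" "u i < 1"
    and s: "s \<in> {0,1}"
  shows "real_class P n z (u(i := s)) \<noteq> real_class P n z u"
proof
  assume eq: "real_class P n z (u(i := s)) = real_class P n z u"
  have "u(i := s) \<in> cube n"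
    using z(2) i s by (auto simp: cube_eq PiE_iff extensional_def)
  then have "interior_coordinates (n, z, u(i := s)) = interior_coordinates (n, z, u)"
    by (rule real_class_eq_interior[OF z(1) _ z eq])
  moreover have "{j \<in> {1..n}. 0 < (u(i := s)) j \<and> (u(i := s)) j < 1}
      = {j \<in> {1..n}. 0 < u j \<and> u j < 1} - {i}"
    using s by auto
  moreover have "card ({j \<in> {1..n}. 0 < u j \<and> u j < 1} - {i}) < card {j \<in> {1..n}. 0 < u j \<and> u j < 1}"
    using i by (intro card_Diff1_less) auto
  ultimately show False
    by (simp add: interior_coordinates_def)
qed

lemma dpath_moving_coordinate:
  assumes z: "z \<in> cells P n" "u \<in> cube n" and i: "i \<in> {1..n}"
    and s: "0 \<le> s" "s \<le> s'" "s' \<le> 1"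
  shows "(\<lambda>t\<in>{0..1}. real_class P n z (u(i := s + t * (s' - s)))) \<in> dpaths (realization P)"
proof -
  let ?\<alpha> = "\<lambda>t::real. u(i := s + t * (s' - s))"
  have range: "s + t * (s' - s) \<in> {0..1}" if "t \<in> {0..1}" for t
  proof -
    have "t * (s' - s) \<le> s' - s" "0 \<le> t * (s' - s)"
      using that s mult_left_le_one_le[of "s' - s" t] by auto
    then show ?thesis
      using s by auto
  qed
  have "continuous_map (top_of_set {0..1}) (cube_top n) ?\<alpha>"
    unfolding cube_top_def continuous_map_componentwise
  proof (intro conjI ballI)
    show "?\<alpha> ` topspace (top_of_set {0..1}) \<subseteq> extensional {1..n}"
      using z(2) i by (auto simp: cube_eq PiE_iff extensional_def)
    fix j assume j: "j \<in> {1..n}"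
    show "continuous_map (top_of_set {0..1}) (top_of_set {0..1}) (\<lambda>t. ?\<alpha> t j)"
    proof (cases "j = i")
      case True
      have "continuous_on {0..1} (\<lambda>t. s + t * (s' - s))"
        by (intro continuous_intros)
      then show ?thesis
        using range True by (auto simp: continuous_map_in_subtopology)
    next
      case False
      then show ?thesis
        using cube_coordinate[OF z(2) j] by (auto simp: continuous_map_in_subtopology)
    qed
  qed
  moreover have "?\<alpha> t j \<le> ?\<alpha> t' j" if "t \<le> t'" for t t' j
    using that s by (auto intro!: mult_right_mono)
  ultimately have "monotone_cube_path n 0 1 ?\<alpha>"
    by (auto simp: monotone_cube_path_def)
  then have "piecewise_dpath P (\<lambda>t\<in>{0..1}. real_class P n z (?\<alpha> t)) 0 1"
    using z(1) by (intro piecewise_dpath.piece[of 0 1 z _ n ?\<alpha>]) auto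
  then show ?thesis
    by (simp add: dpaths_realization)
qed

text \<open>Half edges are used because their inner end is the midpoint, which is never a vertex;
  the far end of a whole edge would be the given vertex again if the edge is a loop.\<close>

lemma dpath_edge:
  assumes "e \<in> cells P 1"
  shows "(\<lambda>t\<in>{0..1}. edge_point P e (t / 2)) \<in> dpaths (realization P)"
    "(\<lambda>t\<in>{0..1}. edge_point P e ((1 + t) / 2)) \<in> dpaths (realization P)"
proof -
  have "piecewise_dpath P (\<lambda>t. edge_point P e (t / 2)) 0 1"
    "piecewise_dpath P (\<lambda>t. edge_point P e ((1 + t) / 2)) 0 1"
    by (rule piecewise_dpath_edge[OF assms]; auto intro!: continuous_intros mono_onI)+
  then have "piecewise_dpath P (\<lambda>t\<in>{0..1}. edge_point P e (t / 2)) 0 1"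
    "piecewise_dpath P (\<lambda>t\<in>{0..1}. edge_point P e ((1 + t) / 2)) 0 1"
    by (auto elim: piecewise_dpath_cong)
  then show "(\<lambda>t\<in>{0..1}. edge_point P e (t / 2)) \<in> dpaths (realization P)"
    "(\<lambda>t\<in>{0..1}. edge_point P e ((1 + t) / 2)) \<in> dpaths (realization P)"
    by (simp_all add: dpaths_realization)
qed

lemma edge_midpoint_not_vertex:
  assumes "e \<in> cells P 1" "v \<in> cells P 0"
  shows "edge_point P e (1/2) \<noteq> vertex_point P v"
proof
  assume "edge_point P e (1/2) = vertex_point P v"
  then have "real_class P 1 e (\<lambda>j\<in>{1..1}. 1/2) = vertex_point P v"
    by (simp add: edge_point_def)
  from real_class_vertex_interior[OF assms(1) cube_1_restrict assms(2) this, of 1] show False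
    by simp
qed

lemma minimal_point_realization:
  assumes P: "precubical_set P"
  shows "minimal_point (realization P) c \<longleftrightarrow> (\<exists>v. minimal_vertex P v \<and> c = vertex_point P v)"
proof
  assume "minimal_point (realization P) c"
  then have c: "c \<in> topspace (realization_top P)"
    and min: "\<And>\<omega>. \<omega> \<in> dpaths (realization P) \<Longrightarrow> \<omega> 1 = c \<Longrightarrow> \<omega> 0 = c"
    by (auto simp: minimal_point_iff[OF dspace_realization])
  obtain n z u where z: "z \<in> cells P n" "u \<in> cube n" "c = real_class P n z u"
    using c by (rule realization_point_cases)
  have "u j = 0 \<or> u j = 1" if j: "j \<in> {1..n}" for j
  proof (rule ccontr)
    assume "\<not> (u j = 0 \<or> u j = 1)"
    then have uj: "0 < u j" "u j < 1"
      using cube_coordinate[OF z(2) j] by auto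
    then have "real_class P n z (u(j := 0)) = real_class P n z u"
      using min[OF dpath_moving_coordinate[OF z(1,2) j, of 0 "u j"]] z(3) by simp
    then show False
      using interior_coordinate_moves[OF z(1,2) j uj, of 0] by simp
  qed
  then obtain v where v: "v \<in> cells P 0" "c = vertex_point P v"
    using vertex_of_cube[OF P z(1,2)] z(3) by blast
  have "bdry P 1 1 1 e \<noteq> v" if e: "e \<in> cells P 1" for e
  proof
    assume "bdry P 1 1 1 e = v"
    then have "edge_point P e 1 = c"
      using edge_point_endpoint[OF P e, of 1] v(2) by simp
    then have "edge_point P e (1/2) = c"
      using min[OF dpath_edge(2)[OF e]] by simp
    then show False
      using edge_midpoint_not_vertex[OF e v(1)] v(2) by simp
  qed
  then show "\<exists>v. minimal_vertex P v \<and> c = vertex_point P v"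
    using v by (auto simp: minimal_vertex_def)
next
  assume "\<exists>v. minimal_vertex P v \<and> c = vertex_point P v"
  then show "minimal_point (realization P) c"
    using minimal_vertex_dpath[OF P, of _ _ 0 1]
    by (auto simp: minimal_point_iff[OF dspace_realization] dpaths_realization minimal_vertex_def cube_0)
qed

lemma maximal_point_realization:
  assumes P: "precubical_set P"
  shows "maximal_point (realization P) c \<longleftrightarrow> (\<exists>v. maximal_vertex P v \<and> c = vertex_point P v)"
proof
  assume "maximal_point (realization P) c"
  then have c: "c \<in> topspace (realization_top P)"
    and max: "\<And>\<omega>. \<omega> \<in> dpaths (realization P) \<Longrightarrow> \<omega> 0 = c \<Longrightarrow> \<omega> 1 = c"
    by (auto simp: maximal_point_iff[OF dspace_realization])
  obtain n z u where z: "z \<in> cells P n" "u \<in> cube n" "c = real_class P n z u"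
    using c by (rule realization_point_cases)
  have "u j = 0 \<or> u j = 1" if j: "j \<in> {1..n}" for j
  proof (rule ccontr)
    assume "\<not> (u j = 0 \<or> u j = 1)"
    then have uj: "0 < u j" "u j < 1"
      using cube_coordinate[OF z(2) j] by auto
    then have "real_class P n z (u(j := 1)) = real_class P n z u"
      using max[OF dpath_moving_coordinate[OF z(1,2) j, of "u j" 1]] z(3) by simp
    then show False
      using interior_coordinate_moves[OF z(1,2) j uj, of 1] by simp
  qed
  then obtain v where v: "v \<in> cells P 0" "c = vertex_point P v"
    using vertex_of_cube[OF P z(1,2)] z(3) by blast
  have "bdry P 1 0 1 e \<noteq> v" if e: "e \<in> cells P 1" for e
  proof
    assume "bdry P 1 0 1 e = v"
    then have "edge_point P e 0 = c"
      using edge_point_endpoint[OF P e, of 0] v(2) by simp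
    then have "edge_point P e (1/2) = c"
      using max[OF dpath_edge(1)[OF e]] by simp
    then show False
      using edge_midpoint_not_vertex[OF e v(1)] v(2) by simp
  qed
  then show "\<exists>v. maximal_vertex P v \<and> c = vertex_point P v"
    using v by (auto simp: maximal_vertex_def)
next
  assume "\<exists>v. maximal_vertex P v \<and> c = vertex_point P v"
  then show "maximal_point (realization P) c"
    using maximal_vertex_dpath[OF P, of _ _ 0 1]
    by (auto simp: maximal_point_iff[OF dspace_realization] dpaths_realization maximal_vertex_def cube_0)
qed

lemma cells_Extrl: "cells (Extrl P) n = (if n = 0 then {v. minimal_vertex P v \<or> maximal_vertex P v} else {})"
  by (simp add: Extrl_def restrict_cells_def)

lemma extremal_points_realization:
  assumes "precubical_set P"
  shows "extremal_points (realization P) = vertex_point P ` cells (Extrl P) 0"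
  by (auto simp: extremal_points_def minimal_point_realization[OF assms]
      maximal_point_realization[OF assms] cells_Extrl)

section \<open>Fundamental categories and d-path spaces under dihomotopy equivalences\<close>

lemma dspace_dpath_extensional: "dspace X \<Longrightarrow> \<omega> \<in> dpaths X \<Longrightarrow> \<omega> \<in> extensional {0..1}"
  by (auto simp: dspace_def path_set_def)

lemma dspace_dpath_continuous:
  "dspace X \<Longrightarrow> \<omega> \<in> dpaths X \<Longrightarrow> continuous_map (top_of_set {0..1}) (dtop X) \<omega>"
  unfolding dspace_def path_set_def pathin_def by blast

lemma dspace_dinterval: "dspace dinterval"
  unfolding dspace_def
proof (intro conjI ballI allI impI)
  show "dpaths dinterval \<subseteq> path_set (dtop dinterval)"
    by (auto simp: dinterval_def path_set_def pathin_def increasing_map_def continuous_map_in_subtopology)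
next
  fix a assume "a \<in> topspace (dtop dinterval)"
  moreover have "continuous_on {0..1::real} (\<lambda>t\<in>{0..1}. a)"
    by (rule continuous_on_eq[OF continuous_on_const]) simp
  ultimately have "increasing_map (\<lambda>t\<in>{0..1}. a)"
    by (auto simp: dinterval_def increasing_map_def mono_on_def)
  then show "(\<lambda>t\<in>{0..1}. a) \<in> dpaths dinterval"
    by (simp add: dinterval_def)
next
  fix \<omega> \<phi> assume "\<omega> \<in> dpaths dinterval" and \<phi>: "increasing_map \<phi>"
  then have \<omega>: "increasing_map \<omega>"
    by (simp add: dinterval_def)
  have "continuous_on {0..1} (\<lambda>t. \<omega> (\<phi> t))"
    by (rule continuous_on_compose2[of "{0..1}" \<omega>]) (use \<omega> \<phi> in \<open>auto simp: increasing_map_def\<close>)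
  then have "continuous_on {0..1} (compose {0..1} \<omega> \<phi>)"
    by (rule continuous_on_eq) (simp add: compose_def)
  moreover have "mono_on {0..1} (compose {0..1} \<omega> \<phi>)"
    using \<omega> \<phi> by (auto simp: increasing_map_def mono_on_def compose_def image_subset_iff)
  ultimately have "increasing_map (compose {0..1} \<omega> \<phi>)"
    using \<omega> \<phi> by (auto simp: increasing_map_def compose_def image_subset_iff)
  then show "compose {0..1} \<omega> \<phi> \<in> dpaths dinterval"
    by (simp add: dinterval_def)
next
  fix \<omega> \<eta> assume "\<omega> \<in> dpaths dinterval" "\<eta> \<in> dpaths dinterval" and eq: "\<omega> 1 = \<eta> 0"
  then have \<omega>: "continuous_on {0..1} \<omega>" "\<And>t. t \<in> {0..1} \<Longrightarrow> \<omega> t \<in> {0..1}"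
      "\<And>s t. 0 \<le> s \<Longrightarrow> s \<le> t \<Longrightarrow> t \<le> 1 \<Longrightarrow> \<omega> s \<le> \<omega> t"
    and \<eta>: "continuous_on {0..1} \<eta>" "\<And>t. t \<in> {0..1} \<Longrightarrow> \<eta> t \<in> {0..1}"
      "\<And>s t. 0 \<le> s \<Longrightarrow> s \<le> t \<Longrightarrow> t \<le> 1 \<Longrightarrow> \<eta> s \<le> \<eta> t"
    by (auto simp: dinterval_def increasing_map_def mono_on_def image_subset_iff)
  let ?c = "\<lambda>t. if t \<le> 1/2 then \<omega> (2 * t) else \<eta> (2 * t - 1)"
  have "continuous_on {0..1} ?c"
  proof (rule continuous_on_cases_le[where h = "\<lambda>t. t"])
    show "continuous_on {t \<in> {0..1}. t \<le> 1/2} (\<lambda>t. \<omega> (2 * t))"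
      by (rule continuous_on_compose2[OF \<omega>(1)]) (auto intro!: continuous_intros)
    show "continuous_on {t \<in> {0..1}. 1/2 \<le> t} (\<lambda>t. \<eta> (2 * t - 1))"
      by (rule continuous_on_compose2[OF \<eta>(1)]) (auto intro!: continuous_intros)
    fix t :: real assume t: "t = 1/2"
    show "\<omega> (2 * t) = \<eta> (2 * t - 1)"
      unfolding t using eq by simp
  qed auto
  then have "continuous_on {0..1} (concat_path \<omega> \<eta>)"
    by (rule continuous_on_eq) (simp add: concat_path_def)
  moreover have "?c t \<in> {0..1}" if "t \<in> {0..1}" for t
    using that \<omega>(2)[of "2 * t"] \<eta>(2)[of "2 * t - 1"] by (cases "t \<le> 1/2") simp_all
  then have "concat_path \<omega> \<eta> ` {0..1} \<subseteq> {0..1}"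
    unfolding concat_path_def by (simp only: image_subset_iff restrict_apply) simp
  moreover have "?c s \<le> ?c t" if st: "0 \<le> s" "s \<le> t" "t \<le> 1" for s t
  proof -
    consider "t \<le> 1/2" | "s \<le> 1/2" "1/2 < t" | "1/2 < s"
      by linarith
    then show ?thesis
    proof cases
      case 1
      then show ?thesis
        using st \<omega>(3)[of "2 * s" "2 * t"] by auto
    next
      case 2
      then show ?thesis
        using st eq \<omega>(3)[of "2 * s" 1] \<eta>(3)[of 0 "2 * t - 1"] by auto
    next
      case 3
      then show ?thesis
        using st \<eta>(3)[of "2 * s - 1" "2 * t - 1"] by auto
    qed
  qed
  then have "mono_on {0..1} (concat_path \<omega> \<eta>)"
    unfolding concat_path_def by (intro mono_onI) auto
  ultimately have "increasing_map (concat_path \<omega> \<eta>)"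
    by (simp add: increasing_map_def)
  then show "concat_path \<omega> \<eta> \<in> dpaths dinterval"
    by (simp add: dinterval_def concat_path_def)
qed

text \<open>One direction applies h to the identity path, the other is closure of d-paths under
  increasing reparametrization. The restriction is there because a d-map is arbitrary off
  [0,1].\<close>

lemma d_map_dinterval_iff:
  assumes X: "dspace X"
  shows "d_map dinterval X h \<longleftrightarrow> restrict h {0..1} \<in> dpaths X"
proof
  assume h: "d_map dinterval X h"
  have "continuous_on {0..1::real} (\<lambda>t\<in>{0..1}. t)"
    by (rule continuous_on_eq[OF continuous_on_id]) simp
  then have "increasing_map (\<lambda>t\<in>{0..1}. t)"
    by (auto simp: increasing_map_def mono_on_def)
  then have "(\<lambda>t\<in>{0..1}. t) \<in> dpaths dinterval"
    by (simp add: dinterval_def)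
  then have "compose {0..1} h (\<lambda>t\<in>{0..1}. t) \<in> dpaths X"
    using h by (simp add: d_map_def)
  also have "compose {0..1} h (\<lambda>t\<in>{0..1}. t) = restrict h {0..1}"
    by (auto simp: compose_def)
  finally show "restrict h {0..1} \<in> dpaths X" .
next
  assume h: "restrict h {0..1} \<in> dpaths X"
  have "continuous_map (top_of_set {0..1}) (dtop X) h"
    by (rule continuous_map_eq[OF dspace_dpath_continuous[OF X h]]) simp
  moreover have "compose {0..1} h \<phi> \<in> dpaths X" if "\<phi> \<in> dpaths dinterval" for \<phi>
  proof -
    have \<phi>: "increasing_map \<phi>"
      using that by (simp add: dinterval_def)
    then have "compose {0..1} (restrict h {0..1}) \<phi> = compose {0..1} h \<phi>"
      unfolding compose_def by (intro restrict_ext) (auto simp: increasing_map_def image_subset_iff)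
    moreover have "compose {0..1} (restrict h {0..1}) \<phi> \<in> dpaths X"
      using X h \<phi> unfolding dspace_def by blast
    ultimately show ?thesis
      by simp
  qed
  ultimately show "d_map dinterval X h"
    using X dspace_dinterval by (simp add: d_map_def dinterval_def)
qed

section \<open>Dihomotopy of d-paths\<close>

abbreviation dpath_dihomotopic :: "'p dspace \<Rightarrow> (real \<Rightarrow> 'p) \<Rightarrow> (real \<Rightarrow> 'p) \<Rightarrow> bool" where
  "dpath_dihomotopic X \<equiv> dihomotopic_rel {0,1} dinterval X"

lemma dtop_dinterval [simp]: "dtop dinterval = top_of_set {0..1}"
  by (simp add: dinterval_def)

text \<open>The ends of h are prescribed on [0,1] only, so the property required at each time must
  depend on values in [0,1] alone; \<open>d_map_dinterval_iff\<close> shows that it does.\<close>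

lemma dpath_dihomotopicI:
  assumes X: "dspace X"
    and h: "continuous_map (prod_topology (top_of_set {0..1::real}) (top_of_set {0..1})) (dtop X) h"
    and ends: "\<And>s. s \<in> {0..1} \<Longrightarrow> h (0, s) = \<omega> s" "\<And>s. s \<in> {0..1} \<Longrightarrow> h (1, s) = \<eta> s"
    and paths: "\<And>t. t \<in> {0..1} \<Longrightarrow> (\<lambda>s\<in>{0..1}. h (t, s)) \<in> dpaths X"
      "\<And>t. t \<in> {0..1} \<Longrightarrow> h (t, 0) = \<omega> 0 \<and> h (t, 1) = \<omega> 1"
  shows "dpath_dihomotopic X \<omega> \<eta>"
proof -
  have "h (1, 0) = \<omega> 0" "h (1, 1) = \<omega> 1" "h (1, 0) = \<eta> 0" "h (1, 1) = \<eta> 1"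
    using paths(2)[of 1] ends(2)[of 0] ends(2)[of 1] by simp_all
  then have "\<omega> 0 = \<eta> 0" "\<omega> 1 = \<eta> 1"
    by simp_all
  moreover have "d_map dinterval X (\<lambda>s. h (t, s))" if "t \<in> {0..1}" for t
    unfolding d_map_dinterval_iff[OF X] using paths(1)[OF that] .
  ultimately show ?thesis
    unfolding dihomotopic_rel_def dtop_dinterval
  proof (subst homotopic_with)
    fix h k :: "real \<Rightarrow> 'a" assume eq: "\<And>x. x \<in> topspace (top_of_set {0..1::real}) \<Longrightarrow> h x = k x"
    then have "restrict h {0..1} = restrict k {0..1}"
      by (intro restrict_ext) simp
    then have "d_map dinterval X h \<longleftrightarrow> d_map dinterval X k"
      by (simp add: d_map_dinterval_iff[OF X])
    then show "d_map dinterval X h \<and> (\<forall>a\<in>{0, 1}. h a = \<omega> a \<and> h a = \<eta> a) \<longleftrightarrow>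
        d_map dinterval X k \<and> (\<forall>a\<in>{0, 1}. k a = \<omega> a \<and> k a = \<eta> a)"
      using eq by simp
  qed (use h ends paths(2) in \<open>auto intro!: exI[of _ h]\<close>)
qed

lemma dihomotopic_relE:
  assumes "dihomotopic_rel A X Y f g"
  obtains h where "continuous_map (prod_topology (top_of_set {0..1::real}) (dtop X)) (dtop Y) h"
    "\<And>x. h (0, x) = f x" "\<And>x. h (1, x) = g x"
    "\<And>t. t \<in> {0..1} \<Longrightarrow> d_map X Y (\<lambda>x. h (t, x))"
    "\<And>t a. t \<in> {0..1} \<Longrightarrow> a \<in> A \<Longrightarrow> h (t, a) = f a \<and> h (t, a) = g a"
proof -
  obtain h where h: "continuous_map (prod_topology (top_of_set {0..1::real}) (dtop X)) (dtop Y) h \<and>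
      (\<forall>x. h (0, x) = f x) \<and> (\<forall>x. h (1, x) = g x) \<and>
      (\<forall>t\<in>{0..1}. d_map X Y (\<lambda>x. h (t, x)) \<and> (\<forall>a\<in>A. h (t, a) = f a \<and> h (t, a) = g a))"
    using assms unfolding dihomotopic_rel_def homotopic_with_def by (rule exE)
  show ?thesis
    by (rule that[of h]) (use h in blast)+
qed

lemma dpath_dihomotopicE:
  assumes X: "dspace X" and "dpath_dihomotopic X \<omega> \<eta>"
  obtains h where "continuous_map (prod_topology (top_of_set {0..1::real}) (top_of_set {0..1})) (dtop X) h"
    "\<And>s. h (0, s) = \<omega> s" "\<And>s. h (1, s) = \<eta> s"
    "\<And>t. t \<in> {0..1} \<Longrightarrow> (\<lambda>s\<in>{0..1}. h (t, s)) \<in> dpaths X"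
    "\<And>t. t \<in> {0..1} \<Longrightarrow> h (t, 0) = \<omega> 0 \<and> h (t, 1) = \<omega> 1"
proof (rule dihomotopic_relE[OF assms(2)])
  fix h
  assume "continuous_map (prod_topology (top_of_set {0..1::real}) (dtop dinterval)) (dtop X) h"
    "\<And>s. h (0, s) = \<omega> s" "\<And>s. h (1, s) = \<eta> s"
    "\<And>t. t \<in> {0..1} \<Longrightarrow> d_map dinterval X (\<lambda>s. h (t, s))"
    "\<And>t a. t \<in> {0..1} \<Longrightarrow> a \<in> {0, 1} \<Longrightarrow> h (t, a) = \<omega> a \<and> h (t, a) = \<eta> a"
  then show thesis
    by (intro that[of h]) (simp_all only: dtop_dinterval d_map_dinterval_iff[OF X] insert_iff simp_thms)
qed

lemma dpath_dihomotopic_ends: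
  assumes "dpath_dihomotopic X \<omega> \<eta>"
  shows "\<omega> 0 = \<eta> 0 \<and> \<omega> 1 = \<eta> 1"
  using homotopic_with_imp_property[OF assms[unfolded dihomotopic_rel_def]] by blast

lemma dpath_dihomotopic_refl:
  assumes X: "dspace X" and \<omega>: "\<omega> \<in> dpaths X"
  shows "dpath_dihomotopic X \<omega> \<omega>"
proof -
  have "restrict \<omega> {0..1} \<in> dpaths X"
    using \<omega> dspace_dpath_extensional[OF X \<omega>] by (simp add: extensional_restrict)
  then show ?thesis
    unfolding dihomotopic_rel_def dtop_dinterval
    using dspace_dpath_continuous[OF X \<omega>]
    by (intro homotopic_with_equal) (auto simp: d_map_dinterval_iff[OF X])
qed

lemma dpath_dihomotopic_sym:
  assumes "dpath_dihomotopic X \<omega> \<eta>"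
  shows "dpath_dihomotopic X \<eta> \<omega>"
  using homotopic_with_symD[OF assms[unfolded dihomotopic_rel_def]]
  unfolding dihomotopic_rel_def by (rule homotopic_with_mono) auto

lemma dpath_dihomotopic_trans:
  assumes "dpath_dihomotopic X \<omega> \<eta>" "dpath_dihomotopic X \<eta> \<zeta>"
  shows "dpath_dihomotopic X \<omega> \<zeta>"
proof -
  let ?P = "\<lambda>h. d_map dinterval X h \<and> (\<forall>a\<in>{0, 1}. h a = \<omega> a \<and> h a = \<zeta> a)"
  have ends: "\<omega> 0 = \<eta> 0 \<and> \<omega> 1 = \<eta> 1" "\<eta> 0 = \<zeta> 0 \<and> \<eta> 1 = \<zeta> 1"
    using assms dpath_dihomotopic_ends by blast+
  have "homotopic_with ?P (dtop dinterval) (dtop X) \<omega> \<eta>"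
    using assms(1) unfolding dihomotopic_rel_def by (rule homotopic_with_mono) (use ends in auto)
  moreover have "homotopic_with ?P (dtop dinterval) (dtop X) \<eta> \<zeta>"
    using assms(2) unfolding dihomotopic_rel_def by (rule homotopic_with_mono) (use ends in auto)
  ultimately show ?thesis
    unfolding dihomotopic_rel_def by (rule homotopic_with_trans)
qed

lemma dpath_class_eq_iff:
  assumes X: "dspace X" and "\<omega> \<in> dpaths X" "\<eta> \<in> dpaths X"
  shows "dpath_class X \<omega> = dpath_class X \<eta> \<longleftrightarrow> dpath_dihomotopic X \<omega> \<eta>"
proof
  assume "dpath_class X \<omega> = dpath_class X \<eta>"
  then have "\<eta> \<in> dpath_class X \<omega>"
    using dpath_dihomotopic_refl[OF X assms(3)] assms(3) by (simp add: dpath_class_def)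
  then show "dpath_dihomotopic X \<omega> \<eta>"
    by (simp add: dpath_class_def)
next
  assume "dpath_dihomotopic X \<omega> \<eta>"
  then show "dpath_class X \<omega> = dpath_class X \<eta>"
    using dpath_dihomotopic_trans dpath_dihomotopic_sym unfolding dpath_class_def by blast
qed

lemma dpath_dihomotopic_compose:
  assumes f: "d_map X Y f" and "dpath_dihomotopic X \<omega> \<eta>"
  shows "dpath_dihomotopic Y (compose {0..1} f \<omega>) (compose {0..1} f \<eta>)"
proof -
  have X: "dspace X" and Y: "dspace Y" and cont: "continuous_map (dtop X) (dtop Y) f"
    using f by (auto simp: d_map_def)
  obtain h where h: "continuous_map (prod_topology (top_of_set {0..1::real}) (top_of_set {0..1})) (dtop X) h"
    "\<And>s. h (0, s) = \<omega> s" "\<And>s. h (1, s) = \<eta> s"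
    "\<And>t. t \<in> {0..1} \<Longrightarrow> (\<lambda>s\<in>{0..1}. h (t, s)) \<in> dpaths X"
    "\<And>t. t \<in> {0..1} \<Longrightarrow> h (t, 0) = \<omega> 0 \<and> h (t, 1) = \<omega> 1"
    by (rule dpath_dihomotopicE[OF X assms(2)]) (rule that)
  show ?thesis
  proof (rule dpath_dihomotopicI[OF Y, where h = "f \<circ> h"])
    show "continuous_map (prod_topology (top_of_set {0..1::real}) (top_of_set {0..1})) (dtop Y) (f \<circ> h)"
      using h(1) cont by (rule continuous_map_compose)
    fix t :: real assume t: "t \<in> {0..1}"
    have "compose {0..1} f (\<lambda>s\<in>{0..1}. h (t, s)) \<in> dpaths Y"
      using h(4)[OF t] f by (simp add: d_map_def)
    moreover have "compose {0..1} f (\<lambda>s\<in>{0..1}. h (t, s)) = (\<lambda>s\<in>{0..1}. (f \<circ> h) (t, s))"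
      by (auto simp: compose_def)
    ultimately show "(\<lambda>s\<in>{0..1}. (f \<circ> h) (t, s)) \<in> dpaths Y"
      by simp
    show "(f \<circ> h) (t, 0) = compose {0..1} f \<omega> 0 \<and> (f \<circ> h) (t, 1) = compose {0..1} f \<omega> 1"
      using h(5)[OF t] by (simp add: compose_def)
  qed (use h in \<open>auto simp: compose_def\<close>)
qed

lemma dpath_concat:
  "\<lbrakk>dspace X; \<omega> \<in> dpaths X; \<eta> \<in> dpaths X; \<omega> 1 = \<eta> 0\<rbrakk> \<Longrightarrow> concat_path \<omega> \<eta> \<in> dpaths X"
  by (auto simp: dspace_def)

text \<open>The two homotopies run side by side. They fit together at s = 1/2 at every time because
  both keep the end points fixed.\<close>

lemma dpath_dihomotopic_concat:
  assumes X: "dspace X" and "dpath_dihomotopic X \<omega> \<omega>'" "dpath_dihomotopic X \<eta> \<eta>'" "\<omega> 1 = \<eta> 0"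
  shows "dpath_dihomotopic X (concat_path \<omega> \<eta>) (concat_path \<omega>' \<eta>')"
proof -
  let ?I = "top_of_set {0..1::real}"
  obtain h where h: "continuous_map (prod_topology ?I ?I) (dtop X) h"
    "\<And>s. h (0, s) = \<omega> s" "\<And>s. h (1, s) = \<omega>' s"
    "\<And>t. t \<in> {0..1} \<Longrightarrow> (\<lambda>s\<in>{0..1}. h (t, s)) \<in> dpaths X"
    "\<And>t. t \<in> {0..1} \<Longrightarrow> h (t, 0) = \<omega> 0 \<and> h (t, 1) = \<omega> 1"
    by (rule dpath_dihomotopicE[OF X assms(2)]) (rule that)
  obtain k where k: "continuous_map (prod_topology ?I ?I) (dtop X) k"
    "\<And>s. k (0, s) = \<eta> s" "\<And>s. k (1, s) = \<eta>' s"
    "\<And>t. t \<in> {0..1} \<Longrightarrow> (\<lambda>s\<in>{0..1}. k (t, s)) \<in> dpaths X"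
    "\<And>t. t \<in> {0..1} \<Longrightarrow> k (t, 0) = \<eta> 0 \<and> k (t, 1) = \<eta> 1"
    by (rule dpath_dihomotopicE[OF X assms(3)]) (rule that)
  define l where "l p = (if snd p \<le> 1/2 then h (fst p, 2 * snd p) else k (fst p, 2 * snd p - 1))"
    for p :: "real \<times> real"
  have snd_cont: "continuous_map (prod_topology ?I ?I) euclideanreal snd"
    by (rule continuous_map_into_fulltopology[OF continuous_map_snd])
  \<comment> \<open>One substitution for both halves: c = 0 on the left and c = -1 on the
    right.\<close>
  have rescale: "continuous_map (subtopology (prod_topology ?I ?I) S) (prod_topology ?I ?I)
      (\<lambda>p. (fst p, 2 * snd p + c))"
    if "\<And>p. p \<in> S \<Longrightarrow> snd p \<in> {0..1} \<Longrightarrow> 2 * snd p + c \<in> {0..1}" for S c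
  proof (rule continuous_map_pairedI)
    show "continuous_map (subtopology (prod_topology ?I ?I) S) ?I fst"
      by (intro continuous_map_from_subtopology continuous_map_fst)
    have "continuous_map (subtopology (prod_topology ?I ?I) S) euclideanreal (\<lambda>p. 2 * snd p + c)"
      by (intro continuous_map_add continuous_map_real_mult continuous_map_from_subtopology[OF snd_cont])
         auto
    then show "continuous_map (subtopology (prod_topology ?I ?I) S) ?I (\<lambda>p. 2 * snd p + c)"
      using that by (auto simp: continuous_map_in_subtopology)
  qed
  show ?thesis
  proof (rule dpath_dihomotopicI[OF X, where h = l])
    show "continuous_map (prod_topology ?I ?I) (dtop X) l"
      unfolding l_def
    proof (rule continuous_map_cases_le)
      show "continuous_map (prod_topology ?I ?I) euclideanreal snd"
        by (rule snd_cont)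
      let ?T = "{p \<in> topspace (prod_topology ?I ?I). snd p \<le> 1/2}"
      have "continuous_map (subtopology (prod_topology ?I ?I) ?T) (dtop X) (h \<circ> (\<lambda>p. (fst p, 2 * snd p + 0)))"
        by (intro continuous_map_compose[OF rescale h(1)]) auto
      then show "continuous_map (subtopology (prod_topology ?I ?I) ?T) (dtop X) (\<lambda>p. h (fst p, 2 * snd p))"
        by (simp add: o_def)
      let ?T = "{p \<in> topspace (prod_topology ?I ?I). 1/2 \<le> snd p}"
      have "continuous_map (subtopology (prod_topology ?I ?I) ?T) (dtop X) (k \<circ> (\<lambda>p. (fst p, 2 * snd p + -1)))"
        by (intro continuous_map_compose[OF rescale k(1)]) auto
      then show "continuous_map (subtopology (prod_topology ?I ?I) ?T) (dtop X) (\<lambda>p. k (fst p, 2 * snd p - 1))"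
        by (simp add: o_def)
      fix p assume "p \<in> topspace (prod_topology ?I ?I)" "snd p = 1/2"
      then obtain t where "p = (t, 1/2)" "t \<in> {0..1}"
        by (cases p) auto
      then show "h (fst p, 2 * snd p) = k (fst p, 2 * snd p - 1)"
        using h(5)[of t] k(5)[of t] assms(4) by simp
    qed simp
    fix t :: real assume t: "t \<in> {0..1}"
    have "concat_path (\<lambda>s\<in>{0..1}. h (t, s)) (\<lambda>s\<in>{0..1}. k (t, s)) \<in> dpaths X"
      using h(4,5)[OF t] k(4,5)[OF t] assms(4) by (intro dpath_concat[OF X]) auto
    moreover have "concat_path (\<lambda>s\<in>{0..1}. h (t, s)) (\<lambda>s\<in>{0..1}. k (t, s)) = (\<lambda>s\<in>{0..1}. l (t, s))"
      unfolding concat_path_def by (intro restrict_ext) (auto simp: l_def)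
    ultimately show "(\<lambda>s\<in>{0..1}. l (t, s)) \<in> dpaths X"
      by simp
    show "l (t, 0) = concat_path \<omega> \<eta> 0 \<and> l (t, 1) = concat_path \<omega> \<eta> 1"
      using h(5)[OF t] k(5)[OF t] by (simp add: l_def concat_path_def)
  qed (auto simp: l_def concat_path_def h k)
qed

text \<open>Composition and \<open>class_map\<close> are unions over all representatives, which
  avoids choosing one. When the value does not depend on the representative, the union collapses to
  the value at \<omega>.\<close>

lemma UN_dpath_class:
  assumes X: "dspace X" and \<omega>: "\<omega> \<in> dpaths X"
    and const: "\<And>\<eta>. \<eta> \<in> dpaths X \<Longrightarrow> dpath_dihomotopic X \<omega> \<eta> \<Longrightarrow> F \<eta> = F \<omega>"
  shows "(\<Union>\<eta>\<in>dpath_class X \<omega>. F \<eta>) = F \<omega>"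
proof -
  have "\<omega> \<in> dpath_class X \<omega>"
    using dpath_dihomotopic_refl[OF X \<omega>] \<omega> by (simp add: dpath_class_def)
  moreover have "F \<eta> = F \<omega>" if "\<eta> \<in> dpath_class X \<omega>" for \<eta>
    using const that by (simp add: dpath_class_def)
  ultimately show ?thesis
    by blast
qed

lemma Comp_fundamental_category:
  assumes X: "dspace X" and "\<omega> \<in> dpaths X" "\<eta> \<in> dpaths X" "\<omega> 1 = \<eta> 0"
  shows "Comp (fundamental_category X) a b c (dpath_class X \<omega>) (dpath_class X \<eta>)
    = dpath_class X (concat_path \<omega> \<eta>)"
proof -
  have *: "dpath_class X (concat_path \<omega>' \<eta>') = dpath_class X (concat_path \<omega> \<eta>)"
    if "\<omega>' \<in> dpaths X" "dpath_dihomotopic X \<omega> \<omega>'" "\<eta>' \<in> dpaths X" "dpath_dihomotopic X \<eta> \<eta>'" for \<omega>' \<eta>'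
  proof -
    have "\<omega>' 1 = \<eta>' 0"
      using that assms(4) dpath_dihomotopic_ends[OF that(2)] dpath_dihomotopic_ends[OF that(4)] by simp
    then show ?thesis
      using that assms
      by (intro dpath_class_eq_iff[OF X, THEN iffD2] dpath_concat[OF X]
          dpath_dihomotopic_sym[OF dpath_dihomotopic_concat[OF X]]) auto
  qed
  have "(\<Union>\<eta>'\<in>dpath_class X \<eta>. dpath_class X (concat_path \<omega>' \<eta>')) = dpath_class X (concat_path \<omega> \<eta>)"
    if "\<omega>' \<in> dpaths X" "dpath_dihomotopic X \<omega> \<omega>'" for \<omega>'
    using UN_dpath_class[OF X assms(3), of "\<lambda>\<eta>'. dpath_class X (concat_path \<omega>' \<eta>')"]
      *[OF that] assms dpath_dihomotopic_refl[OF X assms(3)] by simp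
  then show ?thesis
    using UN_dpath_class[OF X assms(2), of "\<lambda>\<omega>'. \<Union>\<eta>'\<in>dpath_class X \<eta>. dpath_class X (concat_path \<omega>' \<eta>')"]
      assms(2) dpath_dihomotopic_refl[OF X assms(2)] by (simp add: fundamental_category_def)
qed

section \<open>Functors induced by d-maps\<close>

definition class_map :: "'q dspace \<Rightarrow> ('p \<Rightarrow> 'q) \<Rightarrow> (real \<Rightarrow> 'p) set \<Rightarrow> (real \<Rightarrow> 'q) set" where
  "class_map Y f C = (\<Union>\<omega>\<in>C. dpath_class Y (compose {0..1} f \<omega>))"

lemma d_map_dpath: "d_map X Y f \<Longrightarrow> \<omega> \<in> dpaths X \<Longrightarrow> compose {0..1} f \<omega> \<in> dpaths Y"
  by (simp add: d_map_def)

lemma class_map_dpath_class: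
  assumes f: "d_map X Y f" and \<omega>: "\<omega> \<in> dpaths X"
  shows "class_map Y f (dpath_class X \<omega>) = dpath_class Y (compose {0..1} f \<omega>)"
proof -
  have X: "dspace X" and Y: "dspace Y"
    using f by (auto simp: d_map_def)
  show ?thesis
    unfolding class_map_def
  proof (rule UN_dpath_class[OF X \<omega>])
    fix \<eta> assume "\<eta> \<in> dpaths X" "dpath_dihomotopic X \<omega> \<eta>"
    then show "dpath_class Y (compose {0..1} f \<eta>) = dpath_class Y (compose {0..1} f \<omega>)"
      using dpath_class_eq_iff[OF Y] d_map_dpath[OF f] \<omega>
        dpath_dihomotopic_sym[OF dpath_dihomotopic_compose[OF f]] by metis
  qed
qed

lemma compose_dpaths_between:
  assumes "d_map X Y f" "\<omega> \<in> dpaths_between X a b"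
  shows "compose {0..1} f \<omega> \<in> dpaths_between Y (f a) (f b)"
  using d_map_dpath[OF assms(1)] assms(2)
  by (auto simp: dpaths_between_def) (simp_all add: compose_def)

lemma compose_concat_path:
  "compose {0..1} f (concat_path \<omega> \<eta>) = concat_path (compose {0..1} f \<omega>) (compose {0..1} f \<eta>)"
  by (auto simp: compose_def concat_path_def fun_eq_iff)

lemma is_functor_class_map:
  assumes f: "d_map X Y f" and S: "S \<subseteq> topspace (dtop X)" "f ` S \<subseteq> T"
  shows "is_functor (full_subcategory (fundamental_category X) S) (full_subcategory (fundamental_category Y) T)
     f (\<lambda>_ _. class_map Y f)"
  unfolding is_functor_def
proof (intro conjI ballI)
  let ?C = "full_subcategory (fundamental_category X) S"
  let ?D = "full_subcategory (fundamental_category Y) T"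
  have X: "dspace X" and Y: "dspace Y"
    using f by (auto simp: d_map_def)
  show "f ` Obj ?C \<subseteq> Obj ?D"
    using S by (simp add: full_subcategory_def)
  have Hom: "Hom ?C a b = dpath_class X ` dpaths_between X a b"
    "Hom ?D c d = dpath_class Y ` dpaths_between Y c d" for a b c d
    by (simp_all add: full_subcategory_def fundamental_category_def)
  fix a assume a: "a \<in> Obj ?C"
  show "class_map Y f ` Hom ?C a b \<subseteq> Hom ?D (f a) (f b)" for b
    unfolding Hom using class_map_dpath_class[OF f] compose_dpaths_between[OF f]
    by (auto simp: dpaths_between_def)
  show "class_map Y f (Ident ?C a) = Ident ?D (f a)"
  proof -
    have "(\<lambda>t\<in>{0..1}. a) \<in> dpaths X"
      using X S(1) a by (auto simp: dspace_def full_subcategory_def)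
    moreover have "compose {0..1} f (\<lambda>t\<in>{0..1::real}. a) = (\<lambda>t\<in>{0..1}. f a)"
      by (auto simp: compose_def)
    ultimately show ?thesis
      using class_map_dpath_class[OF f] by (simp add: full_subcategory_def fundamental_category_def)
  qed
  fix b c C D assume "C \<in> Hom ?C a b" "D \<in> Hom ?C b c"
  then obtain \<omega> \<eta> where \<omega>: "\<omega> \<in> dpaths_between X a b" "C = dpath_class X \<omega>"
      and \<eta>: "\<eta> \<in> dpaths_between X b c" "D = dpath_class X \<eta>"
    by (auto simp: Hom)
  have Comp: "Comp ?C = Comp (fundamental_category X)" "Comp ?D = Comp (fundamental_category Y)"
    by (simp_all add: full_subcategory_def)
  have *: "\<omega> \<in> dpaths X" "\<eta> \<in> dpaths X" "\<omega> 1 = \<eta> 0"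
    using \<omega> \<eta> by (auto simp: dpaths_between_def)
  then have "compose {0..1} f \<omega> 1 = compose {0..1} f \<eta> 0"
    by (simp add: compose_def)
  then show "class_map Y f (Comp ?C a b c C D) =
      Comp ?D (f a) (f b) (f c) (class_map Y f C) (class_map Y f D)"
    unfolding Comp \<omega>(2) \<eta>(2)
    using * by (simp add: Comp_fundamental_category[OF X] Comp_fundamental_category[OF Y]
        class_map_dpath_class[OF f] dpath_concat[OF X] d_map_dpath[OF f] compose_concat_path)
qed

text \<open>The homotopy from k to the identity is evaluated along \<omega>; the end points do not
  move because they lie in the fixed set A.\<close>

lemma compose_dihomotopic_id:
  assumes k: "dihomotopic_rel A X X k id" and \<omega>: "\<omega> \<in> dpaths X" "\<omega> 0 \<in> A" "\<omega> 1 \<in> A"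
    and X: "dspace X"
  shows "dpath_dihomotopic X (compose {0..1} k \<omega>) \<omega>"
proof (rule dihomotopic_relE[OF k])
  let ?I = "top_of_set {0..1::real}"
  fix H assume H: "continuous_map (prod_topology ?I (dtop X)) (dtop X) H"
    "\<And>x. H (0, x) = k x" "\<And>x. H (1, x) = id x"
    "\<And>t. t \<in> {0..1} \<Longrightarrow> d_map X X (\<lambda>x. H (t, x))"
    "\<And>t a. t \<in> {0..1} \<Longrightarrow> a \<in> A \<Longrightarrow> H (t, a) = k a \<and> H (t, a) = id a"
  show ?thesis
  proof (rule dpath_dihomotopicI[OF X, where h = "\<lambda>(t, s). H (t, \<omega> s)"])
    have "continuous_map (prod_topology ?I ?I) (prod_topology ?I (dtop X)) (\<lambda>p. (fst p, (\<omega> \<circ> snd) p))"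
      by (intro continuous_map_pairedI continuous_map_fst
          continuous_map_compose[OF continuous_map_snd] dspace_dpath_continuous[OF X \<omega>(1)])
    from continuous_map_compose[OF this H(1)]
    show "continuous_map (prod_topology ?I ?I) (dtop X) (\<lambda>(t, s). H (t, \<omega> s))"
      by (simp add: o_def case_prod_unfold)
    fix t :: real assume t: "t \<in> {0..1}"
    have "compose {0..1} (\<lambda>x. H (t, x)) \<omega> \<in> dpaths X"
      using H(4)[OF t] d_map_dpath \<omega>(1) by blast
    then show "(\<lambda>s\<in>{0..1}. case (t, s) of (t, s) \<Rightarrow> H (t, \<omega> s)) \<in> dpaths X"
      by (simp add: compose_def)
    show "(case (t, 0) of (t, s) \<Rightarrow> H (t, \<omega> s)) = compose {0..1} k \<omega> 0 \<and>
        (case (t, 1) of (t, s) \<Rightarrow> H (t, \<omega> s)) = compose {0..1} k \<omega> 1"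
      using H(5)[OF t] \<omega>(2,3) by (simp add: compose_def)
  qed (use H in \<open>auto simp: compose_def\<close>)
qed

lemma compose_compose: "compose S g (compose S f \<omega>) = compose S (g \<circ> f) \<omega>"
  by (auto simp: compose_def)

text \<open>On A the map g inverts f, so f is bijective on the objects in S. For injectivity on
  morphisms apply g and cancel \<open>g \<circ> f\<close>; for surjectivity, \<eta> is dihomotopic
  to the f-image of its g-image. Only the end points have to lie in A; the d-paths themselves may
  leave it.\<close>

lemma isomorphic_full_subcategories:
  assumes f: "d_map X Y f" and g: "d_map Y X g"
    and gf: "dihomotopic_rel A X X (g \<circ> f) id" "\<And>a. a \<in> A \<Longrightarrow> g (f a) = a"
    and fg: "dihomotopic_rel (f ` A) Y Y (f \<circ> g) id"
    and S: "S \<subseteq> A" "S \<subseteq> topspace (dtop X)"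
  shows "isomorphic_categories (full_subcategory (fundamental_category X) S)
     (full_subcategory (fundamental_category Y) (f ` S))"
  unfolding isomorphic_categories_def
proof (intro exI conjI ballI)
  let ?C = "full_subcategory (fundamental_category X) S"
  let ?D = "full_subcategory (fundamental_category Y) (f ` S)"
  have X: "dspace X" and Y: "dspace Y"
    using f by (auto simp: d_map_def)
  show "is_functor ?C ?D f (\<lambda>_ _. class_map Y f)"
    by (rule is_functor_class_map[OF f S(2) order_refl])
  show "bij_betw f (Obj ?C) (Obj ?D)"
    using S gf(2) by (auto simp: full_subcategory_def bij_betw_def intro!: inj_on_inverseI[of _ g])
  fix a b assume "a \<in> Obj ?C" "b \<in> Obj ?C"
  then have ab: "a \<in> A" "b \<in> A"
    using S by (auto simp: full_subcategory_def)
  have Hom: "Hom ?C a b = dpath_class X ` dpaths_between X a b"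
    "Hom ?D (f a) (f b) = dpath_class Y ` dpaths_between Y (f a) (f b)"
    by (simp_all add: full_subcategory_def fundamental_category_def)
  have fX: "class_map Y f (dpath_class X \<omega>) = dpath_class Y (compose {0..1} f \<omega>)"
    "compose {0..1} f \<omega> \<in> dpaths Y" "\<omega> \<in> dpaths X"
    "dpath_dihomotopic X (compose {0..1} g (compose {0..1} f \<omega>)) \<omega>"
    if "\<omega> \<in> dpaths_between X a b" for \<omega>
  proof -
    show \<omega>: "\<omega> \<in> dpaths X"
      using that by (simp add: dpaths_between_def)
    then show "compose {0..1} f \<omega> \<in> dpaths Y" "class_map Y f (dpath_class X \<omega>) = dpath_class Y (compose {0..1} f \<omega>)"
      using d_map_dpath[OF f] class_map_dpath_class[OF f] by blast+
    show "dpath_dihomotopic X (compose {0..1} g (compose {0..1} f \<omega>)) \<omega>"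
      unfolding compose_compose using that ab
      by (intro compose_dihomotopic_id[OF gf(1) \<omega> _ _ X]) (auto simp: dpaths_between_def)
  qed
  show "bij_betw (class_map Y f) (Hom ?C a b) (Hom ?D (f a) (f b))"
    unfolding bij_betw_def Hom
  proof (intro conjI subset_antisym)
    show "inj_on (class_map Y f) (dpath_class X ` dpaths_between X a b)"
    proof (intro inj_onI, elim imageE)
      fix C C' \<omega> \<omega>' assume eq: "class_map Y f C = class_map Y f C'"
        and C: "C = dpath_class X \<omega>" "\<omega> \<in> dpaths_between X a b"
        and C': "C' = dpath_class X \<omega>'" "\<omega>' \<in> dpaths_between X a b"
      have "dpath_dihomotopic Y (compose {0..1} f \<omega>) (compose {0..1} f \<omega>')"
        using eq dpath_class_eq_iff[OF Y] fX[OF C(2)] fX[OF C'(2)] C C' by simp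
      then have "dpath_dihomotopic X (compose {0..1} g (compose {0..1} f \<omega>)) (compose {0..1} g (compose {0..1} f \<omega>'))"
        by (rule dpath_dihomotopic_compose[OF g])
      then have "dpath_dihomotopic X \<omega> \<omega>'"
        using dpath_dihomotopic_trans[OF dpath_dihomotopic_sym[OF fX(4)[OF C(2)]]]
          dpath_dihomotopic_trans[OF _ fX(4)[OF C'(2)]] by blast
      then show "C = C'"
        using C C' dpath_class_eq_iff[OF X] fX(3) by simp
    qed
    show "class_map Y f ` dpath_class X ` dpaths_between X a b \<subseteq> dpath_class Y ` dpaths_between Y (f a) (f b)"
      using fX(1) compose_dpaths_between[OF f] by auto
    show "dpath_class Y ` dpaths_between Y (f a) (f b) \<subseteq> class_map Y f ` dpath_class X ` dpaths_between X a b"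
    proof (intro image_subsetI)
      fix \<eta> assume \<eta>: "\<eta> \<in> dpaths_between Y (f a) (f b)"
      then have \<eta>Y: "\<eta> \<in> dpaths Y"
        by (simp add: dpaths_between_def)
      have g\<eta>: "compose {0..1} g \<eta> \<in> dpaths_between X a b"
        using compose_dpaths_between[OF g \<eta>] gf(2) ab by simp
      have "dpath_dihomotopic Y (compose {0..1} f (compose {0..1} g \<eta>)) \<eta>"
        unfolding compose_compose using \<eta> ab
        by (intro compose_dihomotopic_id[OF fg \<eta>Y _ _ Y]) (auto simp: dpaths_between_def)
      then have "dpath_class Y \<eta> = class_map Y f (dpath_class X (compose {0..1} g \<eta>))"
        using dpath_class_eq_iff[OF Y] fX(1,2)[OF g\<eta>] \<eta>Y by metis
      then show "dpath_class Y \<eta> \<in> class_map Y f ` dpath_class X ` dpaths_between X a b"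
        using g\<eta> by blast
    qed
  qed
qed

subsection \<open>Spaces of d-paths\<close>

lemma topspace_compact_open: "topspace (compact_open_top X) = path_set X"
proof -
  have "path_set X \<in> {{\<omega> \<in> path_set X. \<omega> ` K \<subseteq> U} |K U. compactin (top_of_set {0..1}) K \<and> openin X U}"
    by (intro CollectI exI[of _ "{}"]) auto
  then show ?thesis
    unfolding compact_open_top_def topology_generated_by_topspace by blast
qed

lemma topspace_dpath_space: "dspace X \<Longrightarrow> topspace (dpath_space X a b) = dpaths_between X a b"
  by (auto simp: dpath_space_def topspace_compact_open dpaths_between_def dspace_def)

text \<open>Joint continuity in time and d-path, by which a homotopy of d-maps becomes a homotopy of
  d-path spaces. It is tested on the subbasic sets of the compact-open topology.\<close>

lemma continuous_map_compose_homotopy: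
  assumes X: "dspace X"
    and H: "continuous_map (prod_topology (top_of_set {0..1::real}) (dtop X)) (dtop Y) H"
    and paths: "\<And>t \<omega>. \<lbrakk>t \<in> {0..1}; \<omega> \<in> dpaths_between X a b\<rbrakk>
      \<Longrightarrow> compose {0..1} (\<lambda>x. H (t, x)) \<omega> \<in> dpaths_between Y c d"
    and Y: "dspace Y"
  shows "continuous_map (prod_topology (top_of_set {0..1}) (dpath_space X a b)) (dpath_space Y c d)
    (\<lambda>(t, \<omega>). compose {0..1} (\<lambda>x. H (t, x)) \<omega>)"
proof -
  let ?I = "top_of_set {0..1::real}"
  let ?h = "\<lambda>(t, \<omega>). compose {0..1} (\<lambda>x. H (t, x)) \<omega>"
  let ?D = "prod_topology ?I (dpath_space X a b)"
  have top: "topspace ?D = {0..1} \<times> dpaths_between X a b"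
    by (simp add: topspace_dpath_space[OF X])
  have into: "?h ` topspace ?D \<subseteq> dpaths_between Y c d"
    unfolding top using paths by auto
  have "continuous_map ?D (compact_open_top (dtop Y)) ?h"
    unfolding compact_open_top_def
  proof (rule continuous_on_generated_topo)
    have "?h ` topspace ?D \<subseteq> topspace (compact_open_top (dtop Y))"
      using into topspace_dpath_space[OF Y, of c d] by (auto simp: dpath_space_def)
    then show "?h ` topspace ?D \<subseteq>
        \<Union> {{\<omega> \<in> path_set (dtop Y). \<omega> ` K \<subseteq> U} |K U. compactin ?I K \<and> openin (dtop Y) U}"
      by (simp only: compact_open_top_def topology_generated_by_topspace)
  next
    fix B assume "B \<in> {{\<omega> \<in> path_set (dtop Y). \<omega> ` K \<subseteq> U} |K U. compactin ?I K \<and> openin (dtop Y) U}"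
    then obtain K U where B: "B = {\<omega> \<in> path_set (dtop Y). \<omega> ` K \<subseteq> U}" and K: "compactin ?I K"
        and U: "openin (dtop Y) U"
      by blast
    have K01: "K \<subseteq> {0..1}"
      using compactin_subset_topspace[OF K] by simp
    define W where "W = {p \<in> topspace (prod_topology ?I (dtop X)). H p \<in> U}"
    have W: "openin (prod_topology ?I (dtop X)) W"
      using H U unfolding W_def continuous_map_def by blast
    show "openin ?D (?h -` B \<inter> topspace ?D)"
      unfolding openin_prod_topology_alt
    proof (intro allI impI)
      fix t \<omega> assume t\<omega>: "(t, \<omega>) \<in> ?h -` B \<inter> topspace ?D"
      then have t: "t \<in> {0..1}" and \<omega>: "\<omega> \<in> dpaths_between X a b"
        by (auto simp: topspace_dpath_space[OF X])
      then have \<omega>X: "\<omega> \<in> dpaths X"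
        by (simp add: dpaths_between_def)
      have "H (t, \<omega> s) \<in> U" if s: "s \<in> K" for s
      proof -
        have "compose {0..1} (\<lambda>x. H (t, x)) \<omega> s \<in> U"
          using t\<omega> s by (auto simp: B)
        then show ?thesis
          using s K01 by (simp add: compose_def subset_iff)
      qed
      then have sub: "{t} \<times> \<omega> ` K \<subseteq> W"
        using t K01 dspace_dpath_in_topspace[OF X \<omega>X] by (auto simp: W_def)
      have "compactin (dtop X) (\<omega> ` K)"
        using K dspace_dpath_continuous[OF X \<omega>X] by (rule image_compactin)
      \<comment> \<open>The tube lemma for the compact sets {t} and the image of K under \<omega>:
        for times in T and d-paths sending K into V, the result sends K into U.\<close>
      then obtain T V where TV: "openin ?I T" "openin (dtop X) V" "{t} \<subseteq> T" "\<omega> ` K \<subseteq> V" "T \<times> V \<subseteq> W"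
        using Wallace_theorem_prod_topology[of ?I "{t}" "dtop X" "\<omega> ` K" W] t W sub by auto
      define N where "N = {\<eta> \<in> path_set (dtop X). \<eta> ` K \<subseteq> V} \<inter> dpaths_between X a b"
      have "openin (dpath_space X a b) N"
        unfolding N_def dpath_space_def compact_open_top_def
        by (intro openin_subtopology_Int topology_generated_by_Basis) (use K TV(2) in blast)
      moreover have "\<omega> \<in> N"
        using TV(4) \<omega> \<omega>X X by (auto simp: N_def dspace_def)
      moreover have "T \<times> N \<subseteq> ?h -` B \<inter> topspace ?D"
      proof (intro subsetI)
        fix q assume q: "q \<in> T \<times> N"
        obtain t' \<eta> where [simp]: "q = (t', \<eta>)"
          by fastforce
        have t': "t' \<in> {0..1}" and \<eta>: "\<eta> \<in> dpaths_between X a b"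
          using q openin_subset[OF TV(1)] by (auto simp: N_def)
        then have "?h q \<in> dpaths_between Y c d"
          using paths by simp
        then have "?h q \<in> path_set (dtop Y)"
          using Y by (auto simp: dspace_def dpaths_between_def)
        moreover have "?h q ` K \<subseteq> U"
        proof (intro image_subsetI)
          fix s assume s: "s \<in> K"
          then have "(t', \<eta> s) \<in> W"
            using TV(5) q by (auto simp: N_def)
          then show "?h q s \<in> U"
            using s K01 by (auto simp: W_def compose_def)
        qed
        ultimately show "q \<in> ?h -` B \<inter> topspace ?D"
          using t' \<eta> by (simp add: B topspace_dpath_space[OF X])
      qed
      ultimately show "\<exists>U V. openin ?I U \<and> openin (dpath_space X a b) V \<and> t \<in> U \<and> \<omega> \<in> V \<and>
          U \<times> V \<subseteq> ?h -` B \<inter> topspace ?D"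
        using TV(1,3) by blast
    qed
  qed
  then show ?thesis
    using into unfolding dpath_space_def[of Y] continuous_map_in_subtopology by auto
qed

text \<open>The special case of a homotopy that is constant in t, evaluated at t = 0.\<close>

lemma continuous_map_compose_dpath_space:
  assumes f: "d_map X Y f"
  shows "continuous_map (dpath_space X a b) (dpath_space Y (f a) (f b)) (compose {0..1} f)"
proof -
  have X: "dspace X" and Y: "dspace Y" and cont: "continuous_map (dtop X) (dtop Y) f"
    using f by (auto simp: d_map_def)
  have "continuous_map (prod_topology (top_of_set {0..1}) (dpath_space X a b)) (dpath_space Y (f a) (f b))
      (\<lambda>(t::real, \<omega>). compose {0..1} (\<lambda>x. (f \<circ> snd) (t, x)) \<omega>)"
    using compose_dpaths_between[OF f]
    by (intro continuous_map_compose_homotopy[OF X _ _ Y] continuous_map_compose[OF continuous_map_snd cont])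
       (simp add: o_def)
  moreover have "continuous_map (dpath_space X a b)
      (prod_topology (top_of_set {0..1}) (dpath_space X a b)) (\<lambda>\<omega>. (0::real, \<omega>))"
    by (intro continuous_map_pairedI) auto
  ultimately show ?thesis
    by (auto dest: continuous_map_compose simp: o_def)
qed

lemma homotopic_compose_dpath_space:
  assumes X: "dspace X" and k: "dihomotopic_rel A X X k id" and ab: "a \<in> A" "b \<in> A"
  shows "homotopic_with (\<lambda>_. True) (dpath_space X a b) (dpath_space X a b) (compose {0..1} k) id"
proof (rule dihomotopic_relE[OF k])
  let ?I = "top_of_set {0..1::real}"
  fix H assume H: "continuous_map (prod_topology ?I (dtop X)) (dtop X) H"
    "\<And>x. H (0, x) = k x" "\<And>x. H (1, x) = id x"
    "\<And>t. t \<in> {0..1} \<Longrightarrow> d_map X X (\<lambda>x. H (t, x))"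
    "\<And>t a. t \<in> {0..1} \<Longrightarrow> a \<in> A \<Longrightarrow> H (t, a) = k a \<and> H (t, a) = id a"
  have "continuous_map (prod_topology ?I (dpath_space X a b)) (dpath_space X a b)
      (\<lambda>(t, \<omega>). compose {0..1} (\<lambda>x. H (t, x)) \<omega>)"
  proof (rule continuous_map_compose_homotopy[OF X H(1) _ X])
    fix t \<omega> assume "t \<in> {0..1::real}" "\<omega> \<in> dpaths_between X a b"
    then show "compose {0..1} (\<lambda>x. H (t, x)) \<omega> \<in> dpaths_between X a b"
      using compose_dpaths_between[OF H(4), of t \<omega> a b] H(5)[of t a] H(5)[of t b] ab by (metis id_apply)
  qed
  moreover have "compose {0..1} (\<lambda>x. x) \<omega> = \<omega>" if "\<omega> \<in> dpaths_between X a b" for \<omega>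
    using dspace_dpath_extensional[OF X, of \<omega>] that
    by (simp add: compose_def dpaths_between_def extensional_restrict)
  ultimately show ?thesis
    by (subst homotopic_with)
       (auto simp: topspace_dpath_space[OF X] H(2,3)
         intro!: exI[of _ "\<lambda>(t, \<omega>). compose {0..1} (\<lambda>x. H (t, x)) \<omega>"])
qed

text \<open>The dihomotopies fix the points of A, so at every time they map d-paths between the
  given end points to such d-paths again.\<close>

lemma homotopy_equivalent_dpath_space:
  assumes f: "d_map X Y f" and g: "d_map Y X g"
    and gf: "dihomotopic_rel A X X (g \<circ> f) id" "\<And>a. a \<in> A \<Longrightarrow> g (f a) = a"
    and fg: "dihomotopic_rel (f ` A) Y Y (f \<circ> g) id"
    and ab: "a \<in> A" "b \<in> A"
  shows "dpath_space X a b homotopy_equivalent_space dpath_space Y (f a) (f b)"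
  unfolding homotopy_equivalent_space_def
proof (intro exI conjI)
  have X: "dspace X" and Y: "dspace Y"
    using f by (auto simp: d_map_def)
  show "continuous_map (dpath_space X a b) (dpath_space Y (f a) (f b)) (compose {0..1} f)"
    by (rule continuous_map_compose_dpath_space[OF f])
  show "continuous_map (dpath_space Y (f a) (f b)) (dpath_space X a b) (compose {0..1} g)"
    using continuous_map_compose_dpath_space[OF g, of "f a" "f b"] gf(2) ab by simp
  have "compose {0..1} g \<circ> compose {0..1} f = compose {0..1} (g \<circ> f)"
    "compose {0..1} f \<circ> compose {0..1} g = compose {0..1} (f \<circ> g)"
    by (auto simp: fun_eq_iff compose_def)
  note * = this
  show "homotopic_with (\<lambda>x. True) (dpath_space X a b) (dpath_space X a b)
      (compose {0..1} g \<circ> compose {0..1} f) id"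
    "homotopic_with (\<lambda>x. True) (dpath_space Y (f a) (f b)) (dpath_space Y (f a) (f b))
      (compose {0..1} f \<circ> compose {0..1} g) id"
    unfolding * using homotopic_compose_dpath_space[OF X gf(1) ab]
      homotopic_compose_dpath_space[OF Y fg, of "f a" "f b"] ab by blast+
qed

section \<open>Contracting an edge\<close>

text \<open>The maps to come differ from \<open>real_class\<close> only on vertices and edges, so
  gluing at the ends of edges is separated from gluing in higher cubes.\<close>

lemma glue_cases:
  assumes "glue P p q"
  obtains
    (edge) e k where "e \<in> cells P 1" "k \<in> {0,1}" "p = (0, bdry P 1 k 1 e, \<lambda>_. undefined)"
      "q = (1, e, \<lambda>j\<in>{1..1}. real k)"
  | (high) n z u k i where "n \<ge> 1" "z \<in> cells P (Suc n)" "u \<in> cube n" "k \<in> {0,1}" "i \<in> {1..Suc n}"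
      "p = (n, bdry P (Suc n) k i z, u)" "q = (Suc n, z, coface n k i u)"
  using assms
proof cases
  case (1 z n u k i)
  show thesis
  proof (cases "n = 0")
    case True
    then have "i = 1" "u = (\<lambda>_. undefined)"
      using 1 by (auto simp: cube_0)
    then show thesis
      using 1 True by (intro edge[of z k]) (simp_all add: coface_0 flip: One_nat_def)
  next
    case False
    then show thesis
      using 1 by (intro high[of n z u k i]) simp_all
  qed
qed

lemma d_map_cong:
  assumes "d_map X Y h" and eq: "\<And>x. x \<in> topspace (dtop X) \<Longrightarrow> h x = k x"
  shows "d_map X Y k"
proof -
  have X: "dspace X"
    using assms(1) by (simp add: d_map_def)
  have "compose {0..1} h \<omega> = compose {0..1} k \<omega>" if "\<omega> \<in> dpaths X" for \<omega> :: "real \<Rightarrow> 'a"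
    unfolding compose_def using dspace_dpath_in_topspace[OF X that] eq by (intro restrict_ext) simp
  moreover have "continuous_map (dtop X) (dtop Y) k"
    using assms(1) by (auto simp: d_map_def intro: continuous_map_eq[OF _ eq])
  ultimately show ?thesis
    using assms(1) by (simp add: d_map_def)
qed

text \<open>Equalities are demanded on the space only: an induced map has no prescribed value
  elsewhere, so that, for instance, \<open>retraction\<close> at time 1 is known to agree with
  \<open>id\<close> only on |P|.\<close>

lemma dihomotopic_relI:
  assumes H: "continuous_map (prod_topology (top_of_set {0..1::real}) (dtop X)) (dtop Y) H"
    and ends: "\<And>x. x \<in> topspace (dtop X) \<Longrightarrow> H (0, x) = f x"
      "\<And>x. x \<in> topspace (dtop X) \<Longrightarrow> H (1, x) = g x"
    and d: "\<And>t. t \<in> {0..1} \<Longrightarrow> d_map X Y (\<lambda>x. H (t, x))"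
    and A: "\<And>t a. t \<in> {0..1} \<Longrightarrow> a \<in> A \<Longrightarrow> H (t, a) = f a \<and> H (t, a) = g a" "A \<subseteq> topspace (dtop X)"
  shows "dihomotopic_rel A X Y f g"
  unfolding dihomotopic_rel_def
proof (subst homotopic_with)
  fix h k :: "'a \<Rightarrow> 'b" assume "\<And>x. x \<in> topspace (dtop X) \<Longrightarrow> h x = k x"
  then show "d_map X Y h \<and> (\<forall>a\<in>A. h a = f a \<and> h a = g a) \<longleftrightarrow>
      d_map X Y k \<and> (\<forall>a\<in>A. k a = f a \<and> k a = g a)"
    using d_map_cong[of X Y h k] d_map_cong[of X Y k h] A(2) by (metis subsetD)
qed (use assms in blast)

text \<open>\<open>only_x\<close> and \<open>no_square\<close> express (i) and (ii) by single
  boundary operators. For b = 0 the edge \<open>x\<close> leads from \<open>v1\<close> to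
  \<open>v0\<close> and the edges of \<open>Y\<close> leave \<open>v0\<close>; for b = 1 all
  directions are reversed.\<close>

locale edge_contraction =
  fixes P :: "'a precubical" and b :: nat and x :: 'a and v0 v1 :: 'a and Y :: "'a set" and Q R :: "'a precubical"
  assumes P: "precubical_set P" and b: "b \<in> {0,1}"
    and x: "x \<in> cells P 1" "regular P 1 x"
    and only_x: "\<And>e. \<lbrakk>e \<in> cells P 1; bdry P 1 (1 - b) 1 e = v0\<rbrakk> \<Longrightarrow> e = x"
    and no_square: "\<And>e k z l i. \<lbrakk>e \<in> cells P 1; k \<in> {0,1}; bdry P 1 k 1 e = v0; z \<in> cells P 2;
        l \<in> {0,1}; i \<in> {1..2}\<rbrakk> \<Longrightarrow> bdry P 2 l i z \<noteq> e"
    and v0: "v0 = bdry P 1 (1 - b) 1 x" and v1: "v1 = bdry P 1 b 1 x"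
    and Y: "Y = {y \<in> cells P 1. bdry P 1 b 1 y = v0}"
    and Q: "Q = \<lparr>cells = (\<lambda>n. if n = 0 then cells P 0 - {v0}
                             else if n = 1 then cells P 1 - {x} else cells P n),
                 bdry = (\<lambda>n k i z. if n = 1 \<and> z \<in> Y \<and> i = 1 \<and> k = b then v1
                                    else bdry P n k i z)\<rparr>"
    and R: "R = remove_cells Q (\<lambda>n. if n = 1 then Y else {})"
begin

section \<open>Faces in the contracted precubical set\<close>

lemma b': "1 - b \<in> {0,1}" "1 - b \<noteq> b" "k \<in> {0,1} \<Longrightarrow> k = b \<or> k = 1 - b"
  using b by auto

lemma vertices: "v0 \<in> cells P 0" "v1 \<in> cells P 0"
  using precubical_bdry[OF P, of x 0] x b b' unfolding v0 v1 by auto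

text \<open>The two vertices of the representable 1-cube are different maps, with values 0 and 1 at
  the unique point of I^0, and regularity makes the morphism belonging to \<open>x\<close> injective
  on them.\<close>

lemma v0_neq_v1: "v0 \<noteq> v1"
proof -
  obtain f where f: "precubical_morphism (representable_cube 1) P f" "f 1 (\<lambda>u\<in>cube 1. u) = x"
      "inj_on (f 0) (cells (representable_cube 1) 0)"
    using x(2) by (auto simp: regular_def)
  let ?id = "\<lambda>u\<in>cube 1. u"
  let ?e = "\<lambda>k. bdry (representable_cube 1) 1 k 1 ?id"
  have e: "?e k = (\<lambda>u\<in>cube 0. coface 0 k 1 u)" if k: "k \<in> {0,1}" for k
  proof -
    have cube: "coface 0 k 1 u \<in> cube 1" if "u \<in> cube 0" for u
      using coface_in_cube[OF that k, of 1] by simp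
    have "?e k = compose (cube 0) ?id (coface 0 k 1)"
      by (simp add: representable_cube_def)
    also have "\<dots> = (\<lambda>u\<in>cube 0. coface 0 k 1 u)"
      unfolding compose_def by (rule restrict_ext) (simp only: restrict_apply cube if_True)
    finally show ?thesis .
  qed
  have cells: "?e k \<in> cells (representable_cube 1) 0" if k: "k \<in> {0,1}" for k
  proof -
    have "compose (cube 0) (coface 0 k 1) (\<lambda>u\<in>cube 0. u) = ?e k"
      unfolding e[OF k] compose_def by (rule restrict_ext) (simp only: restrict_apply if_True)
    then show ?thesis
      using box_hom.comp[OF box_hom.ident[of 0] k, of 1] by (simp add: representable_cube_def)
  qed
  have f_e: "f 0 (?e k) = bdry P 1 k 1 x" if "k \<in> {0,1}" for k
  proof -
    have "?id \<in> cells (representable_cube 1) 1"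
      using box_hom.ident[of 1] by (simp add: representable_cube_def)
    then show ?thesis
      using f(1,2) that unfolding precubical_morphism_def
      by (metis atLeastAtMost_iff cancel_comm_monoid_add_class.diff_cancel order_refl zero_less_one)
  qed
  have "?e 0 \<noteq> ?e 1"
  proof
    assume eq: "?e 0 = ?e 1"
    have "?e 0 = (\<lambda>u\<in>cube 0. coface 0 0 1 u)" "?e 1 = (\<lambda>u\<in>cube 0. coface 0 1 1 u)"
      by (rule e; simp)+
    with eq have "(\<lambda>u\<in>cube 0. coface 0 0 1 u) = (\<lambda>u\<in>cube 0. coface 0 1 1 u)"
      by argo
    from fun_cong[OF fun_cong[OF this, of "\<lambda>_. undefined"], of 1] show False
      by (simp add: cube_0 coface_0 del: One_nat_def)
  qed
  moreover have "(0::nat) \<in> {0,1}" "(1::nat) \<in> {0,1}"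
    by auto
  ultimately have "f 0 (?e 0) \<noteq> f 0 (?e 1)"
    using inj_onD[OF f(3) _ cells cells, of 0 1] by blast
  then have "bdry P 1 0 1 x \<noteq> bdry P 1 1 1 x"
    using f_e[of 0] f_e[of 1] by simp
  then show ?thesis
    using b by (auto simp: v0 v1)
qed

lemma YD: "y \<in> Y \<Longrightarrow> y \<in> cells P 1" "y \<in> Y \<Longrightarrow> bdry P 1 b 1 y = v0"
  by (auto simp: Y)

lemma x_notin_Y: "x \<notin> Y"
  using v0_neq_v1 by (auto simp: Y v1)

text \<open>This keeps the other end of the edges of \<open>Y\<close> inside \<open>Q\<close>: by
  (i), an edge of \<open>Y\<close> violating it would be \<open>x\<close>, which is not in
  \<open>Y\<close>.\<close>

lemma other_end_Y: "y \<in> Y \<Longrightarrow> bdry P 1 (1 - b) 1 y \<noteq> v0"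
  using only_x YD(1) x_notin_Y by metis

lemma cells_Q: "cells Q 0 = cells P 0 - {v0}" "cells Q 1 = cells P 1 - {x}"
    "n \<ge> 2 \<Longrightarrow> cells Q n = cells P n"
  by (auto simp: Q)

lemma bdry_Q: "y \<in> Y \<Longrightarrow> bdry Q 1 b 1 y = v1"
    "n \<noteq> 1 \<or> z \<notin> Y \<or> i \<noteq> 1 \<or> k \<noteq> b \<Longrightarrow> bdry Q n k i z = bdry P n k i z"
  by (auto simp: Q)

lemma cells_R: "cells R 0 = cells P 0 - {v0}" "cells R 1 = cells P 1 - {x} - Y"
    "n \<ge> 2 \<Longrightarrow> cells R n = cells P n"
  by (auto simp: R remove_cells_def restrict_cells_def Q)

lemma cells_R_subset: "cells R n \<subseteq> cells P n" "cells R n \<subseteq> cells Q n"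
  by (auto simp: R remove_cells_def restrict_cells_def Q)

lemma bdry_R:
  assumes "z \<in> cells R n" "k \<in> {0,1}" "i \<in> {1..n}"
  shows "bdry R n k i z = bdry P n k i z" "bdry Q n k i z = bdry P n k i z"
  using assms by (auto simp: R remove_cells_def restrict_cells_def Q)

text \<open>Here (i) and (ii) confine the change to dimension at most one. An edge of
  \<open>R\<close> avoids \<open>v0\<close> at one end by (i) and at the other because it is not in
  \<open>Y\<close>. A face of a square is neither \<open>x\<close> nor in \<open>Y\<close> by (ii),
  since those edges have \<open>v0\<close> in their boundary. From dimension two on nothing has been
  removed.\<close>

lemma faces:
  assumes z: "z \<in> cells P (Suc n)" "k \<in> {0,1}" "i \<in> {1..Suc n}"
    and R: "n = 0 \<Longrightarrow> z \<in> cells R 1"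
  shows "bdry P (Suc n) k i z \<in> cells R n"
proof -
  have P_face: "bdry P (Suc n) k i z \<in> cells P n"
    using precubical_bdry[OF P z] .
  consider "n = 0" | "n = 1" | "n \<ge> 2"
    by linarith
  then show ?thesis
  proof cases
    case 1
    then have "i = 1" "z \<notin> Y" "z \<noteq> x" "z \<in> cells P 1"
      using z R cells_R(2) by auto
    then have "bdry P 1 k 1 z \<noteq> v0"
      using only_x[of z] b'(3)[OF z(2)] by (auto simp: Y)
    then show ?thesis
      using P_face 1 \<open>i = 1\<close> by (simp add: cells_R)
  next
    case 2
    have "bdry P 2 k i z \<noteq> x"
      using no_square[OF x(1) b'(1) v0[symmetric]] z 2 by (simp add: numeral_2_eq_2)
    moreover have "bdry P 2 k i z \<noteq> y" if "y \<in> Y" for y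
      using no_square[OF YD(1)[OF that] b YD(2)[OF that]] z 2 by (simp add: numeral_2_eq_2)
    ultimately show ?thesis
      using P_face 2 cells_R(2) by (auto simp: numeral_2_eq_2)
  next
    case 3
    then show ?thesis
      using P_face cells_R(3) by simp
  qed
qed

lemma precubical_identity:
  assumes "z \<in> cells P n" "k \<in> {0,1}" "l \<in> {0,1}" "1 \<le> i" "i < j" "j \<le> n"
  shows "bdry P (n - 1) k i (bdry P n l j z) = bdry P (n - 1) l (j - 1) (bdry P n k i z)"
  using conjunct2[OF P[unfolded precubical_set_def], rule_format, OF assms(2,3) _ assms(1)] assms(4-6)
  by blast

lemma precubical_Q: "precubical_set Q"
  unfolding precubical_set_def
proof (intro conjI allI ballI impI)
  fix n k i z assume n: "0 < (n::nat)" and k: "k \<in> {0,1::nat}" "i \<in> {1..n}" and z: "z \<in> cells Q n"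
  obtain m where m: "n = Suc m"
    using n by (cases n) auto
  show "bdry Q n k i z \<in> cells Q (n - 1)"
  proof (cases "n = 1 \<and> z \<in> Y")
    case True
    then have "i = 1"
      using k by simp
    show ?thesis
    proof (cases "k = b")
      case True
      \<comment> \<open>The new face \<open>v1\<close> is a vertex of \<open>Q\<close> because it
        differs from \<open>v0\<close>.\<close>
      then show ?thesis
        using bdry_Q(1) \<open>n = 1 \<and> z \<in> Y\<close> \<open>i = 1\<close> vertices v0_neq_v1 by (simp add: cells_Q)
    next
      case False
      then have "bdry P 1 k 1 z \<noteq> v0"
        using other_end_Y \<open>n = 1 \<and> z \<in> Y\<close> b'(3)[OF k(1)] by blast
      then show ?thesis
        using bdry_Q(2)[of n z i k] False precubical_bdry[OF P, of z 0 k i] YD(1) k \<open>n = 1 \<and> z \<in> Y\<close> \<open>i = 1\<close>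
        by (simp add: cells_Q)
    qed
  next
    case False
    have "z \<in> cells R n" "z \<in> cells P n"
      using z False n by (auto simp: R remove_cells_def restrict_cells_def Q split: if_splits)
    then have "bdry P n k i z \<in> cells R m"
      using faces[of z m k i] k m by auto
    then show ?thesis
      using bdry_R(2)[OF \<open>z \<in> cells R n\<close> k] cells_R_subset(2)[of m] m by auto
  qed
next
  fix n k l i j z assume k: "k \<in> {0,1::nat}" and l: "l \<in> {0,1::nat}" and ij: "1 \<le> i \<and> i < j \<and> j \<le> n"
    and z: "z \<in> cells Q n"
  have n: "n \<ge> 2"
    using ij by linarith
  then have zP: "z \<in> cells P n"
    using z by (simp add: cells_Q)
  obtain m where m: "n = Suc m" "m > 0"
    using n by (cases n) auto
  \<comment> \<open>The faces of a cell of dimension at least two lie in \<open>R\<close>, where the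
    operators of \<open>P\<close> and \<open>Q\<close> coincide, so the identities are inherited
    from \<open>P\<close>.\<close>
  have *: "bdry Q m k' i' (bdry Q n l' j' z) = bdry P m k' i' (bdry P n l' j' z)"
    if "l' \<in> {0,1}" "k' \<in> {0,1}" "j' \<in> {1..n}" "i' \<in> {1..m}" for k' i' l' j'
  proof -
    have "bdry P n l' j' z \<in> cells R m"
      using faces[of z m l' j'] that m zP by auto
    then show ?thesis
      using bdry_R(2) bdry_Q(2)[of n z j' l'] that n by simp
  qed
  have "i \<in> {1..m}" "j - 1 \<in> {1..m}" "i \<in> {1..n}" "j \<in> {1..n}"
    using ij m by auto
  then show "bdry Q (n - 1) k i (bdry Q n l j z) = bdry Q (n - 1) l (j - 1) (bdry Q n k i z)"
    using precubical_identity[OF zP k l, of i j] *[OF l k, of j i] *[OF k l, of i "j - 1"] ij m(1)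
    by simp
qed

lemma precubical_R: "precubical_set R"
  unfolding precubical_set_def
proof (intro conjI allI ballI impI)
  fix n k i z assume n: "0 < (n::nat)" and k: "k \<in> {0,1::nat}" "i \<in> {1..n}" and z: "z \<in> cells R n"
  then obtain m where m: "n = Suc m"
    by (cases n) auto
  then show "bdry R n k i z \<in> cells R (n - 1)"
    using faces[of z m k i] k z bdry_R(1)[OF z k] cells_R_subset(1)[of n] by auto
next
  fix n k l i j z assume k: "k \<in> {0,1::nat}" and l: "l \<in> {0,1::nat}" and ij: "1 \<le> i \<and> i < j \<and> j \<le> n"
    and z: "z \<in> cells R n"
  obtain m where m: "n = Suc m" "m > 0"
    using ij by (cases n) auto
  have zP: "z \<in> cells P n"
    using z cells_R_subset by blast
  have *: "bdry R m k' i' (bdry R n l' j' z) = bdry P m k' i' (bdry P n l' j' z)"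
    if "l' \<in> {0,1}" "k' \<in> {0,1}" "j' \<in> {1..n}" "i' \<in> {1..m}" for k' i' l' j'
  proof -
    have "bdry P n l' j' z \<in> cells R m"
      using faces[of z m l' j'] that m zP by auto
    then show ?thesis
      using bdry_R(1) bdry_R(1)[OF z] that by simp
  qed
  have "i \<in> {1..m}" "j - 1 \<in> {1..m}" "i \<in> {1..n}" "j \<in> {1..n}"
    using ij m by auto
  then show "bdry R (n - 1) k i (bdry R n l j z) = bdry R (n - 1) l (j - 1) (bdry R n k i z)"
    using precubical_identity[OF zP k l, of i j] *[OF l k, of j i] *[OF k l, of i "j - 1"] ij m(1)
    by simp
qed

lemma subset_R_P: "precubical_subset R P" and subset_R_Q: "precubical_subset R Q"
  using P precubical_Q precubical_R cells_R_subset bdry_R by (auto simp: precubical_subset_def)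

sublocale RP: low_dimensional_complement R P
  by unfold_locales (use subset_R_P cells_R in auto)

sublocale RQ: low_dimensional_complement R Q
  by unfold_locales (use subset_R_Q cells_R cells_Q in auto)

lemma Y_subset_Q: "Y \<subseteq> cells Q 1"
  using YD(1) x_notin_Y cells_Q(2) by auto

subsection \<open>Coordinates along the edges\<close>

text \<open>\<open>flip s\<close> is the coordinate of the point at distance \<open>s\<close> from the end \<open>d\<^sup>b\<close> of an edge. For
  \<open>y \<in> Y\<close>, \<open>detour y\<close> runs at unit speed from \<open>v1\<close> through \<open>x\<close> to \<open>v0\<close> and then through \<open>y\<close>;
  as a directed path it has to be traversed backwards if \<open>b = 1\<close>.\<close>

definition flip :: "real \<Rightarrow> real" where
  "flip s = real b + (1 - 2 * real b) * s"

definition detour :: "'a \<Rightarrow> real \<Rightarrow> 'a real_point" where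
  "detour y r = (if r \<le> 1 then edge_point P x (flip r) else edge_point P y (flip (r - 1)))"

lemma flip_cases: "b = 0 \<and> flip = (\<lambda>s. s) \<or> b = 1 \<and> flip = (\<lambda>s. 1 - s)"
  using b by (auto simp: flip_def fun_eq_iff)

lemma flip_ends [simp]: "flip 0 = real b" "flip 1 = real (1 - b)" "flip (real b) = 0" "flip (real (1 - b)) = 1"
  using b by (auto simp: flip_def)

lemma flip_flip [simp]: "flip (flip s) = s"
  using flip_cases by auto

lemma flip_in: "s \<in> {0..1} \<Longrightarrow> flip s \<in> {0..1}"
  using flip_cases by auto

lemma continuous_on_flip: "continuous_on S f \<Longrightarrow> continuous_on S (\<lambda>s. flip (f s))"
  unfolding flip_def by (intro continuous_intros)

lemma continuous_map_flip: "continuous_map T euclideanreal f \<Longrightarrow> continuous_map T euclideanreal (\<lambda>s. flip (f s))"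
  unfolding flip_def by (intro continuous_map_add continuous_map_real_mult) auto

lemma edge_point_P_x: "edge_point P x (real b) = vertex_point P v1" "edge_point P x (real (1 - b)) = vertex_point P v0"
  using edge_point_endpoint[OF P x(1)] b b' by (simp_all add: v0 v1)

lemma detour_ends:
  assumes "y \<in> Y"
  shows "detour y 0 = vertex_point P v1" "detour y 2 = vertex_point P (bdry P 1 (1 - b) 1 y)"
  using edge_point_P_x edge_point_endpoint[OF P YD(1)[OF assms] b'(1)] by (simp_all add: detour_def)

text \<open>Both branches of \<open>detour\<close> give the point \<open>v0\<close> at r = 1, so the
  second formula is valid there too.\<close>

lemma detour_ge_1:
  assumes "y \<in> Y" "r \<ge> 1"
  shows "detour y r = edge_point P y (flip (r - 1))"
proof (cases "r = 1")
  case True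
  then show ?thesis
    using edge_point_P_x edge_point_endpoint[OF P YD(1)[OF assms(1)] b] YD(2)[OF assms(1)]
    by (simp add: detour_def)
qed (use assms in \<open>simp add: detour_def\<close>)

lemma continuous_map_detour:
  assumes y: "y \<in> Y" and \<rho>: "continuous_map T euclideanreal \<rho>" "\<And>t. t \<in> topspace T \<Longrightarrow> \<rho> t \<in> {0..2}"
  shows "continuous_map T (realization_top P) (\<lambda>t. detour y (\<rho> t))"
  unfolding detour_def
proof (rule continuous_map_cases_le)
  let ?L = "subtopology T {t \<in> topspace T. \<rho> t \<le> 1}" and ?U = "subtopology T {t \<in> topspace T. 1 \<le> \<rho> t}"
  have "continuous_map ?L euclideanreal (\<lambda>t. flip (\<rho> t))"
    by (intro continuous_map_flip continuous_map_from_subtopology \<rho>(1))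
  then have "continuous_map ?L (top_of_set {0..1}) (\<lambda>t. flip (\<rho> t))"
    using \<rho>(2) flip_in by (auto simp: continuous_map_in_subtopology)
  then show "continuous_map ?L (realization_top P) (\<lambda>t. edge_point P x (flip (\<rho> t)))"
    by (rule continuous_map_edge_point[OF x(1)])
  have "continuous_map ?U euclideanreal (\<lambda>t. flip (\<rho> t - 1))"
    by (intro continuous_map_flip continuous_map_diff continuous_map_from_subtopology \<rho>(1)) auto
  then have "continuous_map ?U (top_of_set {0..1}) (\<lambda>t. flip (\<rho> t - 1))"
    using \<rho>(2) flip_in by (auto simp: continuous_map_in_subtopology)
  then show "continuous_map ?U (realization_top P) (\<lambda>t. edge_point P y (flip (\<rho> t - 1)))"
    by (rule continuous_map_edge_point[OF YD(1)[OF y]])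
  fix t assume "\<rho> t = 1"
  then show "edge_point P x (flip (\<rho> t)) = edge_point P y (flip (\<rho> t - 1))"
    using detour_ge_1[OF y, of 1] by (simp add: detour_def)
qed (use \<rho> in auto)

text \<open>Here \<open>flip (\<rho> t)\<close> may leave [0,1]; it expresses the direction,
  forwards along the detour for b = 0 and backwards for b = 1. The path is cut where it passes
  \<open>v0\<close>, that is, where \<rho> = 1.\<close>

lemma piecewise_dpath_detour:
  assumes y: "y \<in> Y" and "a < d" and \<rho>: "continuous_on {a..d} \<rho>" "mono_on {a..d} (\<lambda>t. flip (\<rho> t))"
    "\<And>t. t \<in> {a..d} \<Longrightarrow> \<rho> t \<in> {0..2}"
  shows "piecewise_dpath P (\<lambda>t. detour y (\<rho> t)) a d"
proof -
  have low: "piecewise_dpath P (\<lambda>t. detour y (\<rho> t)) a' d'"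
    if "a \<le> a'" "a' < d'" "d' \<le> d" "\<And>t. t \<in> {a'..d'} \<Longrightarrow> \<rho> t \<le> 1" for a' d'
  proof (rule piecewise_dpath_cong)
    have "\<rho> t \<in> {0..1}" if "t \<in> {a'..d'}" for t
      using that \<open>a \<le> a'\<close> \<open>d' \<le> d\<close> \<rho>(3)[of t] \<open>\<And>t. t \<in> {a'..d'} \<Longrightarrow> \<rho> t \<le> 1\<close>[of t] by auto
    then have "(\<lambda>t. flip (\<rho> t)) ` {a'..d'} \<subseteq> {0..1}"
      using flip_in by blast
    then show "piecewise_dpath P (\<lambda>t. edge_point P x (flip (\<rho> t))) a' d'"
      using that(1-3) by (intro piecewise_dpath_edge x(1) continuous_on_flip
          continuous_on_subset[OF \<rho>(1)] mono_on_subset[OF \<rho>(2)]) auto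
  qed (use that in \<open>auto simp: detour_def\<close>)
  have high: "piecewise_dpath P (\<lambda>t. detour y (\<rho> t)) a' d'"
    if "a \<le> a'" "a' < d'" "d' \<le> d" "\<And>t. t \<in> {a'..d'} \<Longrightarrow> \<rho> t \<ge> 1" for a' d'
  proof (rule piecewise_dpath_cong)
    have "\<rho> t - 1 \<in> {0..1}" if "t \<in> {a'..d'}" for t
      using that \<open>a \<le> a'\<close> \<open>d' \<le> d\<close> \<rho>(3)[of t] \<open>\<And>t. t \<in> {a'..d'} \<Longrightarrow> \<rho> t \<ge> 1\<close>[of t] by auto
    then have "(\<lambda>t. flip (\<rho> t - 1)) ` {a'..d'} \<subseteq> {0..1}"
      using flip_in by blast
    \<comment> \<open>Shifting the distance by 1 shifts the coordinate by a constant, so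
      monotonicity carries over.\<close>
    moreover have "flip (\<rho> t - 1) = flip (\<rho> t) - (1 - 2 * real b)" for t
      by (simp add: flip_def algebra_simps)
    then have "mono_on {a..d} (\<lambda>t. flip (\<rho> t - 1))"
      using \<rho>(2) by (simp add: mono_on_def)
    then have "mono_on {a'..d'} (\<lambda>t. flip (\<rho> t - 1))"
      by (rule mono_on_subset) (use that in auto)
    moreover have "continuous_on {a'..d'} \<rho>"
      by (rule continuous_on_subset[OF \<rho>(1)]) (use that in auto)
    then have "continuous_on {a'..d'} (\<lambda>t. flip (\<rho> t - 1))"
      by (intro continuous_on_flip continuous_on_diff continuous_on_const)
    ultimately show "piecewise_dpath P (\<lambda>t. edge_point P y (flip (\<rho> t - 1))) a' d'"
      using that(2) by (intro piecewise_dpath_edge[OF YD(1)[OF y]])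
  qed (use that detour_ge_1[OF y] in auto)
  show ?thesis
    using flip_cases
  proof (elim disjE conjE)
    assume "flip = (\<lambda>s. s)"
    then have mono: "\<rho> s \<le> \<rho> t" if "a \<le> s" "s \<le> t" "t \<le> d" for s t
      using mono_onD[OF \<rho>(2), of s t] that by auto
    consider "\<rho> d \<le> 1" | "\<rho> a \<ge> 1" | "\<rho> a < 1" "1 < \<rho> d"
      by linarith
    then show ?thesis
    proof cases
      case 1
      then show ?thesis
        using mono[of _ d] \<open>a < d\<close> by (intro low) (auto intro: order_trans)
    next
      case 2
      then show ?thesis
        using mono[of a] \<open>a < d\<close> by (intro high) (auto intro: order_trans)
    next
      case 3
      then obtain m where m: "a \<le> m" "m \<le> d" "\<rho> m = 1"
        using IVT'[of \<rho> a 1 d] \<rho>(1) \<open>a < d\<close> by auto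
      then have "a < m" "m < d"
        using 3 by (auto simp: less_le)
      then show ?thesis
        using mono[of _ m] mono[of m] m by (intro piecewise_dpath.join[OF low[of a m] high[of m d]]) auto
    qed
  next
    \<comment> \<open>Now \<rho> decreases: the path runs through y first and then through
      \<open>x\<close>, so the two pieces come in the opposite order.\<close>
    assume "flip = (\<lambda>s. 1 - s)"
    then have anti: "\<rho> t \<le> \<rho> s" if "a \<le> s" "s \<le> t" "t \<le> d" for s t
      using mono_onD[OF \<rho>(2), of s t] that by auto
    consider "\<rho> a \<le> 1" | "\<rho> d \<ge> 1" | "\<rho> d < 1" "1 < \<rho> a"
      by linarith
    then show ?thesis
    proof cases
      case 1
      then show ?thesis
        using anti[of a] \<open>a < d\<close> by (intro low) (auto intro: order_trans)
    next
      case 2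
      then show ?thesis
        using anti[of _ d] \<open>a < d\<close> by (intro high) (auto intro: order_trans)
    next
      case 3
      then obtain m where m: "a \<le> m" "m \<le> d" "\<rho> m = 1"
        using IVT2'[of \<rho> d 1 a] \<rho>(1) \<open>a < d\<close> by auto
      then have "a < m" "m < d"
        using 3 by (auto simp: less_le)
      then show ?thesis
        using anti[of _ m] anti[of m] m by (intro piecewise_dpath.join[OF high[of a m] low[of m d]]) auto
    qed
  qed
qed

end

text \<open>Keeps the dimension 1 in the form \<open>1\<close>, so that facts about
  \<open>cube 1\<close> and \<open>cells P 1\<close> continue to match in simplification.\<close>

declare One_nat_def [simp del]

lemma continuous_map_cube_coordinate:
  "continuous_map (prod_topology T (cube_top 1)) euclideanreal (\<lambda>p. snd p 1)"
proof -
  have "continuous_map (cube_top 1) (top_of_set {0..1}) (\<lambda>u. u 1)"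
    unfolding cube_top_def by (rule continuous_map_product_projection) simp
  then have "continuous_map (cube_top 1) euclideanreal (\<lambda>u. u 1)"
    by (rule continuous_map_into_fulltopology)
  from continuous_map_compose[OF continuous_map_snd this] show ?thesis
    by (simp add: o_def)
qed

lemma continuous_map_interval_parameter:
  "continuous_map (prod_topology (top_of_set {0..1::real}) X) euclideanreal fst"
  by (rule continuous_map_into_fulltopology[OF continuous_map_fst])

lemma continuous_map_slice:
  assumes "continuous_map (prod_topology S X) Y (\<lambda>(t, x). h t x)" "t \<in> topspace S"
  shows "continuous_map X Y (h t)"
proof -
  have "continuous_map X (prod_topology S X) (\<lambda>x. (t, x))"
    using assms(2) by (intro continuous_map_pairedI) auto
  from continuous_map_compose[OF this assms(1)] show ?thesis
    by (simp add: o_def)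
qed

lemma continuous_map_real_class_snd:
  assumes "z \<in> cells P n"
  shows "continuous_map (prod_topology T (cube_top n)) (realization_top P) (\<lambda>(t, u). real_class P n z u)"
  using continuous_map_compose[OF continuous_map_snd continuous_map_real_class[OF assms]]
  by (simp add: o_def case_prod_unfold)

context edge_contraction
begin

text \<open>For b = 1 each of the two flips reverses the order, so the reversals cancel:
  monotonicity of \<psi> as a function of the distance is enough for both values of b.\<close>

lemma mono_on_flip_conj:
  assumes \<psi>: "mono_on {0..1} \<psi>" and s: "mono_on S s" "\<And>t. t \<in> S \<Longrightarrow> s t \<in> {0..1}"
  shows "mono_on S (\<lambda>t. flip (\<psi> (flip (s t))))"
proof (rule mono_onI)
  fix r t assume rt: "r \<in> S" "t \<in> S" "r \<le> t"
  then have "s r \<le> s t"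
    by (intro mono_onD[OF s(1)])
  then show "flip (\<psi> (flip (s r))) \<le> flip (\<psi> (flip (s t)))"
    using mono_onD[OF \<psi>, of "flip (s r)" "flip (s t)"] mono_onD[OF \<psi>, of "flip (s t)" "flip (s r)"]
      flip_cases s(2)[OF rt(1)] s(2)[OF rt(2)] by auto
qed

lemma glue_P_high:
  assumes "n \<ge> 1" "z \<in> cells P (Suc n)" "k \<in> {0,1}" "i \<in> {1..Suc n}"
  shows "bdry P (Suc n) k i z \<in> cells R n" "z \<in> cells R (Suc n)"
  using faces[OF assms(2-4)] assms cells_R(3)[of "Suc n"] by auto

lemma cells_R_in: "z \<in> cells R n \<Longrightarrow> z \<in> cells P n" "z \<in> cells R n \<Longrightarrow> z \<in> cells Q n"
  using cells_R_subset by blast+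

lemma cells_R_not_special: "z \<in> cells R n \<Longrightarrow> \<not> (n = 1 \<and> z = x) \<and> \<not> (n = 0 \<and> z = v0) \<and> \<not> (n = 1 \<and> z \<in> Y)"
  using cells_R(1,2) by auto

lemma cells_P_cases:
  assumes "z \<in> cells P n"
  obtains "n = 1" "z = x" | "n = 0" "z = v0" | "n = 1" "z \<in> Y" | "z \<in> cells R n"
proof -
  consider "n = 0" | "n = 1" | "n \<ge> 2"
    by linarith
  then show thesis
    using assms that cells_R by cases auto
qed

lemma cells_Q_cases:
  assumes "z \<in> cells Q n"
  obtains "n = 1" "z \<in> Y" | "z \<in> cells R n"
proof -
  consider "n = 0" | "n = 1" | "n \<ge> 2"
    by linarith
  then show thesis
    using assms that cells_R cells_Q by cases auto
qed

subsection \<open>The maps and homotopies\<close>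

text \<open>The degree is tested together with the cell because the sets of cells of different
  degrees may overlap. Edges of \<open>Y\<close> keep their coordinate; the collapse is accounted
  for by their new end \<open>v1\<close> in \<open>Q\<close>.\<close>

definition contraction :: "nat \<times> 'a \<times> (nat \<Rightarrow> real) \<Rightarrow> 'a real_point" where
  "contraction = (\<lambda>(n, z, u).
     if n = 1 \<and> z = x \<or> n = 0 \<and> z = v0 then vertex_point Q v1 else real_class Q n z u)"

text \<open>The factor 2 is the length of the detour through \<open>x\<close> and z.\<close>

definition expansion :: "nat \<times> 'a \<times> (nat \<Rightarrow> real) \<Rightarrow> 'a real_point" where
  "expansion = (\<lambda>(n, z, u). if n = 1 \<and> z \<in> Y then detour z (2 * flip (u 1)) else real_class P n z u)"

text \<open>At time t the vertex \<open>v0\<close> has moved to distance t from \<open>v1\<close>,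
  the edge \<open>x\<close> is compressed onto [0, t], and an edge of \<open>Y\<close> is spread
  affinely over the remaining part [t, 2] of its detour.\<close>

definition retraction :: "real \<Rightarrow> nat \<times> 'a \<times> (nat \<Rightarrow> real) \<Rightarrow> 'a real_point" where
  "retraction t = (\<lambda>(n, z, u).
     if n = 1 \<and> z = x then edge_point P x (flip (t * flip (u 1)))
     else if n = 0 \<and> z = v0 then edge_point P x (flip t)
     else if n = 1 \<and> z \<in> Y then detour z (t + flip (u 1) * (2 - t))
     else real_class P n z u)"

text \<open>The shadow of \<open>retraction\<close> after \<open>x\<close> has been collapsed: from
  the position t + s * (2 - t) on the detour subtract the length 1 of \<open>x\<close> and cut off
  at 0. For t = 0 this is the effect of expanding and contracting, for t = 1 it is s.\<close>

definition reparametrization :: "real \<Rightarrow> nat \<times> 'a \<times> (nat \<Rightarrow> real) \<Rightarrow> 'a real_point" where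
  "reparametrization t = (\<lambda>(n, z, u).
     if n = 1 \<and> z \<in> Y then edge_point Q z (flip (max 0 ((2 - t) * flip (u 1) - (1 - t))))
     else real_class Q n z u)"

text \<open>The source of everything relative to |R|: on the cells of \<open>R\<close> all four
  formulas keep cell and coordinates.\<close>

lemma default_on_R:
  assumes "z \<in> cells R n"
  shows "contraction (n, z, u) = real_class Q n z u" "expansion (n, z, u) = real_class P n z u"
    "retraction t (n, z, u) = real_class P n z u" "reparametrization t (n, z, u) = real_class Q n z u"
  using cells_R_not_special[OF assms]
  by (auto simp: contraction_def expansion_def retraction_def reparametrization_def)

lemma edge_point_Q:
  assumes "y \<in> Y"
  shows "edge_point Q y (real b) = vertex_point Q v1"
    "edge_point Q y (real (1 - b)) = vertex_point Q (bdry P 1 (1 - b) 1 y)"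
proof -
  have y: "y \<in> cells Q 1"
    using Y_subset_Q assms by blast
  show "edge_point Q y (real b) = vertex_point Q v1"
    using edge_point_endpoint[OF precubical_Q y b] bdry_Q(1)[OF assms] by simp
  show "edge_point Q y (real (1 - b)) = vertex_point Q (bdry P 1 (1 - b) 1 y)"
    using edge_point_endpoint[OF precubical_Q y b'(1)] bdry_Q(2)[of 1 y 1 "1 - b"] b'(2) by simp
qed

text \<open>Over the cells of dimension at least two, all the maps are given by \<open>real_class\<close>; hence
  compatibility with \<^const>\<open>glue\<close> only has to be checked at the ends of the edges.\<close>

lemma glue_P_invariant:
  assumes "glue P p q"
    and R: "\<And>n z u. z \<in> cells R n \<Longrightarrow> F (n, z, u) = real_class X n z u"
    and X: "precubical_set X" "\<And>n z. z \<in> cells R n \<Longrightarrow> z \<in> cells X n"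
      "\<And>n z k i. \<lbrakk>z \<in> cells R n; k \<in> {0,1}; i \<in> {1..n}\<rbrakk> \<Longrightarrow> bdry X n k i z = bdry P n k i z"
    and ends_x: "F (0, v1, \<lambda>_. undefined) = F (1, x, \<lambda>j\<in>{1..1}. real b)"
      "F (0, v0, \<lambda>_. undefined) = F (1, x, \<lambda>j\<in>{1..1}. real (1 - b))"
    and ends_y: "\<And>y. y \<in> Y \<Longrightarrow> F (0, v0, \<lambda>_. undefined) = F (1, y, \<lambda>j\<in>{1..1}. real b)"
      "\<And>y. y \<in> Y \<Longrightarrow> F (0, bdry P 1 (1 - b) 1 y, \<lambda>_. undefined) = F (1, y, \<lambda>j\<in>{1..1}. real (1 - b))"
  shows "F p = F q"
  using assms(1)
proof (cases rule: glue_cases)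
  case (edge e k)
  from edge(1) show ?thesis
  proof (cases rule: cells_P_cases)
    case 1
    then show ?thesis
      using edge b'(3)[OF edge(2)] ends_x v0 v1 by auto
  next
    case 3
    then show ?thesis
      using edge b'(3)[OF edge(2)] ends_y YD(2) by auto
  next
    case 4
    have "bdry P 1 k 1 e \<in> cells R 0"
      using faces[of e 0 k 1] edge(1,2) 4 by (simp add: One_nat_def)
    moreover have "edge_point X e (real k) = vertex_point X (bdry P 1 k 1 e)"
      using edge_point_endpoint[OF X(1) X(2)[OF 4] edge(2)] X(3)[OF 4 edge(2), of 1] by simp
    ultimately show ?thesis
      using edge(3,4) R 4 by (simp add: edge_point_def)
  qed simp
next
  case (high n z u k i)
  note face = glue_P_high[OF high(1,2,4,5)]
  have "real_class X (Suc n) z (coface n k i u) = real_class X n (bdry X (Suc n) k i z) u"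
    using real_class_glue[OF X(1) X(2)[OF face(2)] high(3-5)] .
  then show ?thesis
    using R[OF face(1)] R[OF face(2)] X(3)[OF face(2) high(4,5)] high(6,7) by simp
qed

text \<open>In \<open>Q\<close> the edges of \<open>Y\<close> are the only cells outside
  \<open>R\<close>, so only their two ends remain to be compared.\<close>

lemma glue_Q_invariant:
  assumes "glue Q p q"
    and R: "\<And>n z u. z \<in> cells R n \<Longrightarrow> F (n, z, u) = real_class X n z u"
    and X: "precubical_set X" "\<And>n z. z \<in> cells R n \<Longrightarrow> z \<in> cells X n"
      "\<And>n z k i. \<lbrakk>z \<in> cells R n; k \<in> {0,1}; i \<in> {1..n}\<rbrakk> \<Longrightarrow> bdry X n k i z = bdry P n k i z"
    and ends_y: "\<And>y. y \<in> Y \<Longrightarrow> F (0, v1, \<lambda>_. undefined) = F (1, y, \<lambda>j\<in>{1..1}. real b)"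
      "\<And>y. y \<in> Y \<Longrightarrow> F (0, bdry P 1 (1 - b) 1 y, \<lambda>_. undefined) = F (1, y, \<lambda>j\<in>{1..1}. real (1 - b))"
  shows "F p = F q"
  using assms(1)
proof (cases rule: glue_cases)
  case (edge e k)
  from edge(1) show ?thesis
  proof (cases rule: cells_Q_cases)
    case 1
    then show ?thesis
      using edge b'(3)[OF edge(2)] ends_y bdry_Q(1)[of e] bdry_Q(2)[of 1 e 1 "1 - b"] b'(2) by auto
  next
    case 2
    have "bdry P 1 k 1 e \<in> cells R 0"
      using faces[of e 0 k 1] edge(2) 2 cells_R_in(1)[OF 2] by (simp add: One_nat_def)
    moreover have "bdry Q 1 k 1 e = bdry P 1 k 1 e"
      using bdry_R(2)[OF 2 edge(2), of 1] by simp
    moreover have "edge_point X e (real k) = vertex_point X (bdry P 1 k 1 e)"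
      using edge_point_endpoint[OF X(1) X(2)[OF 2] edge(2)] X(3)[OF 2 edge(2), of 1] by simp
    ultimately show ?thesis
      using edge(3,4) R 2 by (simp add: edge_point_def)
  qed
next
  case (high n z u k i)
  have "z \<in> cells P (Suc n)"
    using high(1,2) cells_Q(3)[of "Suc n"] by simp
  note face = glue_P_high[OF high(1) this high(4,5)]
  have "real_class X (Suc n) z (coface n k i u) = real_class X n (bdry X (Suc n) k i z) u"
    using real_class_glue[OF X(1) X(2)[OF face(2)] high(3-5)] .
  then show ?thesis
    using R[OF face(1)] R[OF face(2)] X(3)[OF face(2) high(4,5)] bdry_R(2)[OF face(2) high(4,5)] high(6,7)
    by simp
qed

lemma v1_in_R: "v1 \<in> cells R 0"
  using vertices v0_neq_v1 by (simp add: cells_R)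

lemma contraction_glue: "glue P p q \<Longrightarrow> contraction p = contraction q"
proof (rule glue_P_invariant[where X = Q])
  show "contraction (0, v1, \<lambda>_. undefined) = contraction (1, x, \<lambda>j\<in>{1..1}. real b)"
    using v0_neq_v1 by (simp add: contraction_def)
  show "contraction (0, v0, \<lambda>_. undefined) = contraction (1, x, \<lambda>j\<in>{1..1}. real (1 - b))"
    by (simp add: contraction_def)
  fix y assume y: "y \<in> Y"
  then have "y \<noteq> x"
    using x_notin_Y by blast
  then show "contraction (0, v0, \<lambda>_. undefined) = contraction (1, y, \<lambda>j\<in>{1..1}. real b)"
    "contraction (0, bdry P 1 (1 - b) 1 y, \<lambda>_. undefined) = contraction (1, y, \<lambda>j\<in>{1..1}. real (1 - b))"
    using edge_point_Q[OF y] other_end_Y[OF y] by (auto simp: contraction_def edge_point_def)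
qed (use default_on_R precubical_Q cells_R_in bdry_R(2) in auto)

lemma expansion_glue: "glue Q p q \<Longrightarrow> expansion p = expansion q"
proof (rule glue_Q_invariant[where X = P])
  fix y assume y: "y \<in> Y"
  then show "expansion (0, v1, \<lambda>_. undefined) = expansion (1, y, \<lambda>j\<in>{1..1}. real b)"
    "expansion (0, bdry P 1 (1 - b) 1 y, \<lambda>_. undefined) = expansion (1, y, \<lambda>j\<in>{1..1}. real (1 - b))"
    using detour_ends[OF y] by (simp_all add: expansion_def)
qed (use default_on_R P cells_R_in in auto)

text \<open>At \<open>v0\<close> the formulas for \<open>v0\<close>, for \<open>x\<close> and for
  the edges of \<open>Y\<close> all give the point at distance t on \<open>x\<close>; for the last
  ones this uses t \<le> 1, which places \<open>detour y t\<close> on \<open>x\<close>.\<close>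

lemma retraction_glue:
  assumes "t \<in> {0..1}" "glue P p q"
  shows "retraction t p = retraction t q"
proof (rule glue_P_invariant[where X = P, OF assms(2)])
  show "retraction t (0, v1, \<lambda>_. undefined) = retraction t (1, x, \<lambda>j\<in>{1..1}. real b)"
    using v0_neq_v1 edge_point_P_x by (simp add: retraction_def)
  show "retraction t (0, v0, \<lambda>_. undefined) = retraction t (1, x, \<lambda>j\<in>{1..1}. real (1 - b))"
    by (simp add: retraction_def)
  fix y assume y: "y \<in> Y"
  then have "y \<noteq> x"
    using x_notin_Y by blast
  then show "retraction t (0, v0, \<lambda>_. undefined) = retraction t (1, y, \<lambda>j\<in>{1..1}. real b)"
    "retraction t (0, bdry P 1 (1 - b) 1 y, \<lambda>_. undefined) = retraction t (1, y, \<lambda>j\<in>{1..1}. real (1 - b))"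
    using y detour_ends[OF y] other_end_Y[OF y] assms(1) by (simp_all add: retraction_def detour_def[of y t])
qed (use default_on_R P cells_R_in in auto)

text \<open>At s = 0 the maximum is 0 because -(1 - t) \<le> 0, and at s = 1 it is 1; the cut-off
  thus keeps both ends of an edge of \<open>Y\<close> in place at all times.\<close>

lemma reparametrization_glue:
  assumes "t \<in> {0..1}" "glue Q p q"
  shows "reparametrization t p = reparametrization t q"
proof (rule glue_Q_invariant[where X = Q, OF assms(2)])
  fix y assume y: "y \<in> Y"
  then show "reparametrization t (0, v1, \<lambda>_. undefined) = reparametrization t (1, y, \<lambda>j\<in>{1..1}. real b)"
    "reparametrization t (0, bdry P 1 (1 - b) 1 y, \<lambda>_. undefined) =
      reparametrization t (1, y, \<lambda>j\<in>{1..1}. real (1 - b))"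
    using edge_point_Q[OF y] assms(1) by (simp_all add: reparametrization_def max_absorb1)
qed (use default_on_R precubical_Q cells_R_in bdry_R(2) in auto)

abbreviation contract_map :: "'a real_point \<Rightarrow> 'a real_point" where
  "contract_map \<equiv> induced_map contraction"

abbreviation expand_map :: "'a real_point \<Rightarrow> 'a real_point" where
  "expand_map \<equiv> induced_map expansion"

lemma contract_map_class:
  "z \<in> cells P n \<Longrightarrow> u \<in> cube n \<Longrightarrow> contract_map (real_class P n z u) = contraction (n, z, u)"
  by (rule induced_map_real_class[OF contraction_glue])

lemma expand_map_class:
  "z \<in> cells Q n \<Longrightarrow> u \<in> cube n \<Longrightarrow> expand_map (real_class Q n z u) = expansion (n, z, u)"
  by (rule induced_map_real_class[OF expansion_glue])

lemma retraction_class: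
  "t \<in> {0..1} \<Longrightarrow> z \<in> cells P n \<Longrightarrow> u \<in> cube n \<Longrightarrow>
    induced_map (retraction t) (real_class P n z u) = retraction t (n, z, u)"
  by (rule induced_map_real_class[OF retraction_glue])

lemma reparametrization_class:
  "t \<in> {0..1} \<Longrightarrow> z \<in> cells Q n \<Longrightarrow> u \<in> cube n \<Longrightarrow>
    induced_map (reparametrization t) (real_class Q n z u) = reparametrization t (n, z, u)"
  by (rule induced_map_real_class[OF reparametrization_glue])

lemma retraction_range:
  fixes t s :: real
  assumes "t \<in> {0..1}" "s \<in> {0..1}"
  shows "t * s \<in> {0..1}" "t + s * (2 - t) \<in> {0..2}" "max 0 ((2 - t) * s - (1 - t)) \<in> {0..1}"
proof -
  have "t * s \<le> 1" "0 \<le> t * s"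
    using assms mult_le_one[of t s] by auto
  then show "t * s \<in> {0..1}"
    by simp
  have "s * (2 - t) \<le> 2 - t" "0 \<le> s * (2 - t)"
    using assms mult_left_le_one_le[of "2 - t" s] by auto
  moreover have "(2 - t) * s = s * (2 - t)"
    by (rule mult.commute)
  moreover have "0 \<le> t" "t \<le> 1"
    using assms by auto
  ultimately have "0 \<le> t + s * (2 - t)" "t + s * (2 - t) \<le> 2" "(2 - t) * s - (1 - t) \<le> 1"
    by linarith+
  then show "t + s * (2 - t) \<in> {0..2}" "max 0 ((2 - t) * s - (1 - t)) \<in> {0..1}"
    by auto
qed

section \<open>Continuity and directedness of the maps and homotopies\<close>

lemma continuous_map_retraction:
  "continuous_map (prod_topology (top_of_set {0..1}) (realization_top P)) (realization_top P)
     (\<lambda>(t, c). induced_map (retraction t) c)"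
proof (rule continuous_map_induced_homotopy)
  let ?I = "top_of_set {0..1::real}"
  let ?T = "prod_topology ?I (cube_top 1)"
  have coord: "flip (snd p 1) \<in> {0..1}" "fst p \<in> {0..1}" if "p \<in> topspace ?T" for p
    using that flip_in[OF cube_coordinate[of "snd p" 1 1]] by auto
  have s: "continuous_map ?T euclideanreal (\<lambda>p. flip (snd p 1))"
    by (intro continuous_map_flip continuous_map_cube_coordinate)
  note t = continuous_map_interval_parameter[of "cube_top 1"]
  fix n z assume z: "z \<in> cells P n"
  then show "continuous_map (prod_topology ?I (cube_top n)) (realization_top P)
      (\<lambda>(t, u). retraction t (n, z, u))"
  proof (cases rule: cells_P_cases)
    case 1
    have "continuous_map ?T euclideanreal (\<lambda>p. flip (fst p * flip (snd p 1)))"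
      by (intro continuous_map_flip continuous_map_real_mult s t)
    moreover have "flip (fst p * flip (snd p 1)) \<in> {0..1}" if "p \<in> topspace ?T" for p
      using coord[OF that] by (intro flip_in[OF retraction_range(1)])
    ultimately have "continuous_map ?T (top_of_set {0..1}) (\<lambda>p. flip (fst p * flip (snd p 1)))"
      by (simp add: continuous_map_in_subtopology image_subset_iff)
    from continuous_map_edge_point[OF x(1) this] show ?thesis
      using 1 by (simp add: retraction_def case_prod_unfold)
  next
    case 2
    have "continuous_map (prod_topology ?I (cube_top 0)) euclideanreal (\<lambda>p. flip (fst p))"
      by (intro continuous_map_flip continuous_map_interval_parameter)
    then have "continuous_map (prod_topology ?I (cube_top 0)) (top_of_set {0..1}) (\<lambda>p. flip (fst p))"
      using flip_in by (auto simp: continuous_map_in_subtopology)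
    from continuous_map_edge_point[OF x(1) this] show ?thesis
      using 2 by (simp add: retraction_def case_prod_unfold)
  next
    case 3
    have "continuous_map ?T (realization_top P) (\<lambda>p. detour z (fst p + flip (snd p 1) * (2 - fst p)))"
    proof (rule continuous_map_detour[OF 3(2)])
      show "continuous_map ?T euclideanreal (\<lambda>p. fst p + flip (snd p 1) * (2 - fst p))"
        by (intro continuous_map_add continuous_map_real_mult continuous_map_diff s t) auto
      show "fst p + flip (snd p 1) * (2 - fst p) \<in> {0..2}" if "p \<in> topspace ?T" for p
        using coord[OF that] by (intro retraction_range)
    qed
    then show ?thesis
      using 3 x_notin_Y by (auto simp: retraction_def case_prod_unfold)
  next
    case 4
    then show ?thesis
      using continuous_map_real_class_snd[OF z] by (simp add: default_on_R)
  qed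
qed (rule retraction_glue)

lemma continuous_map_reparametrization:
  "continuous_map (prod_topology (top_of_set {0..1}) (realization_top Q)) (realization_top Q)
     (\<lambda>(t, c). induced_map (reparametrization t) c)"
proof (rule continuous_map_induced_homotopy)
  let ?I = "top_of_set {0..1::real}"
  let ?T = "prod_topology ?I (cube_top 1)"
  let ?\<rho> = "\<lambda>p. flip (max 0 ((2 - fst p) * flip (snd p 1) - (1 - fst p)))"
  fix n z assume z: "z \<in> cells Q n"
  then show "continuous_map (prod_topology ?I (cube_top n)) (realization_top Q)
      (\<lambda>(t, u). reparametrization t (n, z, u))"
  proof (cases rule: cells_Q_cases)
    case 1
    have "continuous_map ?T euclideanreal ?\<rho>"
      by (intro continuous_map_flip continuous_map_real_max continuous_map_real_mult continuous_map_diff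
          continuous_map_cube_coordinate continuous_map_interval_parameter) auto
    moreover have "?\<rho> p \<in> {0..1}" if "p \<in> topspace ?T" for p
      using that cube_coordinate[of "snd p" 1 1] by (intro flip_in retraction_range(3)) auto
    ultimately have "continuous_map ?T (top_of_set {0..1}) ?\<rho>"
      by (simp add: continuous_map_in_subtopology image_subset_iff)
    from continuous_map_edge_point[OF _ this] show ?thesis
      using 1 z by (simp add: reparametrization_def case_prod_unfold)
  next
    case 2
    then show ?thesis
      using continuous_map_real_class_snd[OF z] by (simp add: default_on_R)
  qed
qed (rule reparametrization_glue)

lemma piecewise_dpath_default:
  assumes "z \<in> cells R n" "a < d" "monotone_cube_path n a d \<alpha>"
  shows "piecewise_dpath P (\<lambda>\<tau>. real_class P n z (\<alpha> \<tau>)) a d"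
    "piecewise_dpath Q (\<lambda>\<tau>. real_class Q n z (\<alpha> \<tau>)) a d"
  using assms cells_R_in[OF assms(1)] by (auto intro: piecewise_dpath.piece)

lemma piecewise_dpath_vertex:
  assumes "v \<in> cells X 0" "a < d"
  shows "piecewise_dpath X (\<lambda>\<tau>. vertex_point X v) a d"
  using assms by (intro piecewise_dpath.piece[of a d v X 0 "\<lambda>_ _. undefined"])
    (auto simp: monotone_cube_path_def cube_0)

lemma d_map_retraction:
  assumes t: "t \<in> {0..1}"
  shows "d_map (realization P) (realization P) (induced_map (retraction t))"
proof (rule d_map_realizationI)
  show "continuous_map (realization_top P) (realization_top P) (induced_map (retraction t))"
    by (rule continuous_map_slice[OF continuous_map_retraction]) (use t in simp)
  fix n z a d \<alpha> assume z: "z \<in> cells P n" and less: "a < d" and \<alpha>: "monotone_cube_path n a d \<alpha>"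
  have "piecewise_dpath P (\<lambda>\<tau>. retraction t (n, z, \<alpha> \<tau>)) a d"
    using z
  proof (cases rule: cells_P_cases)
    case 1
    note \<alpha>' = monotone_cube_path_1[OF \<alpha>[unfolded 1]]
    have "piecewise_dpath P (\<lambda>\<tau>. edge_point P x (flip (t * flip (\<alpha> \<tau> 1)))) a d"
    proof (rule piecewise_dpath_edge[OF x(1) less])
      show "continuous_on {a..d} (\<lambda>\<tau>. flip (t * flip (\<alpha> \<tau> 1)))"
        by (intro continuous_on_flip continuous_on_mult continuous_on_const \<alpha>'(1))
      show "mono_on {a..d} (\<lambda>\<tau>. flip (t * flip (\<alpha> \<tau> 1)))"
        using t by (intro mono_on_flip_conj[OF _ \<alpha>'(2,3)] mono_onI mult_left_mono) auto
      show "(\<lambda>\<tau>. flip (t * flip (\<alpha> \<tau> 1))) ` {a..d} \<subseteq> {0..1}"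
        using \<alpha>'(3) by (intro image_subsetI flip_in retraction_range t) simp
    qed
    then show ?thesis
      using 1 by (simp add: retraction_def)
  next
    case 2
    have "piecewise_dpath P (\<lambda>\<tau>. edge_point P x (flip t)) a d"
      using flip_in[OF t] by (intro piecewise_dpath_edge[OF x(1) less]) (auto intro: mono_onI)
    then show ?thesis
      using 2 by (simp add: retraction_def)
  next
    case 3
    note \<alpha>' = monotone_cube_path_1[OF \<alpha>[unfolded 3]]
    have "piecewise_dpath P (\<lambda>\<tau>. detour z (t + flip (\<alpha> \<tau> 1) * (2 - t))) a d"
    proof (rule piecewise_dpath_detour[OF 3(2) less])
      show "continuous_on {a..d} (\<lambda>\<tau>. t + flip (\<alpha> \<tau> 1) * (2 - t))"
        by (intro continuous_on_add continuous_on_flip continuous_on_mult continuous_on_const \<alpha>'(1))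
      show "mono_on {a..d} (\<lambda>\<tau>. flip (t + flip (\<alpha> \<tau> 1) * (2 - t)))"
        using t by (intro mono_on_flip_conj[OF _ \<alpha>'(2,3)] mono_onI add_left_mono mult_right_mono) auto
      show "t + flip (\<alpha> \<tau> 1) * (2 - t) \<in> {0..2}" if "\<tau> \<in> {a..d}" for \<tau>
        using \<alpha>'(3)[OF that] by (intro retraction_range(2) flip_in t)
    qed
    moreover have "z \<noteq> x"
      using 3 x_notin_Y by blast
    ultimately show ?thesis
      using 3 by (simp add: retraction_def)
  next
    case 4
    then show ?thesis
      using piecewise_dpath_default(1)[OF 4 less \<alpha>] by (simp add: default_on_R)
  qed
  then show "piecewise_dpath P (\<lambda>\<tau>. induced_map (retraction t) (real_class P n z (\<alpha> \<tau>))) a d"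
    by (rule piecewise_dpath_cong) (simp add: retraction_class[OF t z monotone_cube_path_in_cube[OF \<alpha>]])
qed

lemma d_map_reparametrization:
  assumes t: "t \<in> {0..1}"
  shows "d_map (realization Q) (realization Q) (induced_map (reparametrization t))"
proof (rule d_map_realizationI)
  show "continuous_map (realization_top Q) (realization_top Q) (induced_map (reparametrization t))"
    by (rule continuous_map_slice[OF continuous_map_reparametrization]) (use t in simp)
  fix n z a d \<alpha> assume z: "z \<in> cells Q n" and less: "a < d" and \<alpha>: "monotone_cube_path n a d \<alpha>"
  have "piecewise_dpath Q (\<lambda>\<tau>. reparametrization t (n, z, \<alpha> \<tau>)) a d"
    using z
  proof (cases rule: cells_Q_cases)
    case 1
    note \<alpha>' = monotone_cube_path_1[OF \<alpha>[unfolded 1]]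
    let ?\<rho> = "\<lambda>\<tau>. flip (max 0 ((2 - t) * flip (\<alpha> \<tau> 1) - (1 - t)))"
    have "piecewise_dpath Q (\<lambda>\<tau>. edge_point Q z (?\<rho> \<tau>)) a d"
    proof (rule piecewise_dpath_edge[OF _ less])
      show "z \<in> cells Q 1"
        using z 1 by simp
      show "continuous_on {a..d} ?\<rho>"
        by (intro continuous_on_flip continuous_on_max continuous_on_diff continuous_on_mult
            continuous_on_const \<alpha>'(1))
      show "mono_on {a..d} ?\<rho>"
        using t by (intro mono_on_flip_conj[OF _ \<alpha>'(2,3)] mono_onI max.mono diff_right_mono mult_left_mono) auto
      show "?\<rho> ` {a..d} \<subseteq> {0..1}"
        using \<alpha>'(3) by (intro image_subsetI flip_in retraction_range t) simp
    qed
    then show ?thesis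
      using 1 by (simp add: reparametrization_def)
  next
    case 2
    then show ?thesis
      using piecewise_dpath_default(2)[OF 2 less \<alpha>] by (simp add: default_on_R)
  qed
  then show "piecewise_dpath Q (\<lambda>\<tau>. induced_map (reparametrization t) (real_class Q n z (\<alpha> \<tau>))) a d"
    by (rule piecewise_dpath_cong) (simp add: reparametrization_class[OF t z monotone_cube_path_in_cube[OF \<alpha>]])
qed

lemma d_map_contract: "d_map (realization P) (realization Q) contract_map"
proof (rule d_map_realizationI)
  show "continuous_map (realization_top P) (realization_top Q) contract_map"
  proof (rule continuous_map_induced_map)
    fix n z assume z: "z \<in> cells P n"
    have "vertex_point Q v1 \<in> topspace (realization_top Q)"
      using v1_in_R cells_R_subset(2) by (intro real_class_in_topspace) (auto simp: cube_0)
    then have const: "continuous_map (cube_top n) (realization_top Q) (\<lambda>u. vertex_point Q v1)"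
      by simp
    have default: "continuous_map (cube_top n) (realization_top Q) (\<lambda>u. real_class Q n z u)" if "z \<in> cells Q n"
      using continuous_map_real_class[OF that] by simp
    from z show "continuous_map (cube_top n) (realization_top Q) (\<lambda>u. contraction (n, z, u))"
    proof (cases rule: cells_P_cases)
      case 3
      then have "z \<in> cells Q n" "z \<noteq> x"
        using Y_subset_Q x_notin_Y by auto
      then show ?thesis
        using default 3 by (simp add: contraction_def)
    next
      case 4
      then show ?thesis
        using default cells_R_subset(2) by (auto simp: default_on_R)
    qed (use const in \<open>simp_all add: contraction_def\<close>)
  qed (rule contraction_glue)
next
  fix n z a d \<alpha> assume z: "z \<in> cells P n" and less: "a < d" and \<alpha>: "monotone_cube_path n a d \<alpha>"
  have const: "piecewise_dpath Q (\<lambda>\<tau>. vertex_point Q v1) a d"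
    using v1_in_R cells_R_subset(2) less by (intro piecewise_dpath_vertex) auto
  from z have "piecewise_dpath Q (\<lambda>\<tau>. contraction (n, z, \<alpha> \<tau>)) a d"
  proof (cases rule: cells_P_cases)
    case 3
    then have "z \<in> cells Q n" "z \<noteq> x"
      using Y_subset_Q x_notin_Y by auto
    then have "piecewise_dpath Q (\<lambda>\<tau>. real_class Q n z (\<alpha> \<tau>)) a d"
      using less \<alpha> by (auto intro: piecewise_dpath.piece)
    then show ?thesis
      using 3 \<open>z \<noteq> x\<close> by (simp add: contraction_def)
  next
    case 4
    then show ?thesis
      using piecewise_dpath_default(2)[OF 4 less \<alpha>] by (simp add: default_on_R)
  qed (use const in \<open>simp_all add: contraction_def\<close>)
  then show "piecewise_dpath Q (\<lambda>\<tau>. contract_map (real_class P n z (\<alpha> \<tau>))) a d"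
    by (rule piecewise_dpath_cong) (simp add: contract_map_class[OF z monotone_cube_path_in_cube[OF \<alpha>]])
qed

lemma d_map_expand: "d_map (realization Q) (realization P) expand_map"
proof (rule d_map_realizationI)
  show "continuous_map (realization_top Q) (realization_top P) expand_map"
  proof (rule continuous_map_induced_map)
    fix n z assume z: "z \<in> cells Q n"
    then show "continuous_map (cube_top n) (realization_top P) (\<lambda>u. expansion (n, z, u))"
    proof (cases rule: cells_Q_cases)
      case 1
      have "continuous_map (cube_top 1) (top_of_set {0..1}) (\<lambda>u. u 1)"
        unfolding cube_top_def by (rule continuous_map_product_projection) simp
      then have "continuous_map (cube_top 1) euclideanreal (\<lambda>u. u 1)"
        by (rule continuous_map_into_fulltopology)
      then have "continuous_map (cube_top 1) euclideanreal (\<lambda>u. 2 * flip (u 1))"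
        by (intro continuous_map_real_mult continuous_map_flip) auto
      moreover have "2 * flip (u 1) \<in> {0..2}" if "u \<in> cube 1" for u
        using flip_in[OF cube_coordinate[OF that, of 1]] by simp
      ultimately have "continuous_map (cube_top 1) (realization_top P) (\<lambda>u. detour z (2 * flip (u 1)))"
        by (rule continuous_map_detour[OF 1(2)])
      then show ?thesis
        using 1 by (simp add: expansion_def)
    next
      case 2
      then show ?thesis
        using continuous_map_real_class[of z P n] cells_R_subset(1) by (auto simp: default_on_R)
    qed
  qed (rule expansion_glue)
next
  fix n z a d \<alpha> assume z: "z \<in> cells Q n" and less: "a < d" and \<alpha>: "monotone_cube_path n a d \<alpha>"
  from z have "piecewise_dpath P (\<lambda>\<tau>. expansion (n, z, \<alpha> \<tau>)) a d"
  proof (cases rule: cells_Q_cases)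
    case 1
    note \<alpha>' = monotone_cube_path_1[OF \<alpha>[unfolded 1]]
    have "piecewise_dpath P (\<lambda>\<tau>. detour z (2 * flip (\<alpha> \<tau> 1))) a d"
    proof (rule piecewise_dpath_detour[OF 1(2) less])
      show "continuous_on {a..d} (\<lambda>\<tau>. 2 * flip (\<alpha> \<tau> 1))"
        by (intro continuous_on_flip continuous_on_mult continuous_on_const \<alpha>'(1))
      show "mono_on {a..d} (\<lambda>\<tau>. flip (2 * flip (\<alpha> \<tau> 1)))"
        by (intro mono_on_flip_conj[OF _ \<alpha>'(2,3)] mono_onI mult_left_mono) auto
      show "2 * flip (\<alpha> \<tau> 1) \<in> {0..2}" if "\<tau> \<in> {a..d}" for \<tau>
        using flip_in[OF \<alpha>'(3)[OF that]] by simp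
    qed
    then show ?thesis
      using 1 by (simp add: expansion_def)
  next
    case 2
    then show ?thesis
      using piecewise_dpath_default(1)[OF 2 less \<alpha>] by (simp add: default_on_R)
  qed
  then show "piecewise_dpath P (\<lambda>\<tau>. expand_map (real_class Q n z (\<alpha> \<tau>))) a d"
    by (rule piecewise_dpath_cong) (simp add: expand_map_class[OF z monotone_cube_path_in_cube[OF \<alpha>]])
qed

section \<open>The ends of the homotopies\<close>

lemma retraction_0:
  assumes "c \<in> topspace (realization_top P)"
  shows "induced_map (retraction 0) c = expand_map (contract_map c)"
proof -
  obtain n z u where c: "z \<in> cells P n" "u \<in> cube n" "c = real_class P n z u"
    using assms by (rule realization_point_cases)
  have v1: "expand_map (vertex_point Q v1) = vertex_point P v1"
    using expand_map_class[of v1 0] v1_in_R cells_R_subset(2) by (auto simp: cube_0 default_on_R)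
  have "retraction 0 (n, z, u) = expand_map (contraction (n, z, u))"
    using c(1)
  proof (cases rule: cells_P_cases)
    case 3
    then have "z \<in> cells Q n" "z \<noteq> x"
      using Y_subset_Q x_notin_Y by auto
    then show ?thesis
      using 3 expand_map_class[of z n u] c(2)
      by (simp add: contraction_def retraction_def expansion_def mult.commute)
  next
    case 4
    then show ?thesis
      using expand_map_class[of z n u] cells_R_subset(2)[of n] c(2) by (auto simp: default_on_R)
  qed (use v1 edge_point_P_x in \<open>simp_all add: contraction_def retraction_def\<close>)
  then show ?thesis
    using c contract_map_class retraction_class[of 0] by simp
qed

lemma retraction_1:
  assumes "c \<in> topspace (realization_top P)"
  shows "induced_map (retraction 1) c = c"
proof -
  obtain n z u where c: "z \<in> cells P n" "u \<in> cube n" "c = real_class P n z u"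
    using assms by (rule realization_point_cases)
  have "retraction 1 (n, z, u) = real_class P n z u"
    using c(1)
  proof (cases rule: cells_P_cases)
    case 1
    then show ?thesis
      using c(2) real_class_edge[of u P x] by (simp add: retraction_def)
  next
    case 2
    then show ?thesis
      using c(2) edge_point_P_x by (simp add: retraction_def cube_0)
  next
    case 3
    \<comment> \<open>At time 1 the position on the detour is 1 + s, hence beyond \<open>v0\<close>,
      on the edge z itself and at distance s from its beginning.\<close>
    then have "flip (u 1) \<ge> 0" "z \<noteq> x"
      using flip_in[OF cube_coordinate[of u 1 1]] c(2) x_notin_Y by auto
    then show ?thesis
      using 3 c(2) detour_ge_1[OF 3(2), of "1 + flip (u 1)"] real_class_edge[of u P z]
      by (simp add: retraction_def)
  next
    case 4
    then show ?thesis
      by (simp add: default_on_R)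
  qed
  then show ?thesis
    using c retraction_class[of 1] by simp
qed

text \<open>The detour passes from \<open>x\<close> to z at s = 1/2. The first half is collapsed to
  \<open>v1\<close>, and there the maximum is 0; on the second half both sides are at distance 2s -
  1.\<close>

lemma reparametrization_0:
  assumes "c \<in> topspace (realization_top Q)"
  shows "induced_map (reparametrization 0) c = contract_map (expand_map c)"
proof -
  obtain n z u where c: "z \<in> cells Q n" "u \<in> cube n" "c = real_class Q n z u"
    using assms by (rule realization_point_cases)
  have "reparametrization 0 (n, z, u) = contract_map (expansion (n, z, u))"
    using c(1)
  proof (cases rule: cells_Q_cases)
    case 1
    let ?s = "flip (u 1)"
    have s: "?s \<in> {0..1}" and "z \<noteq> x"
      using flip_in[OF cube_coordinate[of u 1 1]] c(2) 1 x_notin_Y by auto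
    have contract_edge: "contract_map (edge_point P e r) = contraction (1, e, \<lambda>j\<in>{1..1}. r)"
      if "e \<in> cells P 1" "r \<in> {0..1}" for e r
      using contract_map_class[OF that(1) cube_1_restrict[OF that(2)]] by (simp add: edge_point_def)
    show ?thesis
    proof (cases "2 * ?s \<le> 1")
      case True
      then have "contract_map (detour z (2 * ?s)) = vertex_point Q v1"
        using contract_edge[OF x(1) flip_in, of "2 * ?s"] s by (simp add: detour_def contraction_def)
      moreover have "reparametrization 0 (n, z, u) = vertex_point Q v1"
        using 1 True edge_point_Q(1)[OF 1(2)] by (simp add: reparametrization_def max_def)
      ultimately show ?thesis
        using 1 by (simp add: expansion_def)
    next
      case False
      then have "contract_map (detour z (2 * ?s)) = edge_point Q z (flip (2 * ?s - 1))"
        using contract_edge[OF YD(1)[OF 1(2)] flip_in, of "2 * ?s - 1"] s \<open>z \<noteq> x\<close>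
        by (simp add: detour_def contraction_def edge_point_def)
      then show ?thesis
        using 1 False by (simp add: expansion_def reparametrization_def max_def)
    qed
  next
    case 2
    then show ?thesis
      using contract_map_class[of z n u] cells_R_subset(1)[of n] c(2) by (auto simp: default_on_R)
  qed
  then show ?thesis
    using c expand_map_class reparametrization_class[of 0] by simp
qed

lemma reparametrization_1:
  assumes "c \<in> topspace (realization_top Q)"
  shows "induced_map (reparametrization 1) c = c"
proof -
  obtain n z u where c: "z \<in> cells Q n" "u \<in> cube n" "c = real_class Q n z u"
    using assms by (rule realization_point_cases)
  have "reparametrization 1 (n, z, u) = real_class Q n z u"
    using c(1)
  proof (cases rule: cells_Q_cases)
    case 1
    then have "flip (u 1) \<ge> 0"
      using flip_in[OF cube_coordinate[of u 1 1]] c(2) by auto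
    then show ?thesis
      using 1 c(2) real_class_edge[of u Q z] by (simp add: reparametrization_def)
  next
    case 2
    then show ?thesis
      by (simp add: default_on_R)
  qed
  then show ?thesis
    using c reparametrization_class[of 1] by simp
qed

lemma maps_on_R:
  assumes "c \<in> topspace (realization_top R)"
  shows "contract_map (realization_incl P c) = realization_incl Q c"
    "expand_map (realization_incl Q c) = realization_incl P c"
    "t \<in> {0..1} \<Longrightarrow> induced_map (retraction t) (realization_incl P c) = realization_incl P c"
    "t \<in> {0..1} \<Longrightarrow> induced_map (reparametrization t) (realization_incl Q c) = realization_incl Q c"
proof -
  obtain n z u where c: "z \<in> cells R n" "u \<in> cube n" "c = real_class R n z u"
    using assms by (rule realization_point_cases)
  then have incl: "realization_incl P c = real_class P n z u" "realization_incl Q c = real_class Q n z u"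
    using realization_incl_real_class[OF subset_R_P] realization_incl_real_class[OF subset_R_Q] by auto
  have z: "z \<in> cells P n" "z \<in> cells Q n"
    using c(1) cells_R_subset by auto
  show "contract_map (realization_incl P c) = realization_incl Q c"
    "expand_map (realization_incl Q c) = realization_incl P c"
    "t \<in> {0..1} \<Longrightarrow> induced_map (retraction t) (realization_incl P c) = realization_incl P c"
    "t \<in> {0..1} \<Longrightarrow> induced_map (reparametrization t) (realization_incl Q c) = realization_incl Q c"
    unfolding incl
    using contract_map_class[OF z(1) c(2)] expand_map_class[OF z(2) c(2)] retraction_class[OF _ z(1) c(2)]
      reparametrization_class[OF _ z(2) c(2)] default_on_R[OF c(1)] by simp_all
qed

lemma incl_in_topspace:
  "realization_incl P ` topspace (realization_top R) \<subseteq> topspace (realization_top P)"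
  "realization_incl Q ` topspace (realization_top R) \<subseteq> topspace (realization_top Q)"
  using RP.d_map_realization_incl RQ.d_map_realization_incl
  by (auto simp: d_map_def continuous_map_def)

lemma dihomotopic_P:
  "dihomotopic_rel (realization_incl P ` topspace (realization_top R)) (realization P) (realization P)
     (expand_map \<circ> contract_map) id"
proof (rule dihomotopic_relI)
  fix t :: real and a assume "t \<in> {0..1}" "a \<in> realization_incl P ` topspace (realization_top R)"
  then show "(case (t, a) of (t, c) \<Rightarrow> induced_map (retraction t) c) = (expand_map \<circ> contract_map) a \<and>
      (case (t, a) of (t, c) \<Rightarrow> induced_map (retraction t) c) = id a"
    using maps_on_R by auto
qed (use continuous_map_retraction retraction_0 retraction_1 d_map_retraction incl_in_topspace in auto)

lemma dihomotopic_Q: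
  "dihomotopic_rel (realization_incl Q ` topspace (realization_top R)) (realization Q) (realization Q)
     (contract_map \<circ> expand_map) id"
proof (rule dihomotopic_relI)
  fix t :: real and a assume "t \<in> {0..1}" "a \<in> realization_incl Q ` topspace (realization_top R)"
  then show "(case (t, a) of (t, c) \<Rightarrow> induced_map (reparametrization t) c) = (contract_map \<circ> expand_map) a \<and>
      (case (t, a) of (t, c) \<Rightarrow> induced_map (reparametrization t) c) = id a"
    using maps_on_R by auto
qed (use continuous_map_reparametrization reparametrization_0 reparametrization_1 d_map_reparametrization
    incl_in_topspace in auto)

lemma dihomotopy_equivalent_P_Q:
  "dihomotopy_equivalent_rel (realization R) (realization_incl P) (realization_incl Q)
     (realization P) (realization Q)"
  unfolding dihomotopy_equivalent_rel_def dihomotopy_equivalence_rel_def dtop_realization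
  using RP.d_embedding_realization_incl RQ.d_embedding_realization_incl d_map_contract d_map_expand
    maps_on_R(1,2) dihomotopic_P dihomotopic_Q by blast

subsection \<open>Extremal vertices\<close>

text \<open>For k = b the loss of \<open>x\<close>, an edge at \<open>v1\<close>, is made up for by
  the edges of \<open>Y\<close>, whose b-end is now \<open>v1\<close>; this is where
  \<open>Y \<noteq> {}\<close> enters, since otherwise \<open>v1\<close> could become extremal. For
  the other k no operator changes, and that end of \<open>x\<close> is \<open>v0\<close>, not
  v.\<close>

lemma has_edge_iff:
  assumes "Y \<noteq> {}" "v \<noteq> v0" "k \<in> {0,1}"
  shows "(\<exists>e\<in>cells P 1. bdry P 1 k 1 e = v) \<longleftrightarrow> (\<exists>e\<in>cells Q 1. bdry Q 1 k 1 e = v)"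
proof (cases "k = b")
  case True
  obtain y where y: "y \<in> Y"
    using assms(1) by blast
  show ?thesis
  proof
    assume "\<exists>e\<in>cells P 1. bdry P 1 k 1 e = v"
    then obtain e where e: "e \<in> cells P 1" "bdry P 1 b 1 e = v"
      using True by blast
    show "\<exists>e\<in>cells Q 1. bdry Q 1 k 1 e = v"
    proof (cases "e = x")
      case eq: True
      then show ?thesis
        using e v1 y Y_subset_Q bdry_Q(1)[OF y] True by auto
    next
      case False
      have "e \<notin> Y"
        using e assms(2) YD(2) by auto
      then show ?thesis
        using e True False bdry_Q(2)[of 1 e 1 b] cells_Q(2) by auto
    qed
  next
    assume "\<exists>e\<in>cells Q 1. bdry Q 1 k 1 e = v"
    then obtain e where e: "e \<in> cells Q 1" "bdry Q 1 b 1 e = v"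
      using True by blast
    then show "\<exists>e\<in>cells P 1. bdry P 1 k 1 e = v"
      using x(1) v1 bdry_Q(1)[of e] bdry_Q(2)[of 1 e 1 b] cells_Q(2) True by (cases "e \<in> Y") auto
  qed
next
  case False
  then have "bdry Q 1 k 1 e = bdry P 1 k 1 e" for e
    by (intro bdry_Q) simp
  moreover have "bdry P 1 k 1 x \<noteq> v"
    using b'(3)[OF assms(3)] False v0 assms(2) by auto
  ultimately show ?thesis
    using cells_Q(2) by auto
qed

text \<open>\<open>x\<close> and an edge of \<open>Y\<close> meet \<open>v0\<close> from opposite
  sides, so no extremal vertex is lost when \<open>v0\<close> is removed.\<close>

lemma v0_not_extremal:
  assumes "Y \<noteq> {}" "k \<in> {0,1}"
  shows "\<exists>e\<in>cells P 1. bdry P 1 k 1 e = v0"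
  using assms(1) b'(3)[OF assms(2)] YD x(1) v0 by auto

lemma extremal_vertex_iff:
  assumes "Y \<noteq> {}"
  shows "minimal_vertex P v \<longleftrightarrow> minimal_vertex Q v" "maximal_vertex P v \<longleftrightarrow> maximal_vertex Q v"
  using has_edge_iff[OF assms, of v 0] has_edge_iff[OF assms, of v 1]
    v0_not_extremal[OF assms, of 0] v0_not_extremal[OF assms, of 1]
  by (cases "v = v0"; simp add: minimal_vertex_def maximal_vertex_def cells_Q(1))+

text \<open>An equality of records: degree 0 has no operators to compare and higher degrees have no
  cells, so equal vertex sets suffice.\<close>

lemma Extrl_eq:
  assumes "Y \<noteq> {}"
  shows "Extrl P = Extrl Q"
  unfolding Extrl_def restrict_cells_def using extremal_vertex_iff[OF assms] by (auto simp: fun_eq_iff)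

lemma cells_Extrl_subset: "cells (Extrl Q) n \<subseteq> cells R n"
  by (auto simp: cells_Extrl cells_R cells_Q minimal_vertex_def maximal_vertex_def)

lemma Extrl_subset_R: "precubical_subset (Extrl Q) R"
  using cells_Extrl_subset precubical_R
  by (auto simp: precubical_subset_def precubical_set_def[of "Extrl Q"] cells_Extrl)

lemma vertex_point_incl:
  assumes "v \<in> cells R 0"
  shows "vertex_point P v \<in> realization_incl P ` topspace (realization_top R)"
    "contract_map (vertex_point P v) = vertex_point Q v"
proof -
  let ?c = "vertex_point R v"
  have c: "?c \<in> topspace (realization_top R)"
    using assms by (intro real_class_in_topspace) (auto simp: cube_0)
  have incl: "realization_incl P ?c = vertex_point P v" "realization_incl Q ?c = vertex_point Q v"
    using realization_incl_real_class[OF subset_R_P assms] realization_incl_real_class[OF subset_R_Q assms]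
    by (simp_all add: cube_0)
  show "vertex_point P v \<in> realization_incl P ` topspace (realization_top R)"
    using c incl(1) by (metis imageI)
  show "contract_map (vertex_point P v) = vertex_point Q v"
    using maps_on_R(1)[OF c] incl by simp
qed

lemma contract_map_image:
  "contract_map ` realization_incl P ` topspace (realization_top R)
    = realization_incl Q ` topspace (realization_top R)"
  unfolding image_image by (rule image_cong) (auto simp: maps_on_R)

lemma expand_contract_on_R:
  "c \<in> realization_incl P ` topspace (realization_top R) \<Longrightarrow> expand_map (contract_map c) = c"
  by (auto simp: maps_on_R)

lemma isomorphic_bipartite_graphs:
  assumes "Y \<noteq> {}"
  shows "isomorphic_categories (fundamental_bipartite_graph (realization P))
     (fundamental_bipartite_graph (realization Q))"
proof -
  let ?A = "realization_incl P ` topspace (realization_top R)"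
  let ?S = "extremal_points (realization P)"
  have cells: "cells (Extrl P) 0 \<subseteq> cells R 0"
    using cells_Extrl_subset Extrl_eq[OF assms] by simp
  then have S: "?S \<subseteq> ?A"
    unfolding extremal_points_realization[OF P] using vertex_point_incl(1) by blast
  \<comment> \<open>The contraction fixes the vertices of \<open>R\<close>, and the extremal
    vertices of \<open>P\<close> and \<open>Q\<close> are the same, so extremal points
    correspond.\<close>
  have "contract_map ` ?S = extremal_points (realization Q)"
    unfolding extremal_points_realization[OF P] extremal_points_realization[OF precubical_Q] image_image
    using cells by (intro image_cong) (auto simp: Extrl_eq[OF assms] vertex_point_incl(2))
  then show ?thesis
    using isomorphic_full_subcategories[OF d_map_contract d_map_expand dihomotopic_P
        expand_contract_on_R _ S] dihomotopic_Q S incl_in_topspace(1)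
    by (simp add: fundamental_bipartite_graph_def contract_map_image)
qed

lemma homotopy_equivalent_dpath_spaces:
  assumes "Y \<noteq> {}" "v \<in> cells (Extrl P) 0" "w \<in> cells (Extrl P) 0"
  shows "dpath_space (realization P) (vertex_point P v) (vertex_point P w)
    homotopy_equivalent_space dpath_space (realization Q) (vertex_point Q v) (vertex_point Q w)"
proof -
  have vw: "v \<in> cells R 0" "w \<in> cells R 0"
    using assms cells_Extrl_subset Extrl_eq by auto
  show ?thesis
    using homotopy_equivalent_dpath_space[OF d_map_contract d_map_expand dihomotopic_P
        expand_contract_on_R _ vertex_point_incl(1)[OF vw(1)] vertex_point_incl(1)[OF vw(2)]]
      dihomotopic_Q vertex_point_incl(2)[OF vw(1)] vertex_point_incl(2)[OF vw(2)]
    by (simp add: contract_map_image)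
qed

end

theorem theorem5p1:
  fixes P Q R :: "'a precubical" and b :: nat and x :: 'a and Y :: "'a set"
  assumes P: "precubical_set P"
    and b: "b \<in> {0, 1}"
    and x: "x \<in> cells P 1" "regular P 1 x"
    and i: "\<not> (\<exists>y \<in> cells P 1 - {x}. bdry P 1 (1 - b) 1 y = bdry P 1 (1 - b) 1 x)"
    and ii: "\<not> (\<exists>e \<in> cells P 1. in_boundary P 0 (bdry P 1 (1 - b) 1 x) 1 e \<and>
                  (\<exists>z \<in> cells P 2. in_boundary P 1 e 2 z))"
    and Y: "Y = {y \<in> cells P 1. bdry P 1 b 1 y = bdry P 1 (1 - b) 1 x}"
    and Q: "Q = \<lparr>cells = (\<lambda>n. if n = 0 then cells P 0 - {bdry P 1 (1 - b) 1 x}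
                             else if n = 1 then cells P 1 - {x} else cells P n),
                 bdry = (\<lambda>n k i z. if n = 1 \<and> z \<in> Y \<and> i = 1 \<and> k = b then bdry P 1 b 1 x
                                    else bdry P n k i z)\<rparr>"
    and R: "R = remove_cells Q (\<lambda>n. if n = 1 then Y else {})"
  shows "precubical_set Q \<and> Y \<subseteq> cells Q 1 \<and>
         precubical_subset R P \<and> precubical_subset R Q \<and>
         dihomotopy_equivalent_rel (realization R) (realization_incl P) (realization_incl Q)
           (realization P) (realization Q) \<and>
         (Y \<noteq> {} \<longrightarrow>
            Extrl P = Extrl Q \<and> precubical_subset (Extrl Q) R \<and>
            isomorphic_categories (fundamental_bipartite_graph (realization P))
              (fundamental_bipartite_graph (realization Q)) \<and>
            (\<forall>v \<in> cells (Extrl P) 0. \<forall>w \<in> cells (Extrl P) 0.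
               dpath_space (realization P) (vertex_point P v) (vertex_point P w)
                 homotopy_equivalent_space
               dpath_space (realization Q) (vertex_point Q v) (vertex_point Q w)))"
proof -
  interpret edge_contraction P b x "bdry P 1 (1 - b) 1 x" "bdry P 1 b 1 x" Y Q R
  proof
    fix e z and k l i :: nat
    assume e: "e \<in> cells P 1" "k \<in> {0,1}" "bdry P 1 k 1 e = bdry P 1 (1 - b) 1 x"
      and z: "z \<in> cells P 2" "l \<in> {0,1}" "i \<in> {1..2::nat}"
    \<comment> \<open>A single operator already witnesses \<open>in_boundary\<close>, so a square
      with face e would contradict (ii).\<close>
    have "in_boundary P 0 (bdry P 1 k 1 e) 1 e"
      using in_boundary.face[of 1 k 1 e P] e by simp
    moreover have "in_boundary P 1 (bdry P 2 l i z) 2 z"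
      using in_boundary.face[of 2 l i z P] z by (simp add: One_nat_def)
    ultimately show "bdry P 2 l i z \<noteq> e"
      using ii e z(1) by auto
  qed (use assms in auto)
  show ?thesis
    using precubical_Q Y_subset_Q subset_R_P subset_R_Q dihomotopy_equivalent_P_Q Extrl_eq Extrl_subset_R
      isomorphic_bipartite_graphs homotopy_equivalent_dpath_spaces by blast
qed

end
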